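(* Let $\Omega\subset\mathbb{R}^{d}$ be open, let $T\in\mathcal{E}'(\Omega)$, let $k\in\mathbb{N}$ and $s>0$, and let $(T\ast\phi_{n})$ be a regularization sequence, where $\phi_{n}(x)=n^{d}\phi(nx)$ and $\phi\in\mathcal{S}(\mathbb{R}^{d})$ is a fixed function with $\int_{\mathbb{R}^{d}}\phi(x)\,dx=1$. Then $$\big((T\ast\phi_{n})_{|\Omega}\big)\in\mathcal{E}^{k,s}_{\mathbb{N}}(\Omega)\iff T\in C^{k-s}_{\ast}(\mathbb{R}^{d}).$$
   Context: $\mathbb{N}$ includes $0$; sequences are indexed by integers $n\geq1$. $\mathcal{E}'(\Omega)$ is the space of compactly supported distributions on $\Omega$; such a $T$ is regarded as a distribution on $\mathbb{R}^{d}$ (extended by zero), so that $T\ast\phi_{n}$ is smooth on $\mathbb{R}^{d}$. We write $\omega\subset\subset\Omega$ if $\omega$ has compact closure contained in $\Omega$. The class $\mathcal{E}^{k,s}_{\mathbb{N}}(\Omega)$: the set of all sequences $(f_{n})$ of $C^{k}$ functions on $\Omega$ such that for every $\omega\subset\subset\Omega$ and every $m\in\mathbb{N}^{d}$ with $|m|\leq k$ one has $\sup_{x\in\omega}|\partial^{m}f_{n}(x)|=O(n^{s})$ as $n\to\infty$. The global Zygmund space $C^{\beta}_{\ast}(\mathbb{R}^{d})$, $\beta\in\mathbb{R}$: let $\varepsilon>0$ and choose $\theta_{1},\theta\in\mathcal{S}(\mathbb{R}^{d})$ with $|\hat{\theta}_{1}(u)|>0$ for $|u|\leq2\varepsilon$,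 $|\hat{\theta}(u)|>0$ for $\varepsilon/2\leq|u|\leq2\varepsilon$, and $\int_{\mathbb{R}^{d}}x^{m}\theta(x)\,dx=0$ for all multi-indices $|m|\leq[\beta]$, where $[\beta]$ is the integral part of $\beta$ (no moment condition is required if $\beta<0$). Put $\theta_{2^{0}}=\theta_{1}$ and $\theta_{2^{j}}(x)=2^{jd}\theta(2^{j}x)$ for $j\geq1$. Then $C^{\beta}_{\ast}(\mathbb{R}^{d})$ is the space of all $T\in\mathcal{S}'(\mathbb{R}^{d})$ with $$\sup_{x\in\mathbb{R}^{d},\,j\geq0}2^{\beta j}|(T\ast\theta_{2^{j}})(x)|<\infty.$$ It is known that this space does not depend on the choice of $\varepsilon,\theta_{1},\theta$ satisfying these conditions. *)

theory Defs
  imports "HOL-Analysis.Analysis"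
begin

text \<open>
  The space \<open>\<real>\<^sup>d\<close> is \<^typ>\<open>real ^ 'd\<close>, and all functions are complex valued.
  A function on a subset \<open>\<Omega>\<close> is represented by a function on the whole space of which only the
  values on \<open>\<Omega>\<close> matter.
\<close>

subsection \<open>Multi-indices, partial derivatives and functions of class \<open>C\<^sup>k\<close>\<close>

type_synonym 'd multi_index = "'d \<Rightarrow> nat"

definition mi_order :: "'d::finite multi_index \<Rightarrow> nat" where
  "mi_order m = (\<Sum>i\<in>UNIV. m i)"

definition monomial :: "'d::finite multi_index \<Rightarrow> real ^ 'd \<Rightarrow> real" where
  "monomial m x = (\<Prod>i\<in>UNIV. (x $ i) ^ m i)"

definition partial :: "'d::finite \<Rightarrow> (real ^ 'd \<Rightarrow> complex) \<Rightarrow> real ^ 'd \<Rightarrow> complex" where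
  "partial i f x = vector_derivative (\<lambda>t. f (x + t *\<^sub>R axis i 1)) (at 0)"

text \<open>
  The index type carries no order, so the partial derivatives in \<open>\<partial>\<^sup>m\<close> are taken in the order of
  some fixed enumeration of the coordinates; for functions of class \<open>C\<^sup>k\<close> and \<open>|m| \<le> k\<close> the order
  is irrelevant.
\<close>

definition coordinates :: "'d::finite list" where
  "coordinates = (SOME is. distinct is \<and> set is = UNIV)"

definition mderiv :: "'d::finite multi_index \<Rightarrow> (real ^ 'd \<Rightarrow> complex) \<Rightarrow> real ^ 'd \<Rightarrow> complex" where
  "mderiv m f = fold (\<lambda>i. partial i ^^ m i) coordinates f"

text \<open>Intended for open \<open>\<Omega>\<close>.\<close>

primrec Ck :: "nat \<Rightarrow> (real ^ 'd::finite) set \<Rightarrow> (real ^ 'd \<Rightarrow> complex) set" where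
  "Ck 0 \<Omega> = {f. continuous_on \<Omega> f}"
| "Ck (Suc k) \<Omega> = {f. continuous_on \<Omega> f \<and>
     (\<forall>i. (\<forall>x\<in>\<Omega>. (\<lambda>t. f (x + t *\<^sub>R axis i 1)) differentiable at 0) \<and> partial i f \<in> Ck k \<Omega>)}"

definition smooth :: "(real ^ 'd::finite) set \<Rightarrow> (real ^ 'd \<Rightarrow> complex) set" where
  "smooth \<Omega> = (\<Inter>k. Ck k \<Omega>)"

subsection \<open>Test functions and Schwartz functions\<close>

definition test_functions :: "(real ^ 'd::finite) set \<Rightarrow> (real ^ 'd \<Rightarrow> complex) set" where
  "test_functions A =
     {f \<in> smooth UNIV. compact (closure {x. f x \<noteq> 0}) \<and> closure {x. f x \<noteq> 0} \<subseteq> A}"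

definition schwartz :: "(real ^ 'd::finite \<Rightarrow> complex) set" where
  "schwartz = {f \<in> smooth UNIV. \<forall>a m. bounded (range (\<lambda>x. monomial a x *\<^sub>R mderiv m f x))}"

definition fourier :: "(real ^ 'd::finite \<Rightarrow> complex) \<Rightarrow> real ^ 'd \<Rightarrow> complex" where
  "fourier f u = (LINT x|lborel. cis (- (u \<bullet> x)) * f x)"

text \<open>\<open>dilate a f\<close> is the function \<open>x \<mapsto> a\<^sup>d f(a x)\<close>.\<close>

definition dilate :: "real \<Rightarrow> (real ^ 'd::finite \<Rightarrow> complex) \<Rightarrow> real ^ 'd \<Rightarrow> complex" where
  "dilate a f x = of_real (a ^ CARD('d)) * f (a *\<^sub>R x)"

subsection \<open>Distributions\<close>

text \<open>
  Distributions are represented by functionals on all functions, of which only the values on the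
  relevant space of test functions matter.  Continuity is expressed by the usual seminorm estimates.
\<close>

type_synonym 'd functional = "(real ^ 'd \<Rightarrow> complex) \<Rightarrow> complex"

definition linear_on_space :: "(real ^ 'd::finite \<Rightarrow> complex) set \<Rightarrow> 'd functional \<Rightarrow> bool" where
  "linear_on_space V T \<longleftrightarrow>
     (\<forall>f\<in>V. \<forall>g\<in>V. \<forall>a b. T (\<lambda>x. a * f x + b * g x) = a * T f + b * T g)"

definition distributions :: "(real ^ 'd::finite) set \<Rightarrow> 'd functional set" where
  "distributions \<Omega> = {T. linear_on_space (test_functions \<Omega>) T \<and>
     (\<forall>K. compact K \<and> K \<subseteq> \<Omega> \<longrightarrow> (\<exists>C N. \<forall>f\<in>test_functions K.
        norm (T f) \<le> C * (\<Sum>m\<in>{m. mi_order m \<le> N}. SUP x. norm (mderiv m f x))))}"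

definition tempered_distributions :: "'d::finite functional set" where
  "tempered_distributions = {T. linear_on_space schwartz T \<and>
     (\<exists>C N. \<forall>f\<in>schwartz. norm (T f) \<le>
        C * (\<Sum>a\<in>{a. mi_order a \<le> N}. \<Sum>m\<in>{m. mi_order m \<le> N}.
               SUP x. norm (monomial a x *\<^sub>R mderiv m f x)))}"

definition dist_support :: "(real ^ 'd::finite) set \<Rightarrow> 'd functional \<Rightarrow> (real ^ 'd) set" where
  "dist_support \<Omega> T =
     {x\<in>\<Omega>. \<forall>U. open U \<and> x \<in> U \<and> U \<subseteq> \<Omega> \<longrightarrow> (\<exists>f\<in>test_functions U. T f \<noteq> 0)}"

definition compact_distributions :: "(real ^ 'd::finite) set \<Rightarrow> 'd functional set" where
  "compact_distributions \<Omega> = {T \<in> distributions \<Omega>. compact (dist_support \<Omega> T)}"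

text \<open>
  The extension by zero of a compactly supported distribution \<open>T\<close> on \<open>\<Omega>\<close>, as a functional on all
  smooth functions on \<open>\<real>\<^sup>d\<close>: \<open>f \<mapsto> T(\<eta> f)\<close>, where \<open>\<eta>\<close> is a test function on \<open>\<Omega>\<close> which equals 1 in a
  neighbourhood of the support of \<open>T\<close>.  The result does not depend on the choice of \<open>\<eta>\<close>.
\<close>

definition cutoff :: "(real ^ 'd::finite) set \<Rightarrow> 'd functional \<Rightarrow> real ^ 'd \<Rightarrow> complex" where
  "cutoff \<Omega> T = (SOME \<eta>. \<eta> \<in> test_functions \<Omega> \<and>
     (\<exists>V. open V \<and> dist_support \<Omega> T \<subseteq> V \<and> (\<forall>x\<in>V. \<eta> x = 1)))"

definition zero_extension :: "(real ^ 'd::finite) set \<Rightarrow> 'd functional \<Rightarrow> 'd functional" where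
  "zero_extension \<Omega> T f = T (\<lambda>x. cutoff \<Omega> T x * f x)"

definition dist_conv :: "'d::finite functional \<Rightarrow> (real ^ 'd \<Rightarrow> complex) \<Rightarrow> real ^ 'd \<Rightarrow> complex" where
  "dist_conv T f x = T (\<lambda>y. f (x - y))"

subsection \<open>The class \<open>\<E>\<^sup>k\<^sup>,\<^sup>s(\<Omega>)\<close> of sequences\<close>

text \<open>
  The sequences are indexed by \<open>n \<ge> 1\<close>.  The condition
  \<open>sup\<^sub>x\<^sub>\<in>\<^sub>\<omega> |\<partial>\<^sup>m f\<^sub>n(x)| = O(n\<^sup>s)\<close> is written as a pointwise bound that is uniform on \<open>\<omega>\<close>.
\<close>

definition seq_class ::
    "nat \<Rightarrow> real \<Rightarrow> (real ^ 'd::finite) set \<Rightarrow> (nat \<Rightarrow> real ^ 'd \<Rightarrow> complex) set" where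
  "seq_class k s \<Omega> = {f. (\<forall>n\<ge>1. f n \<in> Ck k \<Omega>) \<and>
     (\<forall>\<omega> m. compact (closure \<omega>) \<and> closure \<omega> \<subseteq> \<Omega> \<and> mi_order m \<le> k \<longrightarrow>
        (\<exists>C. \<forall>\<^sub>F n in sequentially. \<forall>x\<in>\<omega>. norm (mderiv m (f n) x) \<le> C * real n powr s))}"

subsection \<open>Global Zygmund spaces\<close>

text \<open>For \<open>\<beta> < 0\<close> we have \<open>\<lfloor>\<beta>\<rfloor> < 0\<close>, so there is no moment condition.\<close>

definition zygmund_window ::
    "real \<Rightarrow> real \<Rightarrow> (real ^ 'd::finite \<Rightarrow> complex) \<Rightarrow> (real ^ 'd \<Rightarrow> complex) \<Rightarrow> bool" where
  "zygmund_window \<beta> \<epsilon> \<theta>1 \<theta> \<longleftrightarrow>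
     \<epsilon> > 0 \<and> \<theta>1 \<in> schwartz \<and> \<theta> \<in> schwartz \<and>
     (\<forall>u. norm u \<le> 2 * \<epsilon> \<longrightarrow> norm (fourier \<theta>1 u) > 0) \<and>
     (\<forall>u. \<epsilon> / 2 \<le> norm u \<and> norm u \<le> 2 * \<epsilon> \<longrightarrow> norm (fourier \<theta> u) > 0) \<and>
     (\<forall>m. int (mi_order m) \<le> \<lfloor>\<beta>\<rfloor> \<longrightarrow> (LINT x|lborel. monomial m x *\<^sub>R \<theta> x) = 0)"

definition dyadic ::
    "(real ^ 'd::finite \<Rightarrow> complex) \<Rightarrow> (real ^ 'd \<Rightarrow> complex) \<Rightarrow> nat \<Rightarrow> real ^ 'd \<Rightarrow> complex" where
  "dyadic \<theta>1 \<theta> j = (if j = 0 then \<theta>1 else dilate (2 ^ j) \<theta>)"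

text \<open>
  The space \<open>C\<^sup>\<beta>\<^sub>*(\<real>\<^sup>d)\<close> as defined by the functions \<open>\<theta>1\<close>, \<open>\<theta>\<close>.  It is the same for all
  \<open>\<epsilon>\<close>, \<open>\<theta>1\<close>, \<open>\<theta>\<close> with \<open>zygmund_window \<beta> \<epsilon> \<theta>1 \<theta>\<close>.
\<close>

definition zygmund ::
    "real \<Rightarrow> (real ^ 'd::finite \<Rightarrow> complex) \<Rightarrow> (real ^ 'd \<Rightarrow> complex) \<Rightarrow> 'd functional set" where
  "zygmund \<beta> \<theta>1 \<theta> = {T \<in> tempered_distributions.
     bdd_above (range (\<lambda>(x, j). 2 powr (\<beta> * real j) * norm (dist_conv T (dyadic \<theta>1 \<theta> j) x)))}"

end

theory Submission
  imports Defs "HOL-Probability.Probability"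
begin

text \<open>
  Cutting off turns \<open>T\<close> into a functional that is controlled by finitely many derivatives on a compact
  set, and the theorem is a statement about the seminorms \<open>p(\<psi>) = sup\<^sub>x |(T * \<psi>)(x)|\<close>, which satisfy
  \<open>p(\<psi> * h) \<le> p(\<psi>) \<parallel>h\<parallel>\<^sub>1\<close>.  By a Littlewood--Paley decomposition, \<open>p(\<psi>)\<close> is at most
  \<open>p(\<psi> * \<Phi>) + (\<Sum>l\<ge>1. p(\<psi> * \<Delta>\<^sub>l))\<close>, where the Fourier transform of \<open>\<Delta>\<^sub>l(x) = 2\<^sup>l\<^sup>d \<Delta>(2\<^sup>l x)\<close> lives on an annulus of
  radius about \<open>2\<^sup>l\<close>.  There one can divide by a nonvanishing Fourier transform: \<open>\<Delta> = \<kappa> * \<phi>\<^sub>R\<close> with \<open>R\<close>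
  large (since \<open>\<phi>\<close> has integral 1), and \<open>\<Delta> = \<kappa> * \<theta>\<close> by the assumption on \<open>\<theta>\<close>; hence \<open>p(\<psi> * \<Delta>\<^sub>l)\<close> is
  at most \<open>p(\<phi>\<^sub>n) \<parallel>\<psi> * \<kappa>\<^sub>l\<parallel>\<^sub>1\<close> with \<open>n = 2\<^sup>l R\<close>, respectively \<open>p(\<theta>\<^sub>l) \<parallel>\<psi> * \<kappa>\<^sub>l\<parallel>\<^sub>1\<close>.  The last norm decays
  geometrically in the distance of the two scales, because \<open>\<kappa>\<close> is a sum of derivatives of any given order and
  because \<open>\<theta>\<close> has vanishing moments; this makes the sums converge.  Away from the support
  of \<open>T\<close> the functions \<open>T * \<phi>\<^sub>n\<close> decay rapidly in \<open>n\<close>, so that local bounds are global ones.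
\<close>

subsection \<open>Functions of class \<open>C\<^sup>k\<close>\<close>

text \<open>The Fourier transform of \<open>T\<close> never occurs: \<open>T\<close> enters through
  linearity and a bound on finitely many derivatives over a compact set, and all frequency analysis
  takes place on Schwartz functions. Fourier inversion enters through its value at the origin, which
  normalizes \<Phi> to integral 1; \<Delta> and \<kappa> are constructed as inverse transforms in
  the first place. The exponents arise as follows. A piece at frequency 2^l is a sum of k-fold
  derivatives divided by 2^(l k), and n is comparable to 2^l, so a bound n^s on the k-th derivatives
  becomes 2^(-l (k-s)). Seen from scale j, the range l < j requires a gain of order above k-s,
  supplied by the moments of \<theta>, and the range l > j one above s-k, supplied by repeated
  differentiation. In the converse direction the derivatives fall on \<kappa> when 2^l is below n
  and cost 2^(l k), so that 2^(l s) is summed over those l; the last term, of size n^s, dominates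
  because s is positive. Positivity of s also absorbs the low frequency part, which is merely
  bounded in n.\<close>

lemma has_partial_Ck:
  assumes "f \<in> Ck (Suc k) \<Omega>" "x \<in> \<Omega>"
  shows "((\<lambda>t. f (x + t *\<^sub>R axis i 1)) has_vector_derivative partial i f x) (at 0)"
  using assms by (auto simp: partial_def vector_derivative_works[symmetric])

lemma partial_Ck: "f \<in> Ck (Suc k) \<Omega> \<Longrightarrow> partial i f \<in> Ck k \<Omega>"
  by simp

lemma continuous_on_Ck: "f \<in> Ck k \<Omega> \<Longrightarrow> continuous_on \<Omega> f"
  by (cases k) auto

lemma partial_eqI:
  "((\<lambda>t. f (x + t *\<^sub>R axis i 1)) has_vector_derivative d) (at 0) \<Longrightarrow> partial i f x = d"
  by (simp add: partial_def vector_derivative_at)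

lemma has_vector_derivative_line_cong:
  fixes x :: "real ^ 'd::finite"
  assumes "open \<Omega>" "x \<in> \<Omega>" "\<And>y. y \<in> \<Omega> \<Longrightarrow> f y = g y"
    "((\<lambda>t. f (x + t *\<^sub>R axis i 1)) has_vector_derivative d) (at 0)"
  shows "((\<lambda>t. g (x + t *\<^sub>R axis i 1)) has_vector_derivative d) (at 0)"
proof (rule has_vector_derivative_transform_within_open[OF assms(4)])
  show "open ((\<lambda>t. x + t *\<^sub>R axis i 1) -` \<Omega>)"
    by (intro open_vimage assms continuous_intros)
qed (use assms in auto)

text \<open>Since \<open>vector_derivative\<close> is a choice, the two values agree even where no
  derivative exists: both sides choose from the same set of candidates.\<close>

lemma partial_cong:
  fixes x :: "real ^ 'd::finite"
  assumes "open \<Omega>" "x \<in> \<Omega>" "\<And>y. y \<in> \<Omega> \<Longrightarrow> f y = g y"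
  shows "partial i f x = partial i g x"
proof -
  have "((\<lambda>t. f (x + t *\<^sub>R axis i 1)) has_vector_derivative d) (at 0) \<longleftrightarrow>
      ((\<lambda>t. g (x + t *\<^sub>R axis i 1)) has_vector_derivative d) (at 0)" for d
    using has_vector_derivative_line_cong[of \<Omega> x f g] has_vector_derivative_line_cong[of \<Omega> x g f] assms
    by metis
  then show ?thesis
    by (simp add: partial_def vector_derivative_def)
qed

lemma Ck_cong:
  assumes "open \<Omega>" "\<And>y. y \<in> \<Omega> \<Longrightarrow> f y = g y" "f \<in> Ck k \<Omega>"
  shows "g \<in> Ck k \<Omega>"
  using assms(2,3)
proof (induction k arbitrary: f g)
  case 0
  then show ?case by (auto cong: continuous_on_cong)
next
  case (Suc k)
  have "((\<lambda>t. g (x + t *\<^sub>R axis i 1)) has_vector_derivative partial i f x) (at 0)" if "x \<in> \<Omega>" for x i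
    using has_vector_derivative_line_cong[OF \<open>open \<Omega>\<close> that, of f g] Suc.prems has_partial_Ck that by blast
  moreover have "partial i g \<in> Ck k \<Omega>" for i
    using Suc.IH[of "partial i f" "partial i g"] partial_cong[OF \<open>open \<Omega>\<close>, of _ f g] Suc.prems by auto
  moreover have "continuous_on \<Omega> g"
    using Suc.prems by (auto cong: continuous_on_cong)
  ultimately show ?case
    by (auto simp: differentiable_def has_vector_derivative_def)
qed

text \<open>For building up members of \<open>Ck\<close>: the partial derivatives are supplied as
  explicit functions, to which an induction hypothesis can be applied directly.\<close>

lemma Ck_SucI:
  assumes "open \<Omega>" "continuous_on \<Omega> f" "\<And>i. g i \<in> Ck k \<Omega>"
    "\<And>i x. x \<in> \<Omega> \<Longrightarrow> ((\<lambda>t. f (x + t *\<^sub>R axis i 1)) has_vector_derivative g i x) (at 0)"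
  shows "f \<in> Ck (Suc k) \<Omega>"
proof -
  have "partial i f \<in> Ck k \<Omega>" for i
    by (rule Ck_cong[OF assms(1) _ assms(3)[of i]]) (simp add: partial_eqI[OF assms(4)])
  moreover have "\<forall>x\<in>\<Omega>. (\<lambda>t. f (x + t *\<^sub>R axis i 1)) differentiable at 0" for i
    using assms(4) by (force simp: differentiable_def has_vector_derivative_def)
  ultimately show ?thesis using assms(2) by auto
qed

lemma Ck_Suc_subset: "f \<in> Ck (Suc k) \<Omega> \<Longrightarrow> f \<in> Ck k \<Omega>"
  by (induction k arbitrary: f) auto

lemma Ck_subset: "f \<in> Ck k \<Omega> \<Longrightarrow> \<Omega>' \<subseteq> \<Omega> \<Longrightarrow> f \<in> Ck k \<Omega>'"
  by (induction k arbitrary: f) (auto intro: continuous_on_subset)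

lemma Ck_Un:
  "open \<Omega> \<Longrightarrow> open \<Omega>' \<Longrightarrow> f \<in> Ck k \<Omega> \<Longrightarrow> f \<in> Ck k \<Omega>' \<Longrightarrow> f \<in> Ck k (\<Omega> \<union> \<Omega>')"
  by (induction k arbitrary: f) (auto intro: continuous_on_open_Un)

lemma Ck_const: "open \<Omega> \<Longrightarrow> (\<lambda>x. c) \<in> Ck k \<Omega>"
proof (induction k arbitrary: c)
  case (Suc k)
  show ?case
    by (rule Ck_SucI[where g = "\<lambda>i x. 0"]) (use Suc in auto)
qed auto

lemma Ck_add:
  assumes "open \<Omega>" "f \<in> Ck k \<Omega>" "g \<in> Ck k \<Omega>"
  shows "(\<lambda>x. f x + g x) \<in> Ck k \<Omega>"
  using assms(2,3)
proof (induction k arbitrary: f g)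
  case (Suc k)
  show ?case
    by (rule Ck_SucI[where g = "\<lambda>i x. partial i f x + partial i g x"])
      (use Suc.prems in \<open>auto intro!: assms(1) continuous_on_add Suc.IH has_vector_derivative_add
        simp del: Ck.simps intro: continuous_on_Ck partial_Ck has_partial_Ck\<close>)
qed (auto intro: continuous_on_add)

lemma Ck_mult:
  assumes "open \<Omega>" "f \<in> Ck k \<Omega>" "g \<in> Ck k \<Omega>"
  shows "(\<lambda>x. f x * g x) \<in> Ck k \<Omega>"
  using assms(2,3)
proof (induction k arbitrary: f g)
  case (Suc k)
  note fg = Suc.prems[THEN Ck_Suc_subset] Suc.prems[THEN partial_Ck]
  have "((\<lambda>t. f (x + t *\<^sub>R axis i 1) * g (x + t *\<^sub>R axis i 1)) has_vector_derivative
      f x * partial i g x + partial i f x * g x) (at 0)" if "x \<in> \<Omega>" for x i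
    using has_vector_derivative_mult[OF Suc.prems[THEN has_partial_Ck, OF that]] by simp
  then show ?case
    by (intro Ck_SucI[where g = "\<lambda>i x. f x * partial i g x + partial i f x * g x"])
      (use fg in \<open>auto intro!: assms(1) continuous_on_mult Ck_add Suc.IH intro: continuous_on_Ck\<close>)
qed (auto intro: continuous_on_mult)

lemma Ck_inverse:
  assumes "open \<Omega>" "f \<in> Ck k \<Omega>" "\<And>x. x \<in> \<Omega> \<Longrightarrow> f x \<noteq> 0"
  shows "(\<lambda>x. inverse (f x)) \<in> Ck k \<Omega>"
  using assms(2)
proof (induction k)
  case 0
  then show ?case using assms by (auto intro: continuous_on_inverse)
next
  case (Suc k)
  have IH: "(\<lambda>x. inverse (f x)) \<in> Ck k \<Omega>"
    by (rule Suc.IH) (use Suc.prems in \<open>rule Ck_Suc_subset\<close>)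
  \<comment> \<open>The derivative is written as a product of functions already known to lie in
    \<open>Ck k\<close>, so that \<open>Ck_mult\<close> applies.\<close>
  have "((\<lambda>t. inverse (f (x + t *\<^sub>R axis i 1))) has_vector_derivative
      (- 1) * (partial i f x * (inverse (f x) * inverse (f x)))) (at 0)" if "x \<in> \<Omega>" for x i
  proof -
    have "((\<lambda>t. inverse (f (x + t *\<^sub>R axis i 1))) has_derivative
       (\<lambda>h. - (inverse (f x) * (h *\<^sub>R partial i f x) * inverse (f x)))) (at 0)"
      using Deriv.has_derivative_inverse[OF _ has_partial_Ck[OF Suc.prems that, of i, unfolded has_vector_derivative_def]]
        assms(3)[OF that] by simp
    then show ?thesis
      by (simp add: has_vector_derivative_def mult_ac)
  qed
  moreover have "continuous_on \<Omega> (\<lambda>x. inverse (f x))"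
    using assms(3) continuous_on_Ck[OF Suc.prems] by (intro continuous_on_inverse) auto
  moreover have "(\<lambda>x. (- 1) * (partial i f x * (inverse (f x) * inverse (f x)))) \<in> Ck k \<Omega>" for i
    by (intro Ck_mult[OF assms(1)] Ck_const assms(1) IH partial_Ck Suc.prems)
  ultimately show ?case
    by (intro Ck_SucI[where g = "\<lambda>i x. (- 1) * (partial i f x * (inverse (f x) * inverse (f x)))"] assms(1)) auto
qed

lemma Ck_sum:
  assumes "open \<Omega>" "\<And>a. a \<in> A \<Longrightarrow> f a \<in> Ck k \<Omega>"
  shows "(\<lambda>x. \<Sum>a\<in>A. f a x) \<in> Ck k \<Omega>"
  using assms(2)
  by (induction A rule: infinite_finite_induct) (auto intro: Ck_const Ck_add assms(1))

lemma Ck_prod: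
  assumes "open \<Omega>" "\<And>a. a \<in> A \<Longrightarrow> f a \<in> Ck k \<Omega>"
  shows "(\<lambda>x. \<Prod>a\<in>A. f a x) \<in> Ck k \<Omega>"
  using assms(2)
  by (induction A rule: infinite_finite_induct) (auto intro: Ck_const Ck_mult assms(1))

lemma has_partial_coordinate:
  "((\<lambda>t. complex_of_real ((x + t *\<^sub>R axis j 1) $ i)) has_vector_derivative (if i = j then 1 else 0)) (at 0)"
  by (auto simp: axis_def has_vector_derivative_def intro!: derivative_eq_intros)
    (auto simp: scaleR_conv_of_real)

lemma Ck_coordinate:
  assumes "open \<Omega>"
  shows "(\<lambda>x. complex_of_real (x $ i)) \<in> Ck k \<Omega>"
proof (cases k)
  case (Suc k')
  show ?thesis
    unfolding Suc using assms
    by (intro Ck_SucI[OF _ _ _ has_partial_coordinate] Ck_const) (auto intro!: continuous_intros)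
qed (auto intro!: continuous_intros)

section \<open>Total differentiability and symmetry of second derivatives\<close>

lemma has_vector_derivative_line:
  assumes "f \<in> Ck (Suc k) \<Omega>" "x + s *\<^sub>R axis i 1 \<in> \<Omega>"
  shows "((\<lambda>t. f (x + t *\<^sub>R axis i 1)) has_vector_derivative partial i f (x + s *\<^sub>R axis i 1)) (at s)"
proof -
  have 1: "((\<lambda>t. t - s) has_vector_derivative 1) (at s)"
    by (auto intro!: derivative_eq_intros)
  have 2: "((\<lambda>t. f ((x + s *\<^sub>R axis i 1) + t *\<^sub>R axis i 1)) has_vector_derivative
      partial i f (x + s *\<^sub>R axis i 1)) (at (s - s))"
    using has_partial_Ck[OF assms] by simp
  show ?thesis
    using vector_diff_chain_at[OF 1 2] by (simp add: o_def scaleR_diff_left)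
qed

lemma sum_coords_bound:
  fixes h :: "real ^ 'd::finite"
  shows "(\<Sum>i\<in>UNIV. \<bar>h $ i\<bar>) \<le> of_nat CARD('d) * norm h"
  using sum_mono[of UNIV "\<lambda>i. \<bar>h $ i\<bar>" "\<lambda>_. norm h"] component_le_norm_cart by force

text \<open>The mean value inequality for g t - t c, whose derivative is g' t - c. The first and
  second order remainder estimates below rest on it.\<close>

lemma norm_linepath_bound:
  fixes g :: "real \<Rightarrow> complex"
  assumes "\<And>t. \<bar>t\<bar> \<le> \<bar>a\<bar> \<Longrightarrow> (g has_vector_derivative g' t) (at t)"
    "\<And>t. \<bar>t\<bar> \<le> \<bar>a\<bar> \<Longrightarrow> norm (g' t - c) \<le> e"
  shows "norm (g a - g 0 - of_real a * c) \<le> e * \<bar>a\<bar>"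
proof -
  have seg: "t \<in> closed_segment 0 a \<Longrightarrow> \<bar>t\<bar> \<le> \<bar>a\<bar>" for t
    by (auto simp: closed_segment_eq_real_ivl split: if_splits)
  have e0: "0 \<le> e" using assms(2)[of 0] by (rule order_trans[OF norm_ge_zero]) simp
  have "norm ((g a - of_real a * c) - (g 0 - of_real 0 * c)) \<le> e * norm (a - 0)"
  proof (rule differentiable_bound[where S="closed_segment 0 a" and f = "\<lambda>t. g t - of_real t * c" and f' = "\<lambda>t h. h *\<^sub>R (g' t - c)"])
    fix t assume t: "t \<in> closed_segment 0 a"
    have "((\<lambda>t. g t - of_real t * c) has_vector_derivative g' t - 1 * c) (at t)"
      by (intro has_vector_derivative_diff assms(1) seg t has_vector_derivative_mult_left)
        (auto intro!: derivative_eq_intros)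
    then show "((\<lambda>t. g t - of_real t * c) has_derivative (\<lambda>h. h *\<^sub>R (g' t - c))) (at t within closed_segment 0 a)"
      by (auto simp: has_vector_derivative_def intro: has_derivative_at_withinI)
    show "onorm (\<lambda>h. h *\<^sub>R (g' t - c)) \<le> e"
      using assms(2)[OF seg[OF t]] e0 by (intro onorm_bound) (auto intro!: mult_left_mono simp: mult.commute[of e])
  qed auto
  then show ?thesis by (simp add: algebra_simps)
qed

text \<open>One passes from \<open>x\<close> to \<open>x + h\<close> by changing one coordinate at a
  time; each change is a one-dimensional mean value estimate with a partial derivative that is
  continuous at \<open>x\<close>.\<close>

lemma has_derivative_Ck:
  fixes f :: "real ^ 'd::finite \<Rightarrow> complex"
  assumes "f \<in> Ck (Suc k) \<Omega>" "open \<Omega>" "x \<in> \<Omega>"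
  shows "(f has_derivative (\<lambda>h. \<Sum>i\<in>UNIV. of_real (h $ i) * partial i f x)) (at x)"
proof (rule has_derivativeI)
  show "bounded_linear (\<lambda>h::real^'d. \<Sum>i\<in>UNIV. complex_of_real (h $ i) * partial i f x)"
    by (intro bounded_linear_sum bounded_linear_mult_const bounded_linear_compose[OF bounded_linear_of_real bounded_linear_vec_nth])
next
  let ?D = "real CARD('d)"
  define L where "L h = (\<Sum>i\<in>UNIV. complex_of_real (h $ i) * partial i f x)" for h :: "real ^ 'd"
  have main: "\<exists>d>0. \<forall>h. norm h < d \<longrightarrow> norm (f (x + h) - f x - L h) \<le> e * norm h" if "e > 0" for e
  proof -
    \<comment> \<open>The coordinate errors add up to \<open>e'\<close> times the l1 norm of
      \<open>h\<close>, which is at most d times its Euclidean norm.\<close>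
    define e' where "e' = e / ?D"
    have "e' > 0" using that by (simp add: e'_def)
    have "\<forall>\<^sub>F y in nhds x. dist (partial i f y) (partial i f x) < e'" for i
    proof -
      have "continuous_on \<Omega> (partial i f)" using partial_Ck[OF assms(1)] by (rule continuous_on_Ck)
      then have "isCont (partial i f) x" using assms(2,3) continuous_on_eq_continuous_at by blast
      then have "filterlim (partial i f) (nhds (partial i f x)) (nhds x)"
        by (simp add: isCont_def tendsto_at_iff_tendsto_nhds)
      then show ?thesis using \<open>e' > 0\<close> by (rule tendstoD)
    qed
    then have "\<forall>\<^sub>F y in nhds x. y \<in> \<Omega> \<and> (\<forall>i\<in>UNIV. dist (partial i f y) (partial i f x) < e')"
      using assms(2,3) by (intro eventually_conj eventually_ball_finite ballI)
        (auto intro: eventually_nhds_in_open)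
    then obtain d where d: "d > 0" "\<And>y. dist y x < d \<Longrightarrow> y \<in> \<Omega>"
      "\<And>y i. dist y x < d \<Longrightarrow> dist (partial i f y) (partial i f x) < e'"
      unfolding eventually_nhds_metric by auto
    have "norm (f (x + h) - f x - L h) \<le> e * norm h" if h: "norm h < d" for h
    proof -
      \<comment> \<open>\<open>p A\<close> is \<open>h\<close> with the coordinates outside
        \<open>A\<close> set to 0; the induction over \<open>A\<close> leads from \<open>x\<close>
        to \<open>x + h\<close>.\<close>
      define p where "p A = (\<chi> i. if i \<in> A then h $ i else 0)" for A
      have ind: "norm (f (x + p A) - f x - (\<Sum>i\<in>A. of_real (h $ i) * partial i f x)) \<le> e' * (\<Sum>i\<in>A. \<bar>h $ i\<bar>)" for A
        using finite[of A]
      proof (induction A)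
        case empty
        have "p {} = 0" by (simp add: p_def vec_eq_iff)
        then show ?case by simp
      next
        case (insert j A)
        have pj: "p (insert j A) = p A + (h $ j) *\<^sub>R axis j 1"
          using insert.hyps by (auto simp: p_def vec_eq_iff axis_def)
        have near: "dist ((x + p A) + t *\<^sub>R axis j 1) x < d" if "\<bar>t\<bar> \<le> \<bar>h $ j\<bar>" for t
        proof -
          have "norm (p A + t *\<^sub>R axis j 1) \<le> norm h"
          proof (rule norm_le_componentwise_cart)
            show "norm ((p A + t *\<^sub>R axis j 1) $ i) \<le> norm (h $ i)" for i
              using that insert.hyps by (auto simp: p_def axis_def)
          qed
          then show ?thesis using h by (simp add: dist_norm add.assoc)
        qed
        have "norm (f ((x + p A) + (h $ j) *\<^sub>R axis j 1) - f ((x + p A) + 0 *\<^sub>R axis j 1)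
            - of_real (h $ j) * partial j f x) \<le> e' * \<bar>h $ j\<bar>"
        proof (rule norm_linepath_bound[where g = "\<lambda>t. f ((x + p A) + t *\<^sub>R axis j 1)" and g' = "\<lambda>t. partial j f ((x + p A) + t *\<^sub>R axis j 1)"])
          fix t assume t: "\<bar>t\<bar> \<le> \<bar>h $ j\<bar>"
          show "((\<lambda>t. f ((x + p A) + t *\<^sub>R axis j 1)) has_vector_derivative partial j f ((x + p A) + t *\<^sub>R axis j 1)) (at t)"
            using near[OF t] d by (intro has_vector_derivative_line[OF assms(1)]) auto
          show "norm (partial j f ((x + p A) + t *\<^sub>R axis j 1) - partial j f x) \<le> e'"
            using d(3)[OF near[OF t], of j] by (simp add: dist_norm)
        qed
        then have 1: "norm (f (x + p (insert j A)) - f (x + p A) - of_real (h $ j) * partial j f x) \<le> e' * \<bar>h $ j\<bar>"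
          by (simp add: pj add.assoc)
        have "norm (f (x + p (insert j A)) - f x - (\<Sum>i\<in>insert j A. of_real (h $ i) * partial i f x))
          = norm ((f (x + p (insert j A)) - f (x + p A) - of_real (h $ j) * partial j f x)
            + (f (x + p A) - f x - (\<Sum>i\<in>A. of_real (h $ i) * partial i f x)))"
          using insert.hyps by (simp add: algebra_simps)
        also have "\<dots> \<le> e' * \<bar>h $ j\<bar> + e' * (\<Sum>i\<in>A. \<bar>h $ i\<bar>)"
          by (rule norm_triangle_le) (use 1 insert.IH in linarith)
        also have "\<dots> = e' * (\<Sum>i\<in>insert j A. \<bar>h $ i\<bar>)"
          using insert.hyps by (simp add: algebra_simps)
        finally show ?case .
      qed
      have "p UNIV = h" by (simp add: p_def vec_eq_iff)
      then have "norm (f (x + h) - f x - L h) \<le> e' * (\<Sum>i\<in>UNIV. \<bar>h $ i\<bar>)"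
        using ind[of UNIV] by (simp add: L_def)
      also have "\<dots> \<le> e' * (?D * norm h)"
        using sum_coords_bound[of h] \<open>e' > 0\<close> by (intro mult_left_mono) auto
      finally show ?thesis by (simp add: e'_def)
    qed
    with d(1) show ?thesis by auto
  qed
  show "((\<lambda>y. (f y - f x - (\<Sum>i\<in>UNIV. of_real ((y - x) $ i) * partial i f x)) /\<^sub>R norm (y - x)) \<longlongrightarrow> 0) (at x)"
  proof (rule tendstoI)
    fix e :: real assume "e > 0"
    with main[of "e/2"] obtain d where d: "d > 0" "\<And>h. norm h < d \<Longrightarrow> norm (f (x + h) - f x - L h) \<le> e / 2 * norm h"
      by auto
    show "\<forall>\<^sub>F y in at x. dist ((f y - f x - (\<Sum>i\<in>UNIV. of_real ((y - x) $ i) * partial i f x)) /\<^sub>R norm (y - x)) 0 < e"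
      unfolding eventually_at
    proof (intro exI[of _ d] conjI ballI impI d(1))
      fix y assume y: "y \<noteq> x \<and> dist y x < d"
      have "norm (f y - f x - L (y - x)) \<le> e / 2 * norm (y - x)"
        using d(2)[of "y - x"] y by (simp add: dist_norm)
      also have "\<dots> < e * norm (y - x)" using y \<open>e > 0\<close> by simp
      finally show "dist ((f y - f x - (\<Sum>i\<in>UNIV. of_real ((y - x) $ i) * partial i f x)) /\<^sub>R norm (y - x)) 0 < e"
        using y unfolding L_def[symmetric] by (simp add: divide_simps)
    qed
  qed
qed

text \<open>The mixed second difference of \<open>f\<close> with step t is symmetric in
  \<open>i\<close> and \<open>j\<close>, and t^2 times either iterated derivative approximates it up
  to e t^2.\<close>

lemma partial_commute:
  fixes f :: "real ^ 'd::finite \<Rightarrow> complex"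
  assumes f: "f \<in> Ck (Suc (Suc k)) \<Omega>" and "open \<Omega>" "x \<in> \<Omega>"
  shows "partial i (partial j f) x = partial j (partial i f) x"
proof -
  have key: "\<forall>\<^sub>F t in at_right 0. norm ((f (x + t *\<^sub>R axis i 1 + t *\<^sub>R axis j 1) - f (x + t *\<^sub>R axis i 1) - f (x + t *\<^sub>R axis j 1) + f x)
      - of_real (t ^ 2) * partial i (partial j f) x) \<le> e * t ^ 2" if "e > 0" for e and i j :: 'd
  proof -
    have "continuous_on \<Omega> (partial i (partial j f))"
      using f by (intro continuous_on_Ck[of _ k]) simp
    then have "isCont (partial i (partial j f)) x" using assms(2,3) continuous_on_eq_continuous_at by blast
    then have "filterlim (partial i (partial j f)) (nhds (partial i (partial j f) x)) (nhds x)"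
      by (simp add: isCont_def tendsto_at_iff_tendsto_nhds)
    then have "\<forall>\<^sub>F y in nhds x. y \<in> \<Omega> \<and> dist (partial i (partial j f) y) (partial i (partial j f) x) < e"
      using assms(2,3) \<open>e > 0\<close> by (intro eventually_conj tendstoD) (auto intro: eventually_nhds_in_open)
    then obtain d where d: "d > 0" "\<And>y. dist y x < d \<Longrightarrow> y \<in> \<Omega>"
      "\<And>y. dist y x < d \<Longrightarrow> dist (partial i (partial j f) y) (partial i (partial j f) x) < e"
      unfolding eventually_nhds_metric by auto
    have "norm ((f (x + t *\<^sub>R axis i 1 + t *\<^sub>R axis j 1) - f (x + t *\<^sub>R axis i 1) - f (x + t *\<^sub>R axis j 1) + f x)
      - of_real (t ^ 2) * partial i (partial j f) x) \<le> e * t ^ 2" if t: "0 < t" "t < d / 2" for t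
    proof -
      have near: "dist (x + a *\<^sub>R axis i 1 + b *\<^sub>R axis j 1) x < d" if "\<bar>a\<bar> \<le> t" "\<bar>b\<bar> \<le> t" for a b
      proof -
        have "norm (a *\<^sub>R axis i 1 + b *\<^sub>R axis j 1 :: real^'d) \<le> \<bar>a\<bar> + \<bar>b\<bar>"
          by (rule norm_triangle_le) simp
        then show ?thesis using that t by (simp add: dist_norm add.assoc)
      qed
      let ?c = "partial i (partial j f) x"
      \<comment> \<open>The second difference is an increment in direction \<open>j\<close> of an
        increment in direction \<open>i\<close>, so the mean value inequality is applied
        twice.\<close>
      let ?g = "\<lambda>s. f ((x + t *\<^sub>R axis i 1) + s *\<^sub>R axis j 1) - f (x + s *\<^sub>R axis j 1)"
      let ?g' = "\<lambda>s. partial j f ((x + t *\<^sub>R axis i 1) + s *\<^sub>R axis j 1) - partial j f (x + s *\<^sub>R axis j 1)"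
      have "norm (?g t - ?g 0 - of_real t * (of_real t * ?c)) \<le> (e * \<bar>t\<bar>) * \<bar>t\<bar>"
      proof (rule norm_linepath_bound[where g' = ?g'])
        fix s assume s: "\<bar>s\<bar> \<le> \<bar>t\<bar>"
        have st: "\<bar>s\<bar> \<le> t" using s t by simp
        show "(?g has_vector_derivative ?g' s) (at s)"
          using near[of t s] near[of 0 s] d st t
          by (intro has_vector_derivative_diff has_vector_derivative_line[OF f]) auto
        let ?k = "\<lambda>r. partial j f ((x + s *\<^sub>R axis j 1) + r *\<^sub>R axis i 1)"
        have "norm (?k t - ?k 0 - of_real t * ?c) \<le> e * \<bar>t\<bar>"
        proof (rule norm_linepath_bound[where g' = "\<lambda>r. partial i (partial j f) ((x + s *\<^sub>R axis j 1) + r *\<^sub>R axis i 1)"])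
          fix r assume r: "\<bar>r\<bar> \<le> \<bar>t\<bar>"
          have rr: "dist ((x + s *\<^sub>R axis j 1) + r *\<^sub>R axis i 1) x < d"
            using near[of r s] r st t by (simp add: ac_simps)
          show "((\<lambda>r. partial j f ((x + s *\<^sub>R axis j 1) + r *\<^sub>R axis i 1)) has_vector_derivative
             partial i (partial j f) ((x + s *\<^sub>R axis j 1) + r *\<^sub>R axis i 1)) (at r)"
            using d rr by (intro has_vector_derivative_line[OF partial_Ck[OF f]]) auto
          show "norm (partial i (partial j f) ((x + s *\<^sub>R axis j 1) + r *\<^sub>R axis i 1) - ?c) \<le> e"
            using d(3)[OF rr] by (simp add: dist_norm)
        qed
        then show "norm (?g' s - of_real t * ?c) \<le> e * \<bar>t\<bar>"
          by (simp add: ac_simps)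
      qed
      then show ?thesis using t by (simp add: power2_eq_square algebra_simps)
    qed
    then show ?thesis
      using d(1) unfolding eventually_at_right[OF zero_less_one] by (intro exI[of _ "d/2"]) auto
  qed
  have "norm (partial i (partial j f) x - partial j (partial i f) x) \<le> e" if "e > 0" for e
  proof -
    have "e / 2 > 0" using that by simp
    note ev = eventually_conj[OF eventually_at_right_less[of "0::real"]
      eventually_conj[OF key[OF this, of i j] key[OF this, of j i]]]
    obtain t :: real where t: "t > 0"
      "norm ((f (x + t *\<^sub>R axis i 1 + t *\<^sub>R axis j 1) - f (x + t *\<^sub>R axis i 1) - f (x + t *\<^sub>R axis j 1) + f x)
      - of_real (t ^ 2) * partial i (partial j f) x) \<le> e/2 * t ^ 2"
      "norm ((f (x + t *\<^sub>R axis j 1 + t *\<^sub>R axis i 1) - f (x + t *\<^sub>R axis j 1) - f (x + t *\<^sub>R axis i 1) + f x)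
      - of_real (t ^ 2) * partial j (partial i f) x) \<le> e/2 * t ^ 2"
      using eventually_happens[OF ev] by auto
    let ?F = "f (x + t *\<^sub>R axis i 1 + t *\<^sub>R axis j 1) - f (x + t *\<^sub>R axis i 1) - f (x + t *\<^sub>R axis j 1) + f x"
    have t3: "norm (?F - of_real (t ^ 2) * partial j (partial i f) x) \<le> e/2 * t ^ 2"
      using t(3) by (simp add: algebra_simps)
    have "norm (of_real (t^2) * partial i (partial j f) x - of_real (t^2) * partial j (partial i f) x)
      = norm ((?F - of_real (t^2) * partial j (partial i f) x) - (?F - of_real (t^2) * partial i (partial j f) x))"
      by simp
    also have "\<dots> \<le> e/2 * t^2 + e/2 * t^2"
      using t(2) t3 by (intro order_trans[OF norm_triangle_ineq4]) linarith
    finally have "norm (of_real (t^2) * (partial i (partial j f) x - partial j (partial i f) x)) \<le> e * t^2"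
      by (simp only: right_diff_distrib)
    then show ?thesis using t(1) by (simp add: norm_mult norm_power mult.commute)
  qed
  then have "norm (partial i (partial j f) x - partial j (partial i f) x) \<le> 0"
    by (rule field_le_epsilon[of _ 0, simplified])
  then show ?thesis by simp
qed

subsection \<open>Iterated partial derivatives and Schwartz functions\<close>

text \<open>Derivatives along words of coordinates. In contrast to \<open>mderiv\<close>, whose
  order of differentiation is fixed, they admit induction on the word and turn concatenation into
  composition.\<close>

definition pderivs :: "'d::finite list \<Rightarrow> (real ^ 'd \<Rightarrow> complex) \<Rightarrow> real ^ 'd \<Rightarrow> complex" where
  "pderivs w f = fold partial w f"

lemma pderivs_Nil [simp]: "pderivs [] f = f"
  and pderivs_Cons: "pderivs (i # w) f = pderivs w (partial i f)"
  and pderivs_append: "pderivs (v @ w) f = pderivs w (pderivs v f)"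
  by (simp_all add: pderivs_def)

lemma smooth_CkD: "f \<in> smooth \<Omega> \<Longrightarrow> f \<in> Ck k \<Omega>"
  by (auto simp: smooth_def)

lemma smooth_partial: "f \<in> smooth \<Omega> \<Longrightarrow> partial i f \<in> smooth \<Omega>"
  unfolding smooth_def by (auto intro: partial_Ck[of f])

lemma smooth_pderivs: "f \<in> smooth \<Omega> \<Longrightarrow> pderivs w f \<in> smooth \<Omega>"
  by (induction w arbitrary: f) (auto simp: pderivs_Cons smooth_partial)

lemma smooth_continuous: "f \<in> smooth UNIV \<Longrightarrow> continuous_on A f"
  using continuous_on_Ck[of f 0 UNIV] smooth_CkD continuous_on_subset by blast

lemma smooth_measurable [measurable_dest]: "f \<in> smooth UNIV \<Longrightarrow> f \<in> borel_measurable borel"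
  by (rule borel_measurable_continuous_onI) (rule smooth_continuous)

lemma smooth_has_partial:
  "f \<in> smooth UNIV \<Longrightarrow> ((\<lambda>t. f (x + t *\<^sub>R axis i 1)) has_vector_derivative partial i f x) (at 0)"
  using has_partial_Ck[of f 0 UNIV] smooth_CkD by blast

lemma smooth_has_derivative:
  "f \<in> smooth UNIV \<Longrightarrow> (f has_derivative (\<lambda>h. \<Sum>i\<in>UNIV. of_real (h $ i) * partial i f x)) (at x)"
  using has_derivative_Ck[of f 0 UNIV] smooth_CkD by blast

text \<open>Coinduction: by induction on \<open>k\<close>, a set of continuous functions that is
  closed under partial derivatives lies in every \<open>Ck k\<close>. Iterated derivatives thus
  never have to be computed.\<close>

lemma smooth_coinduct:
  assumes "f \<in> X"
    and "\<And>f. f \<in> X \<Longrightarrow> continuous_on UNIV f"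
    and "\<And>f i. f \<in> X \<Longrightarrow> \<exists>g\<in>X. \<forall>x. ((\<lambda>t. f (x + t *\<^sub>R axis i 1)) has_vector_derivative g x) (at 0)"
  shows "f \<in> smooth UNIV"
proof -
  have "f \<in> X \<Longrightarrow> f \<in> Ck k UNIV" for k f
  proof (induction k arbitrary: f)
    case (Suc k)
    then obtain g where "\<And>i. g i \<in> X" "\<And>i x. ((\<lambda>t. f (x + t *\<^sub>R axis i 1)) has_vector_derivative g i x) (at 0)"
      using assms(3) by metis
    with Suc assms(2) show ?case by (intro Ck_SucI[of UNIV f g]) auto
  qed (use assms(2) in auto)
  with assms(1) show ?thesis by (auto simp: smooth_def)
qed

lemma smooth_const: "(\<lambda>x. c) \<in> smooth UNIV"
  and smooth_add: "f \<in> smooth UNIV \<Longrightarrow> g \<in> smooth UNIV \<Longrightarrow> (\<lambda>x. f x + g x) \<in> smooth UNIV"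
  and smooth_mult: "f \<in> smooth UNIV \<Longrightarrow> g \<in> smooth UNIV \<Longrightarrow> (\<lambda>x. f x * g x) \<in> smooth UNIV"
  and smooth_coordinate: "(\<lambda>x. of_real (x $ i)) \<in> smooth UNIV"
  unfolding smooth_def by (auto intro: Ck_const Ck_add Ck_mult Ck_coordinate)

lemma smooth_cmult: "f \<in> smooth UNIV \<Longrightarrow> (\<lambda>x. c * f x) \<in> smooth UNIV"
  by (rule smooth_mult[OF smooth_const])

lemma smooth_sum: "(\<And>a. a \<in> A \<Longrightarrow> f a \<in> smooth UNIV) \<Longrightarrow> (\<lambda>x. \<Sum>a\<in>A. f a x) \<in> smooth UNIV"
  unfolding smooth_def by (auto intro: Ck_sum)

lemma partial_const [simp]: "partial i (\<lambda>x. c) = (\<lambda>x. 0)"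
  by (rule ext, rule partial_eqI) simp

lemma partial_add:
  "f \<in> smooth UNIV \<Longrightarrow> g \<in> smooth UNIV \<Longrightarrow> partial i (\<lambda>x. f x + g x) = (\<lambda>x. partial i f x + partial i g x)"
  by (rule ext, rule partial_eqI) (intro has_vector_derivative_add smooth_has_partial)

lemma partial_mult:
  assumes "f \<in> smooth UNIV" "g \<in> smooth UNIV"
  shows "partial i (\<lambda>x. f x * g x) = (\<lambda>x. f x * partial i g x + partial i f x * g x)"
proof (rule ext, rule partial_eqI)
  show "((\<lambda>t. f (x + t *\<^sub>R axis i 1) * g (x + t *\<^sub>R axis i 1)) has_vector_derivative
      f x * partial i g x + partial i f x * g x) (at 0)" for x
    using has_vector_derivative_mult[OF assms[THEN smooth_has_partial]] by simp
qed

lemma partial_cmult: "f \<in> smooth UNIV \<Longrightarrow> partial i (\<lambda>x. c * f x) = (\<lambda>x. c * partial i f x)"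
  using partial_mult[OF smooth_const, of f i c] by simp

lemma partial_sum:
  "(\<And>a. a \<in> A \<Longrightarrow> f a \<in> smooth UNIV) \<Longrightarrow> partial i (\<lambda>x. \<Sum>a\<in>A. f a x) = (\<lambda>x. \<Sum>a\<in>A. partial i (f a) x)"
  by (rule ext, rule partial_eqI) (intro has_vector_derivative_sum smooth_has_partial)

lemma partial_coordinate: "partial j (\<lambda>x. complex_of_real (x $ i)) = (\<lambda>x. if i = j then 1 else 0)"
  by (rule ext, rule partial_eqI) (rule has_partial_coordinate)

lemma pderivs_add:
  "f \<in> smooth UNIV \<Longrightarrow> g \<in> smooth UNIV \<Longrightarrow> pderivs w (\<lambda>x. f x + g x) = (\<lambda>x. pderivs w f x + pderivs w g x)"
  by (induction w arbitrary: f g) (simp_all add: pderivs_Cons partial_add smooth_partial)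

lemma pderivs_cmult: "f \<in> smooth UNIV \<Longrightarrow> pderivs w (\<lambda>x. c * f x) = (\<lambda>x. c * pderivs w f x)"
  by (induction w arbitrary: f) (simp_all add: pderivs_Cons partial_cmult smooth_partial)

lemma pderivs_sum:
  "(\<And>a. a \<in> A \<Longrightarrow> f a \<in> smooth UNIV) \<Longrightarrow> pderivs w (\<lambda>x. \<Sum>a\<in>A. f a x) = (\<lambda>x. \<Sum>a\<in>A. pderivs w (f a) x)"
  by (induction w arbitrary: f) (simp_all add: pderivs_Cons partial_sum smooth_partial)

lemma smooth_affine_partial:
  fixes f :: "real ^ 'd::finite \<Rightarrow> complex"
  assumes "f \<in> smooth UNIV"
  shows "((\<lambda>t. f (a *\<^sub>R (x + t *\<^sub>R axis i 1) + b)) has_vector_derivative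
    of_real a * partial i f (a *\<^sub>R x + b)) (at 0)"
proof -
  have 1: "((\<lambda>t. a * t) has_vector_derivative a) (at 0)"
    by (auto intro!: derivative_eq_intros)
  have 2: "((\<lambda>t. f ((a *\<^sub>R x + b) + t *\<^sub>R axis i 1)) has_vector_derivative partial i f (a *\<^sub>R x + b)) (at (a * 0))"
    using smooth_has_partial[OF assms] by simp
  show ?thesis
    using vector_diff_chain_at[OF 1 2] by (simp add: o_def scaleR_add_right add_ac scaleR_conv_of_real[of a "_ :: complex"])
qed

lemma smooth_affine:
  fixes f :: "real ^ 'd::finite \<Rightarrow> complex"
  assumes "f \<in> smooth UNIV"
  shows "(\<lambda>x. f (a *\<^sub>R x + b)) \<in> smooth UNIV"
\<comment> \<open>The constant factor \<open>c\<close> collects the powers of \<open>a\<close> that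
  the chain rule produces; it makes the set closed under differentiation.\<close>
proof (rule smooth_coinduct[where X = "{\<lambda>x. c * f (a *\<^sub>R x + b) |f c. f \<in> smooth UNIV}"])
  show "(\<lambda>x. f (a *\<^sub>R x + b)) \<in> {\<lambda>x. c * f (a *\<^sub>R x + b) |f c. f \<in> smooth UNIV}"
    using assms by (auto intro!: exI[of _ f] exI[of _ 1])
next
  fix g assume "g \<in> {\<lambda>x. c * f (a *\<^sub>R x + b) |f c. f \<in> smooth UNIV}"
  then obtain f c where g: "g = (\<lambda>x. c * f (a *\<^sub>R x + b))" "f \<in> smooth UNIV" by auto
  show "continuous_on UNIV g"
    unfolding g(1) by (intro continuous_intros continuous_on_compose2[OF smooth_continuous[OF g(2), of UNIV]]) auto
  fix i
  show "\<exists>h\<in>{\<lambda>x. c * f (a *\<^sub>R x + b) |f c. f \<in> smooth UNIV}.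
     \<forall>x. ((\<lambda>t. g (x + t *\<^sub>R axis i 1)) has_vector_derivative h x) (at 0)"
  proof (intro bexI allI)
    show "((\<lambda>t. g (x + t *\<^sub>R axis i 1)) has_vector_derivative (c * of_real a) * partial i f (a *\<^sub>R x + b)) (at 0)" for x
      using has_vector_derivative_mult_right[OF smooth_affine_partial[OF g(2), of a x i b], of c]
      by (simp add: g(1) mult.assoc)
    show "(\<lambda>x. (c * of_real a) * partial i f (a *\<^sub>R x + b)) \<in> {\<lambda>x. c * f (a *\<^sub>R x + b) |f c. f \<in> smooth UNIV}"
      using smooth_partial[OF g(2)] by blast
  qed
qed

lemma pderivs_affine:
  "f \<in> smooth UNIV \<Longrightarrow> pderivs w (\<lambda>x. f (a *\<^sub>R x + b)) = (\<lambda>x. of_real a ^ length w * pderivs w f (a *\<^sub>R x + b))"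
proof (induction w arbitrary: f)
  case (Cons i w)
  have "partial i (\<lambda>x. f (a *\<^sub>R x + b)) = (\<lambda>x. of_real a * partial i f (a *\<^sub>R x + b))"
    by (rule ext, rule partial_eqI) (rule smooth_affine_partial[OF Cons.prems])
  then show ?case
    using Cons.IH[OF smooth_partial[OF Cons.prems]] Cons.prems
    by (simp add: pderivs_Cons pderivs_cmult smooth_affine smooth_partial mult_ac)
qed simp

lemma pderivs_reflect:
  "f \<in> smooth UNIV \<Longrightarrow> pderivs w (\<lambda>y. f (x - y)) = (\<lambda>y. (-1) ^ length w * pderivs w f (x - y))"
  using pderivs_affine[of f w "-1" x] by simp

lemma partial_pderivs:
  "f \<in> smooth UNIV \<Longrightarrow> partial i (pderivs w f) = pderivs w (partial i f)"
proof (induction w arbitrary: f)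
  case (Cons j w)
  have "partial i (partial j f) = partial j (partial i f)"
    using partial_commute[OF smooth_CkD[OF Cons.prems]] by auto
  then show ?case
    using Cons.IH[OF smooth_partial[OF Cons.prems]] by (simp add: pderivs_Cons)
qed simp

section \<open>Words and multi-indices\<close>

lemma pderivs_perm: "f \<in> smooth UNIV \<Longrightarrow> mset v = mset w \<Longrightarrow> pderivs v f = pderivs w f"
  unfolding pderivs_def
  by (rule fold_permuted_eq[where P = "\<lambda>f. f \<in> smooth UNIV"])
    (auto simp: smooth_partial intro!: ext partial_commute[OF smooth_CkD])

text \<open>The word along which \<open>mderiv m\<close> differentiates; through it the multi-index
  derivatives of the statement become word derivatives.\<close>

definition sorted_word :: "'d::finite multi_index \<Rightarrow> 'd list" where
  "sorted_word m = concat (map (\<lambda>i. replicate (m i) i) coordinates)"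

lemma coordinates: "distinct (coordinates :: 'd::finite list)" "set (coordinates :: 'd::finite list) = UNIV"
proof -
  have "\<exists>is. distinct is \<and> set is = (UNIV :: 'd set)"
    using finite_distinct_list[of "UNIV :: 'd set"] by auto
  from someI_ex[OF this] show "distinct (coordinates :: 'd::finite list)" "set (coordinates :: 'd::finite list) = UNIV"
    by (auto simp: coordinates_def)
qed

lemma fold_replicate_funpow: "fold f (replicate n i) = f i ^^ n"
  by (induction n) (auto simp: funpow_swap1 fun_eq_iff)

lemma mderiv_eq_pderivs: "mderiv m f = pderivs (sorted_word m) f"
proof -
  have "fold (\<lambda>i. partial i ^^ m i) xs f = fold partial (concat (map (\<lambda>i. replicate (m i) i) xs)) f" for xs
    by (induction xs arbitrary: f) (auto simp: fold_replicate_funpow)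
  then show ?thesis by (simp add: mderiv_def pderivs_def sorted_word_def)
qed

lemma length_sorted_word: "length (sorted_word m) = mi_order m"
  by (simp add: sorted_word_def mi_order_def length_concat o_def sum_list_distinct_conv_sum_set coordinates)

lemma count_sorted_word: "count (mset (sorted_word m)) i = m i"
proof -
  have "count (mset (concat (map (\<lambda>i. replicate (m i) i) xs))) i = (\<Sum>j\<leftarrow>xs. if j = i then m i else 0)" for xs
    by (induction xs) auto
  then show ?thesis
    by (simp add: sorted_word_def sum_list_distinct_conv_sum_set coordinates)
qed

lemma pderivs_eq_mderiv: "f \<in> smooth UNIV \<Longrightarrow> pderivs w f = mderiv (count (mset w)) f"
  unfolding mderiv_eq_pderivs by (rule pderivs_perm) (auto intro: multiset_eqI simp: count_sorted_word)

lemma mi_order_count: "mi_order (count (mset w)) = length w"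
proof -
  have "mset (sorted_word (count (mset w))) = mset w"
    by (rule multiset_eqI) (simp add: count_sorted_word)
  then have "length (sorted_word (count (mset w))) = length w" by (rule mset_eq_length)
  then show ?thesis by (simp add: length_sorted_word)
qed

lemma finite_mi_order: "finite {m :: 'd::finite multi_index. mi_order m \<le> N}"
proof (rule finite_subset)
  show "{m. mi_order m \<le> N} \<subseteq> (UNIV :: 'd set) \<rightarrow>\<^sub>E {..N}"
  proof
    fix m :: "'d multi_index" assume "m \<in> {m. mi_order m \<le> N}"
    moreover have "m i \<le> mi_order m" for i
      unfolding mi_order_def by (rule member_le_sum) auto
    ultimately have "m i \<le> N" for i by (auto intro: le_trans)
    then show "m \<in> UNIV \<rightarrow>\<^sub>E {..N}" by auto
  qed
  show "finite ((UNIV :: 'd set) \<rightarrow>\<^sub>E {..N})"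
    by (rule finite_PiE) auto
qed

section \<open>Schwartz functions and polynomial weights\<close>

lemma abs_monomial_le: "\<bar>monomial a x\<bar> \<le> (1 + norm x) ^ mi_order a"
proof -
  have "\<bar>monomial a x\<bar> = (\<Prod>i\<in>UNIV. \<bar>x $ i\<bar> ^ a i)"
    by (simp add: monomial_def abs_prod power_abs)
  also have "\<dots> \<le> (\<Prod>i\<in>UNIV. (1 + norm x) ^ a i)"
  proof (intro prod_mono conjI)
    show "\<bar>x $ i\<bar> ^ a i \<le> (1 + norm x) ^ a i" for i
      using component_le_norm_cart[of x i] by (intro power_mono) auto
  qed auto
  finally show ?thesis by (simp add: mi_order_def power_sum)
qed

lemma monomial_single: "monomial (\<lambda>j. if j = i then q else 0) x = (x $ i) ^ q"
  by (simp add: monomial_def if_distrib[of "\<lambda>n. _ ^ n"] cong: if_cong)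

text \<open>The largest coordinate controls the norm up to the factor d. This converts the
  coordinate powers that occur in seminorms, and those that Fourier transforms of derivatives
  produce, into a radial weight.\<close>

lemma one_plus_norm_power_le:
  fixes x :: "real ^ 'd::finite"
  shows "(1 + norm x) ^ q \<le> (1 + real CARD('d)) ^ q * (1 + (\<Sum>i\<in>UNIV. \<bar>(x $ i) ^ q\<bar>))"
proof -
  obtain i where i: "\<And>j. \<bar>x $ j\<bar> \<le> \<bar>x $ i\<bar>"
  proof -
    have "Max (range (\<lambda>j. \<bar>x $ j\<bar>)) \<in> range (\<lambda>j. \<bar>x $ j\<bar>)" by (rule Max_in) auto
    then obtain i where "Max (range (\<lambda>j. \<bar>x $ j\<bar>)) = \<bar>x $ i\<bar>" by blast
    then show ?thesis using that[of i] Max_ge[of "range (\<lambda>j. \<bar>x $ j\<bar>)"] by simp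
  qed
  have "norm x \<le> (\<Sum>j\<in>UNIV. \<bar>x $ j\<bar>)" by (rule norm_le_l1_cart)
  also have "\<dots> \<le> (\<Sum>j\<in>(UNIV::'d set). \<bar>x $ i\<bar>)" by (rule sum_mono) (rule i)
  finally have n: "norm x \<le> real CARD('d) * \<bar>x $ i\<bar>" by simp
  have "real CARD('d) * \<bar>x $ i\<bar> \<le> real CARD('d) * max 1 \<bar>x $ i\<bar>"
    by (intro mult_left_mono) auto
  with n have "1 + norm x \<le> (1 + real CARD('d)) * max 1 \<bar>x $ i\<bar>"
    unfolding distrib_right by linarith
  then have "(1 + norm x) ^ q \<le> ((1 + real CARD('d)) * max 1 \<bar>x $ i\<bar>) ^ q"
    by (intro power_mono) auto
  also have "\<dots> = (1 + real CARD('d)) ^ q * max 1 \<bar>x $ i\<bar> ^ q" by (simp add: power_mult_distrib)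
  also have "max 1 \<bar>x $ i\<bar> ^ q \<le> 1 + \<bar>(x $ i) ^ q\<bar>" by (auto simp: max_def power_abs)
  also have "\<bar>(x $ i) ^ q\<bar> \<le> (\<Sum>i\<in>UNIV. \<bar>(x $ i) ^ q\<bar>)"
    by (rule member_le_sum) auto
  finally show ?thesis by (simp add: mult_left_mono)
qed

text \<open>Radial weights and words take the place of monomials and multi-indices: a weight has a
  reciprocal that can be integrated, and words admit induction.\<close>

lemma schwartz_iff:
  "f \<in> schwartz \<longleftrightarrow> f \<in> smooth UNIV \<and> (\<forall>w q. \<exists>C. \<forall>x. (1 + norm x) ^ q * norm (pderivs w f x) \<le> C)"
proof (intro iffI conjI allI)
  assume f: "f \<in> schwartz"
  then show sm: "f \<in> smooth UNIV" by (simp add: schwartz_def)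
  fix w :: "'a list" and q
  let ?m = "count (mset w)"
  have b: "\<exists>B. \<forall>x. \<bar>monomial a x\<bar> * norm (pderivs w f x) \<le> B" for a
    using f by (auto simp: schwartz_def bounded_iff pderivs_eq_mderiv[OF sm])
  obtain B0 where B0: "\<And>x. norm (pderivs w f x) \<le> B0"
    using b[of "\<lambda>_. 0"] by (auto simp: monomial_def)
  obtain B where B: "\<And>i x. \<bar>(x $ i) ^ q\<bar> * norm (pderivs w f x) \<le> B i"
    using b[of "\<lambda>j. if j = _ then q else 0", unfolded monomial_single] by metis
  have "(1 + norm x) ^ q * norm (pderivs w f x)
      \<le> (1 + real CARD('a)) ^ q * (B0 + (\<Sum>i\<in>UNIV. B i))" for x
  proof -
    have "(1 + norm x) ^ q * norm (pderivs w f x)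
      \<le> ((1 + real CARD('a)) ^ q * (1 + (\<Sum>i\<in>UNIV. \<bar>(x $ i) ^ q\<bar>))) * norm (pderivs w f x)"
      by (intro mult_right_mono one_plus_norm_power_le) auto
    also have "\<dots> = (1 + real CARD('a)) ^ q * (norm (pderivs w f x) + (\<Sum>i\<in>UNIV. \<bar>(x $ i) ^ q\<bar> * norm (pderivs w f x)))"
      by (simp add: algebra_simps flip: sum_distrib_left)
    also have "\<dots> \<le> (1 + real CARD('a)) ^ q * (B0 + (\<Sum>i\<in>UNIV. B i))"
      by (intro mult_left_mono add_mono sum_mono B0 B) auto
    finally show ?thesis .
  qed
  then show "\<exists>C. \<forall>x. (1 + norm x) ^ q * norm (pderivs w f x) \<le> C" by blast
next
  assume f: "f \<in> smooth UNIV \<and> (\<forall>w q. \<exists>C. \<forall>x. (1 + norm x) ^ q * norm (pderivs w f x) \<le> C)"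
  have "bounded (range (\<lambda>x. monomial a x *\<^sub>R mderiv m f x))" for a m
  proof -
    obtain C where C: "\<And>x. (1 + norm x) ^ mi_order a * norm (pderivs (sorted_word m) f x) \<le> C"
      using f by blast
    have "norm (monomial a x *\<^sub>R mderiv m f x) \<le> C" for x
      using mult_right_mono[OF abs_monomial_le[of a x], of "norm (mderiv m f x)"] C[of x]
      by (simp add: mderiv_eq_pderivs)
    then show ?thesis by (auto simp: bounded_iff)
  qed
  with f show "f \<in> schwartz" by (simp add: schwartz_def)
qed

lemma schwartz_smooth: "f \<in> schwartz \<Longrightarrow> f \<in> smooth UNIV"
  by (simp add: schwartz_iff)

lemma schwartz_decay:
  assumes "f \<in> schwartz"
  obtains C where "C \<ge> 0" "\<And>x. norm (pderivs w f x) \<le> C / (1 + norm x) ^ q"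
proof -
  obtain C where C: "\<And>x. (1 + norm x) ^ q * norm (pderivs w f x) \<le> C"
    using assms unfolding schwartz_iff by blast
  have *: "(1 + norm x) ^ q > 0" for x :: "real ^ 'a"
    by (rule zero_less_power) (simp add: add_pos_nonneg)
  show ?thesis
  proof
    show "C \<ge> 0" using C[of 0] by (auto intro: order_trans[rotated])
    show "norm (pderivs w f x) \<le> C / (1 + norm x) ^ q" for x
      using C[of x] * by (simp add: pos_le_divide_eq mult.commute)
  qed
qed

lemma schwartz_partial: "f \<in> schwartz \<Longrightarrow> partial i f \<in> schwartz"
  unfolding schwartz_iff pderivs_Cons[symmetric] by (auto intro: smooth_partial)

lemma schwartz_pderivs: "f \<in> schwartz \<Longrightarrow> pderivs w f \<in> schwartz"
  by (induction w arbitrary: f) (auto simp: pderivs_Cons schwartz_partial)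

lemma schwartz_add:
  assumes "f \<in> schwartz" "g \<in> schwartz"
  shows "(\<lambda>x. f x + g x) \<in> schwartz"
  unfolding schwartz_iff
proof (intro conjI allI)
  show "(\<lambda>x. f x + g x) \<in> smooth UNIV" using assms by (intro smooth_add schwartz_smooth)
  fix w q
  obtain C1 C2 where C: "\<And>x. (1 + norm x) ^ q * norm (pderivs w f x) \<le> C1"
    "\<And>x. (1 + norm x) ^ q * norm (pderivs w g x) \<le> C2"
    using assms unfolding schwartz_iff by metis
  have "(1 + norm x) ^ q * norm (pderivs w (\<lambda>x. f x + g x) x) \<le> C1 + C2" for x
  proof -
    have "(1 + norm x) ^ q * norm (pderivs w f x + pderivs w g x)
      \<le> (1 + norm x) ^ q * (norm (pderivs w f x) + norm (pderivs w g x))"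
      by (intro mult_left_mono norm_triangle_ineq) auto
    with C[of x] show ?thesis
      using assms by (simp add: pderivs_add schwartz_smooth algebra_simps)
  qed
  then show "\<exists>C. \<forall>x. (1 + norm x) ^ q * norm (pderivs w (\<lambda>x. f x + g x) x) \<le> C" by blast
qed

lemma schwartz_cmult:
  assumes "f \<in> schwartz"
  shows "(\<lambda>x. c * f x) \<in> schwartz"
  unfolding schwartz_iff
proof (intro conjI allI)
  show "(\<lambda>x. c * f x) \<in> smooth UNIV" using assms by (intro smooth_cmult schwartz_smooth)
  fix w q
  obtain C where C: "\<And>x. (1 + norm x) ^ q * norm (pderivs w f x) \<le> C"
    using assms unfolding schwartz_iff by metis
  have "(1 + norm x) ^ q * norm (pderivs w (\<lambda>x. c * f x) x) \<le> norm c * C" for x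
    using mult_left_mono[OF C[of x] norm_ge_zero[of c]] assms
    by (simp add: pderivs_cmult schwartz_smooth norm_mult mult_ac)
  then show "\<exists>C. \<forall>x. (1 + norm x) ^ q * norm (pderivs w (\<lambda>x. c * f x) x) \<le> C" by blast
qed

lemma schwartz_zero: "(\<lambda>x. 0) \<in> schwartz"
proof -
  have "pderivs w (\<lambda>x. 0) = (\<lambda>x::real^'a. 0)" for w
    by (induction w) (simp_all add: pderivs_Cons)
  then show ?thesis by (auto simp: schwartz_iff smooth_const)
qed

lemma schwartz_sum: "(\<And>a. a \<in> A \<Longrightarrow> f a \<in> schwartz) \<Longrightarrow> (\<lambda>x. \<Sum>a\<in>A. f a x) \<in> schwartz"
  by (induction A rule: infinite_finite_induct) (auto intro: schwartz_zero schwartz_add)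

text \<open>A derivative of the product is one term of the same form with a derivative of
  \<open>f\<close>, to which the induction hypothesis applies, and one constant multiple of
  \<open>f\<close>. Hence the induction on the word runs over all Schwartz functions
  \<open>f\<close>.\<close>

lemma schwartz_coordinate:
  assumes "f \<in> schwartz"
  shows "(\<lambda>x. of_real (x $ i) * f x) \<in> schwartz"
  unfolding schwartz_iff
proof (intro conjI allI)
  show "(\<lambda>x. of_real (x $ i) * f x) \<in> smooth UNIV"
    using assms by (intro smooth_mult smooth_coordinate schwartz_smooth)
  fix w q
  show "\<exists>C. \<forall>x. (1 + norm x) ^ q * norm (pderivs w (\<lambda>x. of_real (x $ i) * f x) x) \<le> C"
    using assms
  proof (induction w arbitrary: f)
    case Nil
    obtain C where C: "\<And>x. (1 + norm x) ^ Suc q * norm (pderivs [] f x) \<le> C"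
      using Nil unfolding schwartz_iff by blast
    have "(1 + norm x) ^ q * norm (of_real (x $ i) * f x) \<le> C" for x
    proof -
      have "(1 + norm x) ^ q * norm (of_real (x $ i) * f x) = (1 + norm x) ^ q * (\<bar>x $ i\<bar> * norm (f x))"
        by (simp add: norm_mult)
      also have "\<dots> \<le> (1 + norm x) ^ q * ((1 + norm x) * norm (f x))"
        using component_le_norm_cart[of x i] by (intro mult_left_mono mult_right_mono) auto
      also have "\<dots> \<le> C" using C[of x] by (simp add: mult_ac)
      finally show ?thesis .
    qed
    then show ?case by auto
  next
    case (Cons j w)
    have p: "partial j (\<lambda>x. of_real (x $ i) * f x) = (\<lambda>x. of_real (x $ i) * partial j f x + (if i = j then 1 else 0) * f x)"
      using Cons.prems by (subst partial_mult) (auto simp: smooth_coordinate schwartz_smooth partial_coordinate)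
    note f = schwartz_smooth[OF Cons.prems]
    obtain C1 where C1: "\<And>x. (1 + norm x) ^ q * norm (pderivs w (\<lambda>x. of_real (x $ i) * partial j f x) x) \<le> C1"
      using Cons.IH[OF schwartz_partial[OF Cons.prems]] by auto
    obtain C2 where C2: "\<And>x. (1 + norm x) ^ q * norm (pderivs w (\<lambda>x. (if i = j then 1 else 0) * f x) x) \<le> C2"
      using schwartz_cmult[OF Cons.prems] unfolding schwartz_iff by blast
    have "(1 + norm x) ^ q * norm (pderivs (j # w) (\<lambda>x. of_real (x $ i) * f x) x) \<le> C1 + C2" for x
    proof -
      have "pderivs (j # w) (\<lambda>x. of_real (x $ i) * f x) x =
        pderivs w (\<lambda>x. of_real (x $ i) * partial j f x) x + pderivs w (\<lambda>x. (if i = j then 1 else 0) * f x) x"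
        unfolding pderivs_Cons p
        by (subst pderivs_add) (intro smooth_mult smooth_coordinate smooth_partial f smooth_const refl)+
      then have "(1 + norm x) ^ q * norm (pderivs (j # w) (\<lambda>x. of_real (x $ i) * f x) x) \<le>
        (1 + norm x) ^ q * (norm (pderivs w (\<lambda>x. of_real (x $ i) * partial j f x) x)
         + norm (pderivs w (\<lambda>x. (if i = j then 1 else 0) * f x) x))"
        by (intro mult_left_mono) (auto intro: norm_triangle_ineq)
      with C1[of x] C2[of x] show ?thesis unfolding distrib_left by linarith
    qed
    then show ?case by blast
  qed
qed

lemma schwartz_dilation:
  fixes f :: "real ^ 'd::finite \<Rightarrow> complex"
  assumes "f \<in> schwartz" "a \<noteq> 0"
  shows "(\<lambda>x. f (a *\<^sub>R x)) \<in> schwartz"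
  unfolding schwartz_iff
proof (intro conjI allI)
  note f = schwartz_smooth[OF assms(1)]
  show "(\<lambda>x. f (a *\<^sub>R x)) \<in> smooth UNIV" using smooth_affine[OF f, of a 0] by simp
  fix w q
  obtain C where C: "\<And>x. (1 + norm x) ^ q * norm (pderivs w f x) \<le> C"
    using assms unfolding schwartz_iff by metis
  let ?b = "1 + 1 / \<bar>a\<bar>"
  have "(1 + norm x) ^ q * norm (pderivs w (\<lambda>x. f (a *\<^sub>R x)) x) \<le> ?b ^ q * (\<bar>a\<bar> ^ length w * C)" for x :: "real ^ 'd"
  proof -
    have 1: "1 + norm x \<le> ?b * (1 + norm (a *\<^sub>R x))"
      using assms(2) by (simp add: field_simps)
    have "(1 + norm x) ^ q * norm (pderivs w (\<lambda>x. f (a *\<^sub>R x)) x)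
       = (1 + norm x) ^ q * (\<bar>a\<bar> ^ length w * norm (pderivs w f (a *\<^sub>R x)))"
      using pderivs_affine[OF f, of w a 0] by (simp add: norm_mult norm_power)
    also have "\<dots> \<le> (?b * (1 + norm (a *\<^sub>R x))) ^ q * (\<bar>a\<bar> ^ length w * norm (pderivs w f (a *\<^sub>R x)))"
      by (intro mult_right_mono power_mono 1) auto
    also have "\<dots> = ?b ^ q * (\<bar>a\<bar> ^ length w * ((1 + norm (a *\<^sub>R x)) ^ q * norm (pderivs w f (a *\<^sub>R x))))"
      unfolding power_mult_distrib by (simp only: mult_ac)
    also have "\<dots> \<le> ?b ^ q * (\<bar>a\<bar> ^ length w * C)"
      by (intro mult_left_mono C) auto
    finally show ?thesis .
  qed
  then show "\<exists>C. \<forall>x. (1 + norm x) ^ q * norm (pderivs w (\<lambda>x. f (a *\<^sub>R x)) x) \<le> C" by blast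
qed

lemma partial_eq_0:
  assumes "open U" "\<And>x. x \<in> U \<Longrightarrow> f x = 0" "x \<in> U"
  shows "partial i f x = 0"
  using partial_cong[of U x f "\<lambda>_. 0" i] assms by simp

lemma pderivs_eq_0:
  assumes "open U" "\<And>x. x \<in> U \<Longrightarrow> f x = 0" "x \<in> U"
  shows "pderivs w f x = 0"
  using assms(2)
  by (induction w arbitrary: f) (auto simp: pderivs_Cons assms(3) intro: partial_eq_0[OF assms(1)])

text \<open>Derivatives are local, so they vanish outside the ball as well; inside, continuity on a
  compact set gives the bound.\<close>

lemma bounded_support_schwartz:
  fixes f :: "real ^ 'd::finite \<Rightarrow> complex"
  assumes f: "f \<in> smooth UNIV" and R: "\<And>x. norm x > R \<Longrightarrow> f x = 0"
  shows "f \<in> schwartz"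
  unfolding schwartz_iff
proof (intro conjI allI f)
  fix w q
  have z: "pderivs w f x = 0" if "norm x > R" for x
    by (rule pderivs_eq_0[of "{x. norm x > R}"]) (use that R in \<open>auto intro!: open_Collect_less continuous_intros\<close>)
  have "continuous_on (cball 0 R) (\<lambda>x. of_real ((1 + norm x) ^ q) * pderivs w f x)"
    by (intro continuous_intros smooth_continuous smooth_pderivs f)
  then have "bounded ((\<lambda>x. of_real ((1 + norm x) ^ q) * pderivs w f x) ` cball 0 R)"
    by (intro compact_imp_bounded compact_continuous_image) auto
  then obtain C where "\<forall>x\<in>cball 0 R. norm (of_real ((1 + norm x) ^ q) * pderivs w f x) \<le> C"
    unfolding bounded_iff by blast
  then have C: "\<And>x. norm x \<le> R \<Longrightarrow> norm (of_real ((1 + norm x) ^ q) * pderivs w f x) \<le> C"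
    by simp
  have "(1 + norm x) ^ q * norm (pderivs w f x) \<le> max C 0" for x
    using C[of x] z[of x] by (cases "norm x \<le> R") (auto simp: norm_mult norm_power simp flip: of_real_add of_real_power)
  then show "\<exists>C. \<forall>x. (1 + norm x) ^ q * norm (pderivs w f x) \<le> C" by blast
qed

lemma test_function_schwartz: "f \<in> test_functions A \<Longrightarrow> f \<in> schwartz"
proof -
  assume f: "f \<in> test_functions A"
  then have "bounded (closure {x. f x \<noteq> 0})" by (auto simp: test_functions_def compact_imp_bounded)
  then obtain R where "\<And>x. x \<in> closure {x. f x \<noteq> 0} \<Longrightarrow> norm x \<le> R" by (auto simp: bounded_iff)
  then have "norm x > R \<Longrightarrow> f x = 0" for x
    using closure_subset[of "{x. f x \<noteq> 0}"] by force
  with f show ?thesis by (intro bounded_support_schwartz[of f R]) (auto simp: test_functions_def)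
qed

text \<open>Lebesgue measure is the image of a product measure over the coordinates. The
  factorization serves the integrable weight below and later the Gaussian.\<close>

lemma
  fixes h :: "'a::euclidean_space \<Rightarrow> real \<Rightarrow> complex"
  assumes h: "\<And>b. b \<in> Basis \<Longrightarrow> integrable lborel (h b)"
  shows integrable_lborel_prod: "integrable lborel (\<lambda>x. \<Prod>b\<in>Basis. h b (x \<bullet> b))"
    and integral_lborel_prod: "(LINT x|lborel. (\<Prod>b\<in>Basis. h b (x \<bullet> b))) = (\<Prod>b\<in>Basis. (LINT t|lborel. h b t))"
proof -
  interpret product_sigma_finite "\<lambda>b::'a. lborel :: real measure"
    by unfold_locales
  have [measurable]: "(\<lambda>f. \<Sum>b\<in>Basis. f b *\<^sub>R b) \<in> (\<Pi>\<^sub>M b\<in>(Basis::'a set). (lborel :: real measure)) \<rightarrow>\<^sub>M borel"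
    by measurable
  have m: "h b \<in> borel_measurable borel" if "b \<in> Basis" for b
    using borel_measurable_integrable[OF h[OF that]] by simp
  have [measurable]: "(\<lambda>x::'a. \<Prod>b\<in>Basis. h b (x \<bullet> b)) \<in> borel_measurable borel"
    by (intro borel_measurable_prod measurable_compose[OF _ m]) auto
  have eq: "(\<Prod>b\<in>Basis. h b ((\<Sum>c\<in>Basis. f c *\<^sub>R c) \<bullet> b)) = (\<Prod>b\<in>Basis. h b (f b))" for f
    by (intro prod.cong) (auto simp: inner_sum_left_Basis)
  show "integrable lborel (\<lambda>x. \<Prod>b\<in>Basis. h b (x \<bullet> b))"
    unfolding lborel_eq[where 'a='a] by (subst integrable_distr_eq) (auto simp: eq intro!: product_integrable_prod h)
  show "(LINT x|lborel. (\<Prod>b\<in>Basis. h b (x \<bullet> b))) = (\<Prod>b\<in>Basis. (LINT t|lborel. h b t))"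
    unfolding lborel_eq[where 'a='a]
    by (subst integral_distr) (auto simp: eq intro!: product_integral_prod h)
qed

text \<open>The integrable product of the functions 1 / (1 + x_b^2) dominates the weight, because
  every 1 + x_b^2 is at most (1 + |x|)^2; this explains the exponent 2 d.\<close>

lemma integrable_inverse_norm_power:
  "integrable lborel (\<lambda>x::'a::euclidean_space. 1 / (1 + norm x) ^ (2 * DIM('a)))"
proof -
  have "integrable lborel (\<lambda>x::real. complex_of_real (inverse (1 + x^2)))"
    using integrable_inverse_1_plus_square
    by (intro integrable_of_real) (simp add: set_integrable_def)
  from integrable_lborel_prod[of "\<lambda>_::'a. \<lambda>x. complex_of_real (inverse (1 + x^2))", OF this]
  have int: "integrable lborel (\<lambda>x::'a. \<Prod>b\<in>Basis. complex_of_real (inverse (1 + (x \<bullet> b)^2)))" .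
  show ?thesis
  proof (rule Bochner_Integration.integrable_bound[OF int])
    have "norm (1 / (1 + norm x) ^ (2 * DIM('a))) \<le> norm (\<Prod>b\<in>Basis. complex_of_real (inverse (1 + (x \<bullet> b)^2)))" for x :: 'a
    proof -
      have pos: "0 < 1 + norm x" by (simp add: add_pos_nonneg)
      have "1 + (x \<bullet> b)^2 \<le> (1 + norm x)^2" if "b \<in> Basis" for b
      proof -
        have "(x \<bullet> b)^2 \<le> (norm x)^2"
          using Basis_le_norm[OF that, of x] by (metis abs_ge_zero power2_abs power_mono)
        then show ?thesis by (simp add: power2_sum add_increasing2)
      qed
      then have "1 / (1 + norm x)^2 \<le> norm (complex_of_real (inverse (1 + (x \<bullet> b)^2)))" if "b \<in> Basis" for b
        unfolding norm_of_real inverse_eq_divide using that pos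
        by (intro order_trans[OF frac_le abs_ge_self]) (auto intro: add_pos_nonneg)
      then have "(\<Prod>b\<in>(Basis::'a set). 1 / (1 + norm x)^2) \<le> (\<Prod>b\<in>Basis. norm (complex_of_real (inverse (1 + (x \<bullet> b)^2))))"
        by (intro prod_mono) auto
      then show ?thesis
        using pos by (simp add: prod_norm power_mult power_one_over)
    qed
    then show "AE x in lborel. norm (1 / (1 + norm x) ^ (2 * DIM('a))) \<le> norm (\<Prod>b\<in>(Basis::'a set). complex_of_real (inverse (1 + (x \<bullet> b)^2)))"
      by simp
  qed measurable
qed

lemma schwartz_integrable:
  fixes f :: "real ^ 'd::finite \<Rightarrow> complex"
  assumes "f \<in> schwartz"
  shows "integrable lborel f"
proof -
  obtain C where C: "C \<ge> 0" "\<And>x. norm (pderivs [] f x) \<le> C / (1 + norm x) ^ (2 * CARD('d))"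
    using schwartz_decay[OF assms] by metis
  show ?thesis
  proof (rule Bochner_Integration.integrable_bound)
    show "integrable lborel (\<lambda>x::real^'d. C * (1 / (1 + norm x) ^ (2 * CARD('d))))"
      using integrable_inverse_norm_power[where 'a="real^'d"] by (intro integrable_mult_right) simp
    show "f \<in> borel_measurable lborel" using smooth_measurable[OF schwartz_smooth[OF assms]] by simp
    have "norm (f x) \<le> norm (C * (1 / (1 + norm x) ^ (2 * CARD('d))))" for x
      using order_trans[OF C(2)[of x] abs_ge_self] by simp
    then show "AE x in lborel. norm (f x) \<le> norm (C * (1 / (1 + norm x) ^ (2 * CARD('d))))" by simp
  qed
qed

subsection \<open>Bounded functionals and convolution\<close>

text \<open>The domain on which the cut-off functional acts. It contains the Schwartz functions and
  is stable under translation, differentiation, convolution with integrable functions and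
  \<open>dist_conv\<close> itself.\<close>

definition bdd_smooth :: "(real ^ 'd::finite \<Rightarrow> complex) set" where
  "bdd_smooth = {f \<in> smooth UNIV. \<forall>w. \<exists>M. \<forall>x. norm (pderivs w f x) \<le> M}"

lemma bdd_smooth_smooth: "f \<in> bdd_smooth \<Longrightarrow> f \<in> smooth UNIV"
  by (simp add: bdd_smooth_def)

lemma schwartz_bdd_smooth: "f \<in> schwartz \<Longrightarrow> f \<in> bdd_smooth"
proof -
  assume f: "f \<in> schwartz"
  have "\<exists>M. \<forall>x. norm (pderivs w f x) \<le> M" for w
  proof -
    obtain C where "\<And>x. norm (pderivs w f x) \<le> C / (1 + norm x) ^ 0"
      using schwartz_decay[OF f] by metis
    then show ?thesis by auto
  qed
  with f show ?thesis by (simp add: bdd_smooth_def schwartz_smooth)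
qed

lemma bdd_smooth_partial:
  assumes "f \<in> bdd_smooth"
  shows "partial i f \<in> bdd_smooth"
proof -
  have "\<exists>M. \<forall>x. norm (pderivs (i # w) f x) \<le> M" for w
    using assms by (auto simp: bdd_smooth_def)
  then show ?thesis
    using assms by (simp add: bdd_smooth_def pderivs_Cons smooth_partial)
qed

lemma bdd_smooth_pderivs: "f \<in> bdd_smooth \<Longrightarrow> pderivs w f \<in> bdd_smooth"
  by (induction w arbitrary: f) (auto simp: pderivs_Cons bdd_smooth_partial)

lemma bdd_smooth_add:
  assumes "f \<in> bdd_smooth" "g \<in> bdd_smooth"
  shows "(\<lambda>x. f x + g x) \<in> bdd_smooth"
proof -
  have "\<exists>M. \<forall>x. norm (pderivs w (\<lambda>x. f x + g x) x) \<le> M" for w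
  proof -
    obtain M1 M2 where "\<And>x. norm (pderivs w f x) \<le> M1" "\<And>x. norm (pderivs w g x) \<le> M2"
      using assms by (fastforce simp: bdd_smooth_def)
    then have "\<forall>x. norm (pderivs w (\<lambda>x. f x + g x) x) \<le> M1 + M2"
      using assms by (auto simp: pderivs_add bdd_smooth_smooth intro!: norm_triangle_le add_mono)
    then show ?thesis ..
  qed
  with assms show ?thesis by (auto simp: bdd_smooth_def smooth_add)
qed

lemma bdd_smooth_cmult:
  assumes "f \<in> bdd_smooth"
  shows "(\<lambda>x. c * f x) \<in> bdd_smooth"
proof -
  have "\<exists>M. \<forall>x. norm (pderivs w (\<lambda>x. c * f x) x) \<le> M" for w
  proof -
    obtain M where "\<And>x. norm (pderivs w f x) \<le> M"
      using assms by (fastforce simp: bdd_smooth_def)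
    then have "\<forall>x. norm (pderivs w (\<lambda>x. c * f x) x) \<le> norm c * M"
      using assms by (auto simp: pderivs_cmult bdd_smooth_smooth norm_mult intro!: mult_left_mono)
    then show ?thesis ..
  qed
  with assms show ?thesis by (auto simp: bdd_smooth_def smooth_cmult)
qed

lemma bdd_smooth_zero: "(\<lambda>x. 0) \<in> bdd_smooth"
  by (intro schwartz_bdd_smooth schwartz_zero)

lemma bdd_smooth_sum: "(\<And>a. a \<in> A \<Longrightarrow> f a \<in> bdd_smooth) \<Longrightarrow> (\<lambda>x. \<Sum>a\<in>A. f a x) \<in> bdd_smooth"
  by (induction A rule: infinite_finite_induct) (auto intro: bdd_smooth_zero bdd_smooth_add)

lemma bdd_smooth_diff: "f \<in> bdd_smooth \<Longrightarrow> g \<in> bdd_smooth \<Longrightarrow> (\<lambda>x. f x - g x) \<in> bdd_smooth"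
  using bdd_smooth_add[of f "\<lambda>x. (-1) * g x"] bdd_smooth_cmult[of g "-1"] by simp

lemma pderivs_diff:
  "f \<in> smooth UNIV \<Longrightarrow> g \<in> smooth UNIV \<Longrightarrow> pderivs w (\<lambda>x. f x - g x) = (\<lambda>x. pderivs w f x - pderivs w g x)"
  using pderivs_add[of f "\<lambda>x. (-1) * g x" w] pderivs_cmult[of g w "-1"] smooth_cmult[of g "-1"] by simp

lemma bdd_smooth_affine:
  assumes "f \<in> bdd_smooth"
  shows "(\<lambda>x. f (a *\<^sub>R x + b)) \<in> bdd_smooth"
proof -
  have "\<exists>M. \<forall>x. norm (pderivs w (\<lambda>x. f (a *\<^sub>R x + b)) x) \<le> M" for w
  proof -
    obtain M where "\<And>x. norm (pderivs w f x) \<le> M"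
      using assms by (fastforce simp: bdd_smooth_def)
    then have "\<forall>x. norm (pderivs w (\<lambda>x. f (a *\<^sub>R x + b)) x) \<le> \<bar>a\<bar> ^ length w * M"
      using assms by (auto simp: pderivs_affine bdd_smooth_smooth norm_mult norm_power intro!: mult_left_mono)
    then show ?thesis ..
  qed
  with assms show ?thesis by (auto simp: bdd_smooth_def smooth_affine)
qed

lemma bdd_smooth_shift: "f \<in> bdd_smooth \<Longrightarrow> (\<lambda>x. f (x + b)) \<in> bdd_smooth"
  and bdd_smooth_reflect: "f \<in> bdd_smooth \<Longrightarrow> (\<lambda>y. f (x - y)) \<in> bdd_smooth"
  using bdd_smooth_affine[of f 1 b] bdd_smooth_affine[of f "-1" x] by simp_all

lemma pderivs_shift: "f \<in> smooth UNIV \<Longrightarrow> pderivs w (\<lambda>x. f (x + b)) = (\<lambda>x. pderivs w f (x + b))"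
  using pderivs_affine[of f w 1 b] by simp

text \<open>There are finitely many words of length at most \<open>N\<close>, so the bounds for the
  single words can be added up.\<close>

lemma bdd_smooth_uniform:
  fixes f :: "real ^ 'd::finite \<Rightarrow> complex"
  assumes "f \<in> bdd_smooth"
  obtains M where "M \<ge> 0" "\<And>w x. length w \<le> N \<Longrightarrow> norm (pderivs w f x) \<le> M"
proof -
  obtain B where B: "\<And>w x. norm (pderivs w f x) \<le> B w"
    using assms unfolding bdd_smooth_def by (auto, metis)
  have Bp: "B w \<ge> 0" for w by (rule order_trans[OF norm_ge_zero B])
  have fin: "finite {w :: 'd list. length w \<le> N}"
    using finite_lists_length_le[OF finite_class.finite_UNIV, of N] by simp
  show ?thesis
  proof
    show "(\<Sum>w\<in>{w. length w \<le> N}. B w) \<ge> 0" by (intro sum_nonneg Bp)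
    show "norm (pderivs w f x) \<le> (\<Sum>w\<in>{w. length w \<le> N}. B w)" if "length w \<le> N" for w x
      using that by (intro order_trans[OF B] member_le_sum fin) (auto simp: Bp)
  qed
qed

lemma bdd_smooth_bounded:
  assumes "f \<in> bdd_smooth"
  obtains M where "M \<ge> 0" "\<And>x. norm (f x) \<le> M"
proof -
  obtain M where "M \<ge> 0" "\<And>w x. length w \<le> 0 \<Longrightarrow> norm (pderivs w f x) \<le> M"
    using bdd_smooth_uniform[OF assms] by metis
  then show ?thesis using that[of M] by (metis le_refl list.size(3) pderivs_Nil)
qed

lemma bounded_partials_lipschitz:
  fixes f :: "real ^ 'd::finite \<Rightarrow> complex"
  assumes "f \<in> smooth UNIV" "\<And>i x. norm (partial i f x) \<le> M"
  shows "norm (f x - f y) \<le> real CARD('d) * M * norm (x - y)"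
proof (rule differentiable_bound[where S = UNIV])
  show "(f has_derivative (\<lambda>h. \<Sum>i\<in>UNIV. of_real (h $ i) * partial i f x)) (at x within UNIV)" for x
    by (rule smooth_has_derivative[OF assms(1)])
  have M: "0 \<le> M" by (rule order_trans[OF norm_ge_zero assms(2)])
  show "onorm (\<lambda>h. \<Sum>i\<in>UNIV. of_real (h $ i) * partial i f x) \<le> real CARD('d) * M" for x
  proof (rule onorm_bound)
    fix h :: "real ^ 'd"
    have "norm (\<Sum>i\<in>UNIV. of_real (h $ i) * partial i f x) \<le> (\<Sum>i\<in>UNIV. \<bar>h $ i\<bar> * M)"
      by (intro sum_norm_le) (auto simp: norm_mult intro!: mult_left_mono assms(2))
    also have "\<dots> = (\<Sum>i\<in>UNIV. \<bar>h $ i\<bar>) * M" by (simp add: sum_distrib_right)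
    also have "\<dots> \<le> (real CARD('d) * norm h) * M"
      by (intro mult_right_mono sum_coords_bound M)
    finally show "norm (\<Sum>i\<in>UNIV. of_real (h $ i) * partial i f x) \<le> real CARD('d) * M * norm h"
      by (simp add: mult_ac)
  qed (use M in auto)
qed auto

lemma bdd_smooth_lipschitz:
  fixes f :: "real ^ 'd::finite \<Rightarrow> complex"
  assumes "f \<in> bdd_smooth"
  obtains M where "M \<ge> 0" "\<And>w x. length w \<le> N \<Longrightarrow> norm (pderivs w f x) \<le> M"
    "\<And>w x y. length w \<le> N \<Longrightarrow> norm (pderivs w f x - pderivs w f y) \<le> M * norm (x - y)"
proof -
  obtain M where M: "M \<ge> 0" "\<And>w x. length w \<le> Suc N \<Longrightarrow> norm (pderivs w f x) \<le> M"
    using bdd_smooth_uniform[OF assms] by metis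
  have c: "1 \<le> real CARD('d)" using zero_less_card_finite[where 'a='d] by linarith
  show ?thesis
  proof
    show "real CARD('d) * M \<ge> 0" using M by simp
    show "norm (pderivs w f x) \<le> real CARD('d) * M" if "length w \<le> N" for w x
    proof -
      have "norm (pderivs w f x) \<le> 1 * M" using that M(2)[of w x] by simp
      also have "\<dots> \<le> real CARD('d) * M" by (intro mult_right_mono c M)
      finally show ?thesis .
    qed
    show "norm (pderivs w f x - pderivs w f y) \<le> real CARD('d) * M * norm (x - y)" if "length w \<le> N" for w x y
    proof (rule bounded_partials_lipschitz)
      show "pderivs w f \<in> smooth UNIV" using assms by (intro smooth_pderivs bdd_smooth_smooth)
      show "norm (partial i (pderivs w f) x) \<le> M" for i x
        using M(2)[of "i # w" x] that assms by (simp add: partial_pderivs bdd_smooth_smooth pderivs_Cons)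
    qed
  qed
qed

text \<open>Two applications of the mean value inequality, first to the partial derivative and then
  to \<open>f\<close>; this yields the constant M rather than M/2.\<close>

lemma second_order_bound:
  fixes f :: "real ^ 'd::finite \<Rightarrow> complex"
  assumes f: "f \<in> smooth UNIV" and M: "\<And>s. \<bar>s\<bar> \<le> \<bar>t\<bar> \<Longrightarrow> norm (partial i (partial i f) (x + s *\<^sub>R axis i 1)) \<le> M"
  shows "norm (f (x + t *\<^sub>R axis i 1) - f x - of_real t * partial i f x) \<le> M * t\<^sup>2"
proof -
  have line: "((\<lambda>t. g (x + t *\<^sub>R axis i 1)) has_vector_derivative partial i g (x + s *\<^sub>R axis i 1)) (at s)"
    if "g \<in> smooth UNIV" for g s
    by (rule has_vector_derivative_line[OF smooth_CkD[OF that]]) simp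
  have M0: "0 \<le> M" by (rule order_trans[OF norm_ge_zero M[of 0]]) simp
  have 1: "norm (partial i f (x + s *\<^sub>R axis i 1) - partial i f x) \<le> M * \<bar>s\<bar>" if "\<bar>s\<bar> \<le> \<bar>t\<bar>" for s
    using that norm_linepath_bound[of s "\<lambda>s. partial i f (x + s *\<^sub>R axis i 1)" "\<lambda>s. partial i (partial i f) (x + s *\<^sub>R axis i 1)" 0 M,
      OF line[OF smooth_partial[OF f]]] M by simp
  have "norm (f (x + t *\<^sub>R axis i 1) - f (x + 0 *\<^sub>R axis i 1) - of_real t * partial i f x) \<le> (M * \<bar>t\<bar>) * \<bar>t\<bar>"
    by (rule norm_linepath_bound[where g = "\<lambda>s. f (x + s *\<^sub>R axis i 1)", OF line[OF f]])
      (auto intro!: order_trans[OF 1] mult_left_mono M0)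
  then show ?thesis by (simp add: power2_eq_square mult.assoc)
qed

text \<open>An explicit quadratic error takes the place of interchanging limits. Derivatives under
  \<open>U\<close>, under the Fourier integral and at the flat point of the cutoff are all obtained
  in this way.\<close>

lemma has_vector_derivative_quadratic:
  fixes g :: "real \<Rightarrow> complex"
  assumes "\<And>t. \<bar>t\<bar> \<le> 1 \<Longrightarrow> norm (g t - g 0 - of_real t * d) \<le> B * t\<^sup>2"
  shows "(g has_vector_derivative d) (at 0)"
  unfolding has_vector_derivative_def
proof (rule has_derivativeI)
  show "((\<lambda>t. (g t - g 0 - (t - 0) *\<^sub>R d) /\<^sub>R norm (t - 0)) \<longlongrightarrow> 0) (at 0)"
  proof (rule Lim_null_comparison)
    have "norm ((g t - g 0 - (t - 0) *\<^sub>R d) /\<^sub>R norm (t - 0)) \<le> B * \<bar>t\<bar>" if "t \<noteq> 0" "\<bar>t\<bar> \<le> 1" for t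
    proof -
      have "norm ((g t - g 0 - (t - 0) *\<^sub>R d) /\<^sub>R norm (t - 0)) = norm (g t - g 0 - of_real t * d) / \<bar>t\<bar>"
        by (simp add: scaleR_conv_of_real divide_inverse mult.commute norm_mult norm_inverse)
      also have "\<dots> \<le> (B * t\<^sup>2) / \<bar>t\<bar>" using that by (intro divide_right_mono assms) auto
      also have "\<dots> = B * \<bar>t\<bar>" using that by (simp add: power2_eq_square abs_if)
      finally show ?thesis .
    qed
    then show "\<forall>\<^sub>F t in at 0. norm ((g t - g 0 - (t - 0) *\<^sub>R d) /\<^sub>R norm (t - 0)) \<le> B * \<bar>t\<bar>"
      by (auto simp: eventually_at intro!: exI[of _ 1])
    show "((\<lambda>t. B * \<bar>t\<bar>) \<longlongrightarrow> 0) (at 0)"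
      by (rule tendsto_eq_intros | simp)+
  qed
qed (auto intro: bounded_linear_scaleR_left)

section \<open>Convolution with bounded functionals and with integrable functions\<close>

definition conv :: "(real ^ 'd::finite \<Rightarrow> complex) \<Rightarrow> (real ^ 'd \<Rightarrow> complex) \<Rightarrow> real ^ 'd \<Rightarrow> complex" where
  "conv f g x = (LINT y|lborel. f (x - y) * g y)"

lemma integrable_bounded_mult:
  fixes F :: "'a \<Rightarrow> complex"
  assumes "integrable M h" "F \<in> borel_measurable M" "\<And>x. norm (F x) \<le> B"
  shows "integrable M (\<lambda>x. F x * h x)"
proof (rule Bochner_Integration.integrable_bound)
  show "integrable M (\<lambda>x. B * norm (h x))" using assms(1) by simp
  show "(\<lambda>x. F x * h x) \<in> borel_measurable M"
    using assms(2) borel_measurable_integrable[OF assms(1)] by (rule borel_measurable_times)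
  have "norm (F x * h x) \<le> norm (B * norm (h x))" for x
    using mult_right_mono[OF assms(3)[of x], of "norm (h x)"] by (simp add: norm_mult)
  then show "AE x in M. norm (F x * h x) \<le> norm (B * norm (h x))" by simp
qed

text \<open>Abstracts the cut-off distribution, with \<open>K\<close> the closed support of the
  cutoff function and \<open>N\<close> the order. Integration against an integrable function is a
  second instance, with \<open>UNIV\<close> for \<open>K\<close> and 0 for \<open>N\<close>, so that
  ordinary convolution inherits the results.\<close>

locale bounded_functional =
  fixes U :: "'d::finite functional" and K :: "(real ^ 'd) set" and C :: real and N :: nat
  assumes linear: "f \<in> bdd_smooth \<Longrightarrow> g \<in> bdd_smooth \<Longrightarrow> U (\<lambda>x. a * f x + b * g x) = a * U f + b * U g"
    and bound: "f \<in> bdd_smooth \<Longrightarrow> (\<And>w y. length w \<le> N \<Longrightarrow> y \<in> K \<Longrightarrow> norm (pderivs w f y) \<le> M) \<Longrightarrow> 0 \<le> M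
      \<Longrightarrow> norm (U f) \<le> C * M"
    and C_nonneg: "0 \<le> C"
begin

text \<open>The functional sees \<psi> on x - K alone; the estimate away from the support relies on
  this version.\<close>

lemma dist_conv_bound_on:
  assumes "\<psi> \<in> bdd_smooth" "0 \<le> M"
    and "\<And>w y. length w \<le> N \<Longrightarrow> y \<in> K \<Longrightarrow> norm (pderivs w \<psi> (x - y)) \<le> M"
  shows "norm (dist_conv U \<psi> x) \<le> C * M"
  unfolding dist_conv_def
  by (rule bound) (use assms in \<open>auto simp: bdd_smooth_reflect pderivs_reflect bdd_smooth_smooth norm_mult norm_power\<close>)

lemma dist_conv_bound:
  assumes "\<psi> \<in> bdd_smooth" "0 \<le> M" "\<And>w z. length w \<le> N \<Longrightarrow> norm (pderivs w \<psi> z) \<le> M"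
  shows "norm (dist_conv U \<psi> x) \<le> C * M"
  by (rule dist_conv_bound_on) (use assms in auto)

lemma dist_conv_linear:
  "f \<in> bdd_smooth \<Longrightarrow> g \<in> bdd_smooth \<Longrightarrow>
    dist_conv U (\<lambda>x. a * f x + b * g x) x = a * dist_conv U f x + b * dist_conv U g x"
  unfolding dist_conv_def by (rule linear) (auto intro: bdd_smooth_reflect)

lemma dist_conv_cmult: "f \<in> bdd_smooth \<Longrightarrow> dist_conv U (\<lambda>x. a * f x) x = a * dist_conv U f x"
  and dist_conv_add: "f \<in> bdd_smooth \<Longrightarrow> g \<in> bdd_smooth \<Longrightarrow> dist_conv U (\<lambda>x. f x + g x) x = dist_conv U f x + dist_conv U g x"
  and dist_conv_diff: "f \<in> bdd_smooth \<Longrightarrow> g \<in> bdd_smooth \<Longrightarrow> dist_conv U (\<lambda>x. f x - g x) x = dist_conv U f x - dist_conv U g x"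
  using dist_conv_linear[of f f a 0 x] dist_conv_linear[of f g 1 1 x] dist_conv_linear[of f g 1 "-1" x] by simp_all

lemma dist_conv_sum:
  assumes "finite A" "\<And>a. a \<in> A \<Longrightarrow> f a \<in> bdd_smooth"
  shows "dist_conv U (\<lambda>x. \<Sum>a\<in>A. f a x) x = (\<Sum>a\<in>A. dist_conv U (f a) x)"
  using assms
proof (induction A)
  case empty
  then show ?case using dist_conv_cmult[OF bdd_smooth_zero, of 0] by simp
qed (simp add: dist_conv_add bdd_smooth_sum)

text \<open>By linearity, the remainder of the difference quotient of
  \<open>dist_conv U \<psi>\<close> is \<open>dist_conv U r\<close> with \<open>r\<close> the
  remainder for \<psi>. The derivatives of \<open>r\<close> up to order \<open>N\<close> are
  quadratically small, uniformly in space, by the bounds on \<psi> up to order N + 2.\<close>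

lemma dist_conv_has_partial:
  assumes "\<psi> \<in> bdd_smooth"
  shows "((\<lambda>t. dist_conv U \<psi> (x + t *\<^sub>R axis i 1)) has_vector_derivative dist_conv U (partial i \<psi>) x) (at 0)"
proof -
  note sm = bdd_smooth_smooth[OF assms]
  obtain M where M: "M \<ge> 0" "\<And>w x. length w \<le> N + 2 \<Longrightarrow> norm (pderivs w \<psi> x) \<le> M"
    using bdd_smooth_uniform[OF assms] by metis
  show ?thesis
  proof (rule has_vector_derivative_quadratic)
    fix t :: real
    let ?e = "t *\<^sub>R axis i (1::real)"
    define r where "r z = (\<psi> (z + ?e) - \<psi> z) - of_real t * partial i \<psi> z" for z
    have r: "r \<in> bdd_smooth"
      unfolding r_def by (intro bdd_smooth_diff bdd_smooth_shift bdd_smooth_cmult bdd_smooth_partial assms)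
    have "norm (dist_conv U r x) \<le> C * (M * t\<^sup>2)"
    proof (rule dist_conv_bound[OF r])
      show "0 \<le> M * t\<^sup>2" using M(1) by simp
      fix w :: "'d list" and z assume w: "length w \<le> N"
      have "pderivs w r z = pderivs w \<psi> (z + ?e) - pderivs w \<psi> z - of_real t * partial i (pderivs w \<psi>) z"
        unfolding r_def using assms sm
        by (simp add: pderivs_diff pderivs_cmult pderivs_shift partial_pderivs bdd_smooth_smooth bdd_smooth_diff bdd_smooth_shift
            bdd_smooth_cmult bdd_smooth_partial)
      moreover have "norm (pderivs w \<psi> (z + ?e) - pderivs w \<psi> z - of_real t * partial i (pderivs w \<psi>) z) \<le> M * t\<^sup>2"
      proof (rule second_order_bound[OF smooth_pderivs[OF sm]])
        show "norm (partial i (partial i (pderivs w \<psi>)) (z + s *\<^sub>R axis i 1)) \<le> M" for s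
          using M(2)[of "i # i # w" "z + s *\<^sub>R axis i 1"] w sm by (simp add: partial_pderivs smooth_partial pderivs_Cons)
      qed
      ultimately show "norm (pderivs w r z) \<le> M * t\<^sup>2" by simp
    qed
    moreover have "dist_conv U r x = (dist_conv U (\<lambda>z. \<psi> (z + ?e)) x - dist_conv U \<psi> x) - of_real t * dist_conv U (partial i \<psi>) x"
      unfolding r_def using assms
      by (simp add: dist_conv_diff dist_conv_cmult bdd_smooth_diff bdd_smooth_shift bdd_smooth_cmult bdd_smooth_partial)
    moreover have "dist_conv U (\<lambda>z. \<psi> (z + ?e)) x = dist_conv U \<psi> (x + ?e)"
      by (simp add: dist_conv_def algebra_simps)
    ultimately show "norm (dist_conv U \<psi> (x + t *\<^sub>R axis i 1) - dist_conv U \<psi> (x + 0 *\<^sub>R axis i 1) - of_real t * dist_conv U (partial i \<psi>) x) \<le> (C * M) * t\<^sup>2"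
      by (simp add: mult.assoc)
  qed
qed

text \<open>The difference of two values is the value at one point for the difference of two
  translates of \<psi>.\<close>

lemma dist_conv_lipschitz:
  assumes "\<psi> \<in> bdd_smooth"
  obtains M where "M \<ge> 0" "\<And>x. norm (dist_conv U \<psi> x) \<le> M" "\<And>x y. norm (dist_conv U \<psi> x - dist_conv U \<psi> y) \<le> M * norm (x - y)"
proof -
  obtain M where M: "M \<ge> 0" "\<And>w x. length w \<le> N \<Longrightarrow> norm (pderivs w \<psi> x) \<le> M"
    "\<And>w x y. length w \<le> N \<Longrightarrow> norm (pderivs w \<psi> x - pderivs w \<psi> y) \<le> M * norm (x - y)"
    using bdd_smooth_lipschitz[OF assms] by metis
  show ?thesis
  proof
    show "0 \<le> C * M" using C_nonneg M by simp
    show "norm (dist_conv U \<psi> x) \<le> C * M" for x by (rule dist_conv_bound[OF assms M(1,2)])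
    fix x y
    let ?g = "\<lambda>z. \<psi> (z + (x - y)) - \<psi> z"
    have "norm (dist_conv U ?g y) \<le> C * (M * norm (x - y))"
    proof (rule dist_conv_bound)
      show "?g \<in> bdd_smooth" by (intro bdd_smooth_diff bdd_smooth_shift assms)
      show "0 \<le> M * norm (x - y)" using M by simp
      show "norm (pderivs w ?g z) \<le> M * norm (x - y)" if "length w \<le> N" for w z
        using M(3)[OF that, of "z + (x - y)" z] assms
        by (simp add: pderivs_diff pderivs_shift bdd_smooth_smooth bdd_smooth_shift)
    qed
    moreover have "dist_conv U ?g y = dist_conv U (\<lambda>z. \<psi> (z + (x - y))) y - dist_conv U \<psi> y"
      by (rule dist_conv_diff) (intro bdd_smooth_shift assms)+
    moreover have "dist_conv U (\<lambda>z. \<psi> (z + (x - y))) y = dist_conv U \<psi> x"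
      by (simp add: dist_conv_def algebra_simps)
    ultimately show "norm (dist_conv U \<psi> x - dist_conv U \<psi> y) \<le> C * M * norm (x - y)" by (simp add: mult.assoc)
  qed
qed

lemma dist_conv_smooth:
  assumes "\<psi> \<in> bdd_smooth"
  shows "dist_conv U \<psi> \<in> smooth UNIV"
proof (rule smooth_coinduct[where X = "{dist_conv U \<psi> |\<psi>. \<psi> \<in> bdd_smooth}"])
  show "dist_conv U \<psi> \<in> {dist_conv U \<psi> |\<psi>. \<psi> \<in> bdd_smooth}" using assms by blast
next
  fix g assume "g \<in> {dist_conv U \<psi> |\<psi>. \<psi> \<in> bdd_smooth}"
  then obtain \<psi> where g: "g = dist_conv U \<psi>" "\<psi> \<in> bdd_smooth" by blast
  obtain M where M: "M \<ge> 0" "\<And>x y. norm (g x - g y) \<le> M * norm (x - y)"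
    using dist_conv_lipschitz[OF g(2)] g(1) by metis
  then have "M-lipschitz_on UNIV g" by (auto simp: lipschitz_on_def dist_norm)
  then show "continuous_on UNIV g" by (rule lipschitz_on_continuous_on)
  show "\<exists>h\<in>{dist_conv U \<psi> |\<psi>. \<psi> \<in> bdd_smooth}.
     \<forall>x. ((\<lambda>t. g (x + t *\<^sub>R axis i 1)) has_vector_derivative h x) (at 0)" for i
    using dist_conv_has_partial[OF g(2)] bdd_smooth_partial[OF g(2)] g(1) by blast
qed

lemma partial_dist_conv: "\<psi> \<in> bdd_smooth \<Longrightarrow> partial i (dist_conv U \<psi>) = dist_conv U (partial i \<psi>)"
  by (rule ext, rule partial_eqI) (rule dist_conv_has_partial)

lemma pderivs_dist_conv: "\<psi> \<in> bdd_smooth \<Longrightarrow> pderivs w (dist_conv U \<psi>) = dist_conv U (pderivs w \<psi>)"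
  by (induction w arbitrary: \<psi>) (simp_all add: pderivs_Cons partial_dist_conv bdd_smooth_partial)

lemma dist_conv_bdd_smooth:
  assumes "\<psi> \<in> bdd_smooth"
  shows "dist_conv U \<psi> \<in> bdd_smooth"
proof -
  have "\<exists>M. \<forall>x. norm (pderivs w (dist_conv U \<psi>) x) \<le> M" for w
  proof -
    obtain M where "\<And>x. norm (dist_conv U (pderivs w \<psi>) x) \<le> M"
      using dist_conv_lipschitz[OF bdd_smooth_pderivs[OF assms, of w]] by metis
    then show ?thesis by (auto simp: pderivs_dist_conv[OF assms])
  qed
  then show ?thesis
    using dist_conv_smooth[OF assms] by (simp add: bdd_smooth_def)
qed

end

lemma bounded_functional_integral:
  fixes h :: "real ^ 'd::finite \<Rightarrow> complex"
  assumes h: "integrable lborel h"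
  shows "bounded_functional (\<lambda>f. LINT y|lborel. f y * h y) UNIV (LINT y|lborel. norm (h y)) 0"
proof
  have int: "integrable lborel (\<lambda>y. f y * h y)" if f: "f \<in> bdd_smooth" for f
  proof -
    obtain M where "\<And>x. norm (f x) \<le> M" using bdd_smooth_bounded[OF f] by metis
    then show ?thesis
      using smooth_measurable[OF bdd_smooth_smooth[OF f]] by (intro integrable_bounded_mult[OF h]) auto
  qed
  show "(LINT y|lborel. (a * f y + b * g y) * h y) = a * (LINT y|lborel. f y * h y) + b * (LINT y|lborel. g y * h y)"
    if "f \<in> bdd_smooth" "g \<in> bdd_smooth" for f g a b
    using int[OF that(1)] int[OF that(2)] by (simp add: distrib_right mult.assoc)
  show "norm (LINT y|lborel. f y * h y) \<le> (LINT y|lborel. norm (h y)) * M"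
    if f: "f \<in> bdd_smooth" and M: "\<And>w y. length w \<le> 0 \<Longrightarrow> y \<in> UNIV \<Longrightarrow> norm (pderivs w f y) \<le> M" "0 \<le> M" for f M
  proof -
    have "norm (LINT y|lborel. f y * h y) \<le> (LINT y|lborel. norm (f y * h y))" by (rule integral_norm_bound)
    also have "\<dots> \<le> (LINT y|lborel. M * norm (h y))"
      using M(1)[of "[]"] by (intro integral_mono integrable_norm int f integrable_mult_right h)
        (auto simp: norm_mult intro!: mult_right_mono)
    finally show ?thesis using h by (simp add: mult.commute)
  qed
qed simp

lemma conv_eq_dist_conv: "conv \<psi> h = dist_conv (\<lambda>f. LINT y|lborel. f y * h y) \<psi>"
  by (simp add: fun_eq_iff conv_def dist_conv_def)

lemma conv_bdd_smooth: "\<psi> \<in> bdd_smooth \<Longrightarrow> integrable lborel h \<Longrightarrow> conv \<psi> h \<in> bdd_smooth"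
  and pderivs_conv: "\<psi> \<in> bdd_smooth \<Longrightarrow> integrable lborel h \<Longrightarrow> pderivs w (conv \<psi> h) = conv (pderivs w \<psi>) h"
  and partial_conv: "\<psi> \<in> bdd_smooth \<Longrightarrow> integrable lborel h \<Longrightarrow> partial i (conv \<psi> h) = conv (partial i \<psi>) h"
  unfolding conv_eq_dist_conv
  by (auto intro: bounded_functional.dist_conv_bdd_smooth bounded_functional.pderivs_dist_conv
      bounded_functional.partial_dist_conv bounded_functional_integral)

lemma conv_integrable:
  assumes "\<psi> \<in> bdd_smooth" "integrable lborel h"
  shows "integrable lborel (\<lambda>y. \<psi> (x - y) * h y)"
proof -
  obtain M where "\<And>x. norm (\<psi> x) \<le> M" using bdd_smooth_bounded[OF assms(1)] by metis
  then show ?thesis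
    using smooth_measurable[OF bdd_smooth_smooth[OF bdd_smooth_reflect[OF assms(1), of x]]]
    by (intro integrable_bounded_mult[OF assms(2)]) auto
qed

lemma conv_bound:
  assumes \<psi>: "\<psi> \<in> bdd_smooth" and h: "integrable lborel h" and M: "\<And>z. norm (\<psi> z) \<le> M"
  shows "norm (conv \<psi> h x) \<le> M * (LINT y|lborel. norm (h y))"
proof -
  have "norm (conv \<psi> h x) \<le> (LINT y|lborel. norm (\<psi> (x - y) * h y))"
    unfolding conv_def by (rule integral_norm_bound)
  also have "\<dots> \<le> (LINT y|lborel. M * norm (h y))"
    by (intro integral_mono integrable_norm conv_integrable \<psi> integrable_mult_right h)
      (auto simp: norm_mult intro!: mult_right_mono M)
  finally show ?thesis by simp
qed

text \<open>Composition with a simple function leaves finitely many values of \<open>F\<close>. With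
  F v = \<psi> (y - v) this is the linear combination of translates that approximates a
  convolution.\<close>

lemma integral_simple_function_compose:
  fixes q :: "'a \<Rightarrow> 'b::euclidean_space" and F :: "'b \<Rightarrow> complex"
  assumes h: "integrable M h" and q: "simple_function M q"
  shows "(LINT z|M. F (q z) * h z) = (\<Sum>v\<in>q ` space M. (LINT z|M. indicator (q -` {v} \<inter> space M) z * h z) * F v)"
    and "integrable M (\<lambda>z. F (q z) * h z)"
proof -
  have fin: "finite (q ` space M)" using q by (simp add: simple_function_def)
  have int: "integrable M (\<lambda>z. indicator (q -` {v} \<inter> space M) z * h z)" for v
  proof (rule integrable_bounded_mult[OF h, where B = 1])
    show "(\<lambda>z. indicator (q -` {v} \<inter> space M) z :: complex) \<in> borel_measurable M"
      using simple_functionD(2)[OF q, of "{v}"] by (rule borel_measurable_indicator)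
  qed (auto simp: indicator_def)
  have eq: "F (q z) * h z = (\<Sum>v\<in>q ` space M. indicator (q -` {v} \<inter> space M) z * h z * F v)" if "z \<in> space M" for z
  proof -
    have "(\<Sum>v\<in>q ` space M. indicator (q -` {v} \<inter> space M) z * h z * F v)
      = (\<Sum>v\<in>q ` space M. if v = q z then h z * F v else 0)"
      by (intro sum.cong) (auto simp: indicator_def that)
    also have "\<dots> = h z * F (q z)" using fin that by simp
    finally show ?thesis by (simp add: mult.commute)
  qed
  have "(LINT z|M. F (q z) * h z) = (LINT z|M. (\<Sum>v\<in>q ` space M. indicator (q -` {v} \<inter> space M) z * h z * F v))"
    by (rule Bochner_Integration.integral_cong[OF refl eq])
  also have "\<dots> = (\<Sum>v\<in>q ` space M. (LINT z|M. indicator (q -` {v} \<inter> space M) z * h z) * F v)"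
    using int by (simp add: Bochner_Integration.integral_sum)
  finally show "(LINT z|M. F (q z) * h z) = (\<Sum>v\<in>q ` space M. (LINT z|M. indicator (q -` {v} \<inter> space M) z * h z) * F v)" .
  have "integrable M (\<lambda>z. (\<Sum>v\<in>q ` space M. indicator (q -` {v} \<inter> space M) z * h z * F v))"
    using int by (intro Bochner_Integration.integrable_sum integrable_mult_left)
  then show "integrable M (\<lambda>z. F (q z) * h z)"
    by (subst Bochner_Integration.integrable_cong[OF refl eq])
qed

text \<open>
  A bounded functional commutes with the convolution integral because the latter is approximated,
  with all derivatives and uniformly, by finite linear combinations of translates of \<open>\<psi>\<close>.
\<close>

lemma (in bounded_functional) dist_conv_conv:
  assumes \<psi>: "\<psi> \<in> bdd_smooth" and h: "integrable lborel h"
  shows "dist_conv U (conv \<psi> h) x = conv (dist_conv U \<psi>) h x"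
proof -
  obtain q :: "nat \<Rightarrow> real ^ 'd \<Rightarrow> real ^ 'd" where q: "\<And>n. simple_function lborel (q n)" "\<And>z. (\<lambda>n. q n z) \<longlonglongrightarrow> z"
    using borel_measurable_implies_sequence_metric[of "\<lambda>z::real^'d. z" lborel 0] by auto
  note qm [measurable] = borel_measurable_simple_function[OF q(1)]
  note hm [measurable] = borel_measurable_integrable[OF h]
  let ?\<Psi> = "dist_conv U \<psi>"
  have \<Psi>: "?\<Psi> \<in> bdd_smooth" by (rule dist_conv_bdd_smooth[OF \<psi>])
  \<comment> \<open>The error of replacing \<open>z\<close> by \<open>q n z\<close>: the Lipschitz
    term makes the integrand tend to 0 pointwise, and the term 2 M makes it dominated by a multiple
    of |h z|.\<close>
  define E where "E M n = (LINT z|lborel. min (2 * M) (M * norm (q n z - z)) * norm (h z))" for M :: real and n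
  have Eint: "integrable lborel (\<lambda>z. min (2 * M) (M * norm (q n z - z)) * norm (h z))" if "M \<ge> 0" for M n
  proof (rule Bochner_Integration.integrable_bound)
    show "integrable lborel (\<lambda>z. 2 * M * norm (h z))" using h by simp
    show "AE z in lborel. norm (min (2 * M) (M * norm (q n z - z)) * norm (h z)) \<le> norm (2 * M * norm (h z))"
      using that by (auto simp: abs_mult intro!: mult_right_mono AE_I2)
  qed measurable
  have E0: "(\<lambda>n. E M n) \<longlonglongrightarrow> 0" if "M \<ge> 0" for M
  proof -
    have "(\<lambda>n. LINT z|lborel. min (2 * M) (M * norm (q n z - z)) * norm (h z)) \<longlonglongrightarrow> (LINT z::real^'d|lborel. (0::real))"
    proof (rule integral_dominated_convergence[where w = "\<lambda>z. 2 * M * norm (h z)" and M = lborel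
          and s = "\<lambda>n z. min (2 * M) (M * norm (q n z - z)) * norm (h z)" and f = "\<lambda>z. 0::real"])
      show "integrable lborel (\<lambda>z. 2 * M * norm (h z))" using h by simp
      show "AE z in lborel. norm (min (2 * M) (M * norm (q n z - z)) * norm (h z)) \<le> 2 * M * norm (h z)" for n
        using that by (auto simp: abs_mult intro!: mult_right_mono AE_I2)
      show "AE z in lborel. (\<lambda>n. min (2 * M) (M * norm (q n z - z)) * norm (h z)) \<longlonglongrightarrow> 0"
      proof (rule AE_I2)
        fix z
        have "(\<lambda>n. min (2 * M) (M * norm (q n z - z)) * norm (h z)) \<longlonglongrightarrow> min (2 * M) (M * norm (z - z)) * norm (h z)"
          by (intro tendsto_intros q)
        then show "(\<lambda>n. min (2 * M) (M * norm (q n z - z)) * norm (h z)) \<longlonglongrightarrow> 0" using that by simp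
      qed
    qed measurable
    then show ?thesis by (simp add: E_def)
  qed
  have diff: "norm ((LINT z|lborel. F (y - q n z) * h z) - conv F h y) \<le> E M n"
    if F: "F \<in> bdd_smooth" and M: "M \<ge> 0" "\<And>x. norm (F x) \<le> M" "\<And>x y. norm (F x - F y) \<le> M * norm (x - y)" for F M y n
  proof -
    have i1: "integrable lborel (\<lambda>z. F (y - q n z) * h z)"
      by (rule integral_simple_function_compose(2)[OF h q(1)[of n], where F = "\<lambda>v. F (y - v)"])
    have i2: "integrable lborel (\<lambda>z. F (y - z) * h z)" by (rule conv_integrable[OF F h])
    have "(LINT z|lborel. F (y - q n z) * h z) - conv F h y = (LINT z|lborel. F (y - q n z) * h z - F (y - z) * h z)"
      using i1 i2 by (simp add: conv_def)
    also have "norm \<dots> \<le> (LINT z|lborel. norm (F (y - q n z) * h z - F (y - z) * h z))"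
      by (rule integral_norm_bound)
    also have "\<dots> \<le> E M n"
      unfolding E_def
    proof (intro integral_mono integrable_norm Bochner_Integration.integrable_diff i1 i2 Eint M(1))
      fix z
      have "norm (F (y - q n z) - F (y - z)) \<le> 2 * M"
        using M(2)[of "y - q n z"] M(2)[of "y - z"] norm_triangle_ineq4[of "F (y - q n z)" "F (y - z)"] by linarith
      moreover have "norm (F (y - q n z) - F (y - z)) \<le> M * norm (q n z - z)"
        using M(3)[of "y - q n z" "y - z"] by (simp add: norm_minus_commute)
      ultimately have "norm (F (y - q n z) - F (y - z)) * norm (h z) \<le> min (2 * M) (M * norm (q n z - z)) * norm (h z)"
        by (intro mult_right_mono) auto
      then show "norm (F (y - q n z) * h z - F (y - z) * h z) \<le> min (2 * M) (M * norm (q n z - z)) * norm (h z)"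
        by (simp add: norm_mult flip: left_diff_distrib)
    qed
    finally show ?thesis .
  qed
  define G where "G n y = (LINT z|lborel. \<psi> (y - q n z) * h z)" for n y
  define m where "m n v = (LINT z|lborel. indicator (q n -` {v} \<inter> space lborel) z * h z)" for n v
  have fin: "finite (q n ` space lborel)" for n using q(1)[of n] by (simp add: simple_function_def)
  have G_eq: "G n = (\<lambda>y. \<Sum>v\<in>q n ` space lborel. m n v * \<psi> (y + - v))" for n
    using integral_simple_function_compose(1)[OF h q(1)[of n], where F = "\<lambda>v. \<psi> (_ - v)"]
    by (simp add: fun_eq_iff G_def m_def)
  have G: "G n \<in> bdd_smooth" for n
    unfolding G_eq by (intro bdd_smooth_sum bdd_smooth_cmult bdd_smooth_shift \<psi>)
  have pG: "pderivs w (G n) y = (LINT z|lborel. pderivs w \<psi> (y - q n z) * h z)" for w n y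
  proof -
    have "pderivs w (G n) y = (\<Sum>v\<in>q n ` space lborel. m n v * pderivs w \<psi> (y + - v))"
      unfolding G_eq using \<psi>
      by (subst pderivs_sum) (auto simp: pderivs_cmult pderivs_shift bdd_smooth_smooth bdd_smooth_cmult bdd_smooth_shift
          simp del: add_uminus_conv_diff)
    then show ?thesis
      using integral_simple_function_compose(1)[OF h q(1)[of n], where F = "\<lambda>v. pderivs w \<psi> (y - v)"]
      by (simp add: m_def)
  qed
  have dG: "dist_conv U (G n) x = (LINT z|lborel. ?\<Psi> (x - q n z) * h z)" for n
  proof -
    have "dist_conv U (G n) x = (\<Sum>v\<in>q n ` space lborel. m n v * dist_conv U (\<lambda>y. \<psi> (y + - v)) x)"
      unfolding G_eq using fin
      by (subst dist_conv_sum) (auto simp: dist_conv_cmult bdd_smooth_cmult bdd_smooth_shift \<psi>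
          simp del: add_uminus_conv_diff)
    also have "\<dots> = (\<Sum>v\<in>q n ` space lborel. m n v * ?\<Psi> (x - v))"
      by (simp add: dist_conv_def algebra_simps)
    finally show ?thesis
      using integral_simple_function_compose(1)[OF h q(1)[of n], where F = "\<lambda>v. ?\<Psi> (x - v)"]
      by (simp add: m_def)
  qed
  obtain M where M: "M \<ge> 0" "\<And>w x. length w \<le> N \<Longrightarrow> norm (pderivs w \<psi> x) \<le> M"
    "\<And>w x y. length w \<le> N \<Longrightarrow> norm (pderivs w \<psi> x - pderivs w \<psi> y) \<le> M * norm (x - y)"
    using bdd_smooth_lipschitz[OF \<psi>] by metis
  have cv: "conv \<psi> h \<in> bdd_smooth" by (rule conv_bdd_smooth[OF \<psi> h])
  have "norm (dist_conv U (\<lambda>y. G n y - conv \<psi> h y) x) \<le> C * E M n" for n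
  proof (rule dist_conv_bound)
    show "(\<lambda>y. G n y - conv \<psi> h y) \<in> bdd_smooth" by (intro bdd_smooth_diff G cv)
    show "0 \<le> E M n" unfolding E_def using M(1) by (intro Bochner_Integration.integral_nonneg) auto
    show "norm (pderivs w (\<lambda>y. G n y - conv \<psi> h y) z) \<le> E M n" if "length w \<le> N" for w z
    proof -
      have "pderivs w (\<lambda>y. G n y - conv \<psi> h y) z = (LINT y|lborel. pderivs w \<psi> (z - q n y) * h y) - conv (pderivs w \<psi>) h z"
        using G cv by (simp add: pderivs_diff bdd_smooth_smooth pG pderivs_conv \<psi> h)
      then show ?thesis
        using diff[OF bdd_smooth_pderivs[OF \<psi>, of w] M(1) M(2)[OF that] M(3)[OF that]] by simp
    qed
  qed
  then have b1: "norm (dist_conv U (G n) x - dist_conv U (conv \<psi> h) x) \<le> C * E M n" for n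
    using G cv by (simp add: dist_conv_diff)
  \<comment> \<open>Both sides of the claim are limits of one sequence, the left one by the bound of
    \<open>U\<close>, the right one by the Lipschitz bound of
    \<open>dist_conv U \<psi>\<close>.\<close>
  have "(\<lambda>n. dist_conv U (G n) x - dist_conv U (conv \<psi> h) x) \<longlonglongrightarrow> 0"
    by (rule Lim_null_comparison[of _ "\<lambda>n. C * E M n"]) (use b1 tendsto_mult_right_zero[OF E0[OF M(1)]] in auto)
  then have l1: "(\<lambda>n. dist_conv U (G n) x) \<longlonglongrightarrow> dist_conv U (conv \<psi> h) x" by (rule LIM_zero_cancel)
  obtain M' where M': "M' \<ge> 0" "\<And>x. norm (?\<Psi> x) \<le> M'" "\<And>x y. norm (?\<Psi> x - ?\<Psi> y) \<le> M' * norm (x - y)"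
    using dist_conv_lipschitz[OF \<psi>] by metis
  have "(\<lambda>n. dist_conv U (G n) x - conv ?\<Psi> h x) \<longlonglongrightarrow> 0"
    by (rule Lim_null_comparison[of _ "E M'"]) (use diff[OF \<Psi> M'] E0[OF M'(1)] dG in auto)
  then have l2: "(\<lambda>n. dist_conv U (G n) x) \<longlonglongrightarrow> conv ?\<Psi> h x" by (rule LIM_zero_cancel)
  from l1 l2 show ?thesis by (rule LIMSEQ_unique)
qed

text \<open>The commutation of a bounded functional with a convolution, applied to the functional
  that integrates against \<open>h\<close>.\<close>

lemma conv_swap:
  assumes "\<psi> \<in> bdd_smooth" "integrable lborel g" "integrable lborel h"
  shows "conv (conv \<psi> g) h = conv (conv \<psi> h) g"
  unfolding conv_eq_dist_conv[of _ h]
  using bounded_functional.dist_conv_conv[OF bounded_functional_integral[OF assms(3)] assms(1,2)] by auto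

lemma (in bounded_functional) dist_conv_conv_bound:
  assumes "\<psi> \<in> bdd_smooth" "integrable lborel h" "\<And>x. norm (dist_conv U \<psi> x) \<le> P"
  shows "norm (dist_conv U (conv \<psi> h) x) \<le> P * (LINT y|lborel. norm (h y))"
  unfolding dist_conv_conv[OF assms(1,2)]
  by (rule conv_bound) (use assms dist_conv_bdd_smooth in auto)

subsection \<open>Dilations and vanishing moments\<close>

lemma nn_integral_lborel_affine:
  fixes f :: "'a::euclidean_space \<Rightarrow> ennreal"
  assumes [measurable]: "f \<in> borel_measurable borel" and "c \<noteq> 0"
  shows "(\<integral>\<^sup>+x. f x \<partial>lborel) = ennreal (\<bar>c\<bar> ^ DIM('a)) * (\<integral>\<^sup>+x. f (t + c *\<^sub>R x) \<partial>lborel)"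
  by (subst lborel_affine[OF assms(2), of t])
    (simp add: nn_integral_density nn_integral_distr nn_integral_cmult)

lemma integrable_lborel_affine:
  fixes f :: "'a::euclidean_space \<Rightarrow> 'b::{banach, second_countable_topology}"
  assumes "integrable lborel f" "c \<noteq> 0"
  shows "integrable lborel (\<lambda>x. f (t + c *\<^sub>R x))"
proof -
  have [measurable]: "f \<in> borel_measurable borel" using borel_measurable_integrable[OF assms(1)] by simp
  have "(\<integral>\<^sup>+x. norm (f x) \<partial>lborel) < \<infinity>" using assms(1) by (simp add: integrable_iff_bounded)
  then have "(\<integral>\<^sup>+x. norm (f (t + c *\<^sub>R x)) \<partial>lborel) < \<infinity>"
    using assms(2) by (subst (asm) nn_integral_lborel_affine[OF _ assms(2), of _ t]) (auto simp: ennreal_mult_less_top)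
  then show ?thesis by (simp add: integrable_iff_bounded)
qed

lemma integral_lborel_affine:
  fixes f :: "'a::euclidean_space \<Rightarrow> 'b::{banach, second_countable_topology}"
  assumes "integrable lborel f" "c \<noteq> 0"
  shows "(LINT x|lborel. f x) = \<bar>c\<bar> ^ DIM('a) *\<^sub>R (LINT x|lborel. f (t + c *\<^sub>R x))"
proof -
  have [measurable]: "f \<in> borel_measurable borel" using borel_measurable_integrable[OF assms(1)] by simp
  show ?thesis
    by (subst lborel_affine[OF assms(2), of t]) (simp add: integral_density integral_distr)
qed

definition l1 :: "(real ^ 'd::finite \<Rightarrow> complex) \<Rightarrow> real" where
  "l1 f = (LINT x|lborel. norm (f x))"

lemma l1_nonneg: "0 \<le> l1 f"
  by (simp add: l1_def)

lemma conv_commute: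
  assumes "f \<in> bdd_smooth" "integrable lborel g"
  shows "conv f g = conv g f"
proof
  fix x
  show "conv f g x = conv g f x"
    using integral_lborel_affine[OF conv_integrable[OF assms, of x], of "-1" x]
    by (simp add: conv_def mult.commute)
qed

text \<open>Young's inequality through Tonelli; measurability of \<open>conv f g\<close> comes from
  its smoothness, hence \<open>f\<close> in \<open>bdd_smooth\<close>.\<close>

lemma integrable_conv:
  fixes f :: "real ^ 'd::finite \<Rightarrow> complex"
  assumes f: "f \<in> bdd_smooth" "integrable lborel f" and g: "integrable lborel g"
  shows "integrable lborel (conv f g)" and "l1 (conv f g) \<le> l1 f * l1 g"
proof -
  have [measurable]: "f \<in> borel_measurable borel" "g \<in> borel_measurable borel"
    using borel_measurable_integrable[OF f(2)] borel_measurable_integrable[OF g] by simp_all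
  have cm [measurable]: "conv f g \<in> borel_measurable borel"
    by (intro smooth_measurable bdd_smooth_smooth conv_bdd_smooth f g)
  have shift: "(\<integral>\<^sup>+x. norm (f (x - y)) \<partial>lborel) = ennreal (l1 f)" for y
  proof -
    have "(\<integral>\<^sup>+x. norm (f x) \<partial>lborel) = (\<integral>\<^sup>+x. norm (f (- y + 1 *\<^sub>R x)) \<partial>lborel)"
      by (subst nn_integral_lborel_affine[of "\<lambda>x. ennreal (norm (f x))" 1 "- y"]) auto
    moreover have "(\<integral>\<^sup>+x. norm (f x) \<partial>lborel) = ennreal (l1 f)"
      unfolding l1_def using f(2) by (intro nn_integral_eq_integral) auto
    ultimately show ?thesis by simp
  qed
  have "(\<integral>\<^sup>+x. norm (conv f g x) \<partial>lborel) \<le> (\<integral>\<^sup>+x. (\<integral>\<^sup>+y. ennreal (norm (f (x - y))) * ennreal (norm (g y)) \<partial>lborel) \<partial>lborel)"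
  proof (rule nn_integral_mono)
    fix x
    have i: "integrable lborel (\<lambda>y. f (x - y) * g y)" by (rule conv_integrable[OF f(1) g])
    have "ennreal (norm (conv f g x)) \<le> ennreal (LINT y|lborel. norm (f (x - y) * g y))"
      unfolding conv_def by (intro ennreal_leI integral_norm_bound)
    also have "\<dots> = (\<integral>\<^sup>+y. norm (f (x - y) * g y) \<partial>lborel)"
      using i by (intro nn_integral_eq_integral[symmetric]) auto
    finally show "ennreal (norm (conv f g x)) \<le> (\<integral>\<^sup>+y. ennreal (norm (f (x - y))) * ennreal (norm (g y)) \<partial>lborel)"
      by (simp add: norm_mult ennreal_mult)
  qed
  also have "\<dots> = (\<integral>\<^sup>+y. (\<integral>\<^sup>+x. ennreal (norm (f (x - y))) * ennreal (norm (g y)) \<partial>lborel) \<partial>lborel)"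
    by (rule lborel_pair.Fubini') measurable
  also have "\<dots> = (\<integral>\<^sup>+y. ennreal (l1 f) * ennreal (norm (g y)) \<partial>lborel)"
    by (intro nn_integral_cong) (simp add: nn_integral_multc shift)
  also have "\<dots> = ennreal (l1 f) * ennreal (l1 g)"
    using g by (simp add: nn_integral_cmult nn_integral_eq_integral l1_def)
  finally have le: "(\<integral>\<^sup>+x. norm (conv f g x) \<partial>lborel) \<le> ennreal (l1 f * l1 g)"
    by (simp add: ennreal_mult l1_nonneg)
  then show i: "integrable lborel (conv f g)"
    by (auto simp: integrable_iff_bounded intro: le_less_trans)
  have "ennreal (l1 (conv f g)) = (\<integral>\<^sup>+x. norm (conv f g x) \<partial>lborel)"
    unfolding l1_def using i by (intro nn_integral_eq_integral[symmetric]) auto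
  with le have "ennreal (l1 (conv f g)) \<le> ennreal (l1 f * l1 g)" by simp
  then show "l1 (conv f g) \<le> l1 f * l1 g"
    by (simp add: l1_nonneg)
qed

lemma l1_sum:
  assumes "finite A" "\<And>a. a \<in> A \<Longrightarrow> integrable lborel (f a)"
  shows "l1 (\<lambda>x. \<Sum>a\<in>A. f a x) \<le> (\<Sum>a\<in>A. l1 (f a))"
proof -
  have "l1 (\<lambda>x. \<Sum>a\<in>A. f a x) \<le> (LINT x|lborel. (\<Sum>a\<in>A. norm (f a x)))"
    unfolding l1_def using assms by (intro integral_mono integrable_norm Bochner_Integration.integrable_sum norm_sum)
  also have "\<dots> = (\<Sum>a\<in>A. l1 (f a))"
    unfolding l1_def using assms by (intro Bochner_Integration.integral_sum) auto
  finally show ?thesis .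
qed

lemma l1_cmult: "l1 (\<lambda>x. c * f x) = norm c * l1 f"
  by (simp add: l1_def norm_mult)

lemma schwartz_dilate: "f \<in> schwartz \<Longrightarrow> 0 < a \<Longrightarrow> dilate a f \<in> schwartz"
  unfolding dilate_def by (intro schwartz_cmult schwartz_dilation) auto

lemma dilate_1 [simp]: "dilate 1 f = f"
  by (simp add: dilate_def fun_eq_iff)

lemma dilate_dilate: "dilate a (dilate b f) = dilate (a * b) f"
  by (simp add: dilate_def fun_eq_iff power_mult_distrib mult_ac)

lemma pderivs_dilate:
  assumes "f \<in> smooth UNIV"
  shows "pderivs w (dilate a f) = (\<lambda>x. of_real a ^ length w * dilate a (pderivs w f) x)"
proof -
  have "dilate a f = (\<lambda>x. of_real (a ^ CARD('a)) * f (a *\<^sub>R x + 0))" by (simp add: dilate_def fun_eq_iff)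
  then show ?thesis
    by (simp only: pderivs_cmult[OF smooth_affine[OF assms]] pderivs_affine[OF assms])
      (simp add: dilate_def mult_ac)
qed

lemma integral_dilate:
  fixes f :: "real ^ 'd::finite \<Rightarrow> complex"
  assumes "integrable lborel f" "0 < a"
  shows "integrable lborel (dilate a f)" "(LINT x|lborel. dilate a f x) = (LINT x|lborel. f x)"
proof -
  show "integrable lborel (dilate a f)"
    using integrable_lborel_affine[OF assms(1), of a 0] assms(2) by (simp add: dilate_def[abs_def])
  show "(LINT x|lborel. dilate a f x) = (LINT x|lborel. f x)"
    using integral_lborel_affine[OF assms(1), of a 0] assms(2)
    by (simp add: dilate_def scaleR_conv_of_real[where 'a=complex])
qed

lemma l1_dilate:
  fixes f :: "real ^ 'd::finite \<Rightarrow> complex"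
  assumes "integrable lborel f" "0 < a"
  shows "l1 (dilate a f) = l1 f"
  using integral_lborel_affine[OF integrable_norm[OF assms(1)], of a 0] assms(2)
  by (simp add: l1_def dilate_def norm_mult norm_power)

lemma conv_dilate:
  assumes "f \<in> bdd_smooth" "integrable lborel g" "0 < a"
  shows "conv (dilate a f) (dilate a g) = dilate a (conv f g)"
proof
  fix x :: "real ^ 'a"
  have "conv (dilate a f) (dilate a g) x
      = of_real (a ^ CARD('a)) * (of_real (a ^ CARD('a)) * (LINT y|lborel. f (a *\<^sub>R x - a *\<^sub>R y) * g (a *\<^sub>R y)))"
    unfolding conv_def dilate_def by (simp add: scaleR_diff_right mult_ac flip: integral_mult_right_zero)
  then show "conv (dilate a f) (dilate a g) x = dilate a (conv f g) x"
    using integral_lborel_affine[OF conv_integrable[OF assms(1,2), of "a *\<^sub>R x"], of a 0] assms(3)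
    by (simp add: conv_def dilate_def scaleR_conv_of_real[where 'a=complex])
qed

text \<open>The substitution moves the scale from \<open>g\<close> into the argument of
  \<open>f\<close>, where Lipschitz bounds and Taylor expansion can exploit it.\<close>

lemma conv_dilate_right:
  assumes "f \<in> bdd_smooth" "integrable lborel g" "0 < a"
  shows "conv f (dilate a g) x = (LINT y|lborel. f (x - (1 / a) *\<^sub>R y) * g y)"
proof -
  have m: "f \<in> borel_measurable borel" by (intro smooth_measurable bdd_smooth_smooth assms)
  obtain M where "\<And>z. norm (f z) \<le> M" using bdd_smooth_bounded[OF assms(1)] by metis
  then have "integrable lborel (\<lambda>y. f (x - (1 / a) *\<^sub>R y) * g y)"
    by (intro integrable_bounded_mult[OF assms(2)] measurable_compose[OF _ m]) auto
  from integral_lborel_affine[OF this, of a 0] show ?thesis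
    using assms(3) by (simp add: conv_def dilate_def scaleR_conv_of_real[where 'a=complex] mult_ac flip: integral_mult_right_zero)
qed

lemma schwartz_weighted_integrable:
  fixes f :: "real ^ 'd::finite \<Rightarrow> complex"
  assumes "f \<in> schwartz"
  shows "integrable lborel (\<lambda>x. (1 + norm x) ^ q * norm (f x))"
proof -
  obtain C where C: "C \<ge> 0" "\<And>x. norm (pderivs [] f x) \<le> C / (1 + norm x) ^ (q + 2 * CARD('d))"
    using schwartz_decay[OF assms] by metis
  have [measurable]: "f \<in> borel_measurable borel" by (intro smooth_measurable schwartz_smooth assms)
  show ?thesis
  proof (rule Bochner_Integration.integrable_bound)
    show "integrable lborel (\<lambda>x::real^'d. C * (1 / (1 + norm x) ^ (2 * CARD('d))))"
      using integrable_inverse_norm_power[where 'a="real^'d"] by (intro integrable_mult_right) simp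
    have "norm ((1 + norm x) ^ q * norm (f x)) \<le> norm (C * (1 / (1 + norm x) ^ (2 * CARD('d))))" for x
    proof -
      have "(1 + norm x) ^ q * norm (f x) \<le> (1 + norm x) ^ q * (C / (1 + norm x) ^ (q + 2 * CARD('d)))"
        using C(2)[of x] by (intro mult_left_mono) auto
      also have "\<dots> = C * (1 / (1 + norm x) ^ (2 * CARD('d)))"
        using norm_ge_zero[of x] by (simp add: power_add add_nonneg_eq_0_iff del: norm_ge_zero)
      finally show ?thesis using C(1) by (simp add: abs_mult)
    qed
    then show "AE x in lborel. norm ((1 + norm x) ^ q * norm (f x)) \<le> norm (C * (1 / (1 + norm x) ^ (2 * CARD('d))))"
      by simp
  qed measurable
qed

text \<open>Since \<Phi> has integral 1, \<psi> x can be put under the integral, where the Lipschitz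
  bound is applied at distance |y| / t.\<close>

lemma approximate_identity_bound:
  fixes \<psi> \<Phi> :: "real ^ 'd::finite \<Rightarrow> complex"
  assumes \<psi>: "\<psi> \<in> bdd_smooth" and L: "\<And>x y. norm (\<psi> x - \<psi> y) \<le> L * norm (x - y)"
    and \<Phi>: "\<Phi> \<in> schwartz" "(LINT x|lborel. \<Phi> x) = 1" and t: "t > 0"
  shows "norm (\<psi> x - conv \<psi> (dilate t \<Phi>) x) \<le> L / t * (LINT y|lborel. (1 + norm y) ^ 1 * norm (\<Phi> y))"
proof -
  \<comment> \<open>Nonnegativity is read off from two points at distance 1; which coordinate
    \<open>undefined\<close> denotes does not matter.\<close>
  have L0: "0 \<le> L"
    using order_trans[OF norm_ge_zero L[of "axis undefined 1" 0]] by simp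
  have int: "integrable lborel \<Phi>" by (rule schwartz_integrable[OF \<Phi>(1)])
  obtain M where M: "\<And>z. norm (\<psi> z) \<le> M" using bdd_smooth_bounded[OF \<psi>] by metis
  have m: "\<psi> \<in> borel_measurable borel" by (intro smooth_measurable bdd_smooth_smooth \<psi>)
  have i1: "integrable lborel (\<lambda>y. \<psi> (x - (1 / t) *\<^sub>R y) * \<Phi> y)"
    using M by (intro integrable_bounded_mult[OF int] measurable_compose[OF _ m]) auto
  have "\<psi> x - conv \<psi> (dilate t \<Phi>) x = (LINT y|lborel. \<psi> x * \<Phi> y) - (LINT y|lborel. \<psi> (x - (1 / t) *\<^sub>R y) * \<Phi> y)"
    using \<Phi>(2) by (simp add: conv_dilate_right[OF \<psi> int t])
  also have "\<dots> = (LINT y|lborel. \<psi> x * \<Phi> y - \<psi> (x - (1 / t) *\<^sub>R y) * \<Phi> y)"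
    using i1 int by simp
  also have "norm \<dots> \<le> (LINT y|lborel. norm (\<psi> x * \<Phi> y - \<psi> (x - (1 / t) *\<^sub>R y) * \<Phi> y))"
    by (rule integral_norm_bound)
  also have "\<dots> \<le> (LINT y|lborel. L / t * ((1 + norm y) ^ 1 * norm (\<Phi> y)))"
  proof (intro integral_mono integrable_norm Bochner_Integration.integrable_diff i1 integrable_mult_right int
      schwartz_weighted_integrable \<Phi>)
    fix y
    have "norm (\<psi> x - \<psi> (x - (1 / t) *\<^sub>R y)) \<le> L / t * norm y"
      using L[of x "x - (1 / t) *\<^sub>R y"] t by simp
    also have "\<dots> \<le> L / t * (1 + norm y) ^ 1"
      using L0 t by (intro mult_left_mono) auto
    finally have "norm (\<psi> x - \<psi> (x - (1 / t) *\<^sub>R y)) * norm (\<Phi> y) \<le> L / t * (1 + norm y) ^ 1 * norm (\<Phi> y)"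
      by (rule mult_right_mono) simp
    then show "norm (\<psi> x * \<Phi> y - \<psi> (x - (1 / t) *\<^sub>R y) * \<Phi> y) \<le> L / t * ((1 + norm y) ^ 1 * norm (\<Phi> y))"
      by (simp add: norm_mult mult.assoc flip: left_diff_distrib)
  qed
  finally show ?thesis by simp
qed

section \<open>Taylor expansion and vanishing moments\<close>

definition dir_deriv :: "real ^ 'd::finite \<Rightarrow> (real ^ 'd \<Rightarrow> complex) \<Rightarrow> real ^ 'd \<Rightarrow> complex" where
  "dir_deriv z f = (\<lambda>x. \<Sum>i\<in>UNIV. of_real (z $ i) * partial i f x)"

lemma schwartz_dir_deriv: "f \<in> schwartz \<Longrightarrow> dir_deriv z f \<in> schwartz"
  unfolding dir_deriv_def by (intro schwartz_sum schwartz_cmult schwartz_partial)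

lemma schwartz_dir_deriv_pow: "f \<in> schwartz \<Longrightarrow> (dir_deriv z ^^ q) f \<in> schwartz"
  by (induction q) (auto intro: schwartz_dir_deriv)

lemma dir_deriv_sum:
  assumes "\<And>i. f i \<in> schwartz"
  shows "dir_deriv z (\<lambda>x. \<Sum>i\<in>UNIV. c i * f i x) = (\<lambda>x. \<Sum>i\<in>UNIV. c i * dir_deriv z (f i) x)"
proof
  fix x
  have "partial j (\<lambda>x. \<Sum>i\<in>UNIV. c i * f i x) = (\<lambda>x. \<Sum>i\<in>UNIV. c i * partial j (f i) x)" for j
    using assms by (simp add: partial_sum smooth_cmult schwartz_smooth partial_cmult)
  then show "dir_deriv z (\<lambda>x. \<Sum>i\<in>UNIV. c i * f i x) x = (\<Sum>i\<in>UNIV. c i * dir_deriv z (f i) x)"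
    unfolding dir_deriv_def sum_distrib_left
    by (simp add: sum_distrib_left) (subst sum.swap, simp add: mult_ac)
qed

lemma dir_deriv_pow_sum:
  assumes "\<And>i. f i \<in> schwartz"
  shows "(dir_deriv z ^^ q) (\<lambda>x. \<Sum>i\<in>UNIV. c i * f i x) = (\<lambda>x. \<Sum>i\<in>UNIV. c i * (dir_deriv z ^^ q) (f i) x)"
  by (induction q) (simp_all add: assms dir_deriv_sum schwartz_dir_deriv_pow)

lemma dir_deriv_pow_Suc:
  assumes "f \<in> schwartz"
  shows "(dir_deriv z ^^ Suc q) f = (\<lambda>x. \<Sum>i\<in>UNIV. of_real (z $ i) * (dir_deriv z ^^ q) (partial i f) x)"
  unfolding funpow_Suc_right o_apply
  unfolding dir_deriv_def[of z f] by (rule dir_deriv_pow_sum[OF schwartz_partial[OF assms]])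

lemma dir_deriv_pow_bound:
  fixes f :: "real ^ 'd::finite \<Rightarrow> complex"
  assumes "f \<in> schwartz"
  shows "\<exists>C\<ge>0. \<forall>x z. norm ((dir_deriv z ^^ q) f x) \<le> C * norm z ^ q / (1 + norm x) ^ p"
  using assms
proof (induction q arbitrary: f)
  case 0
  obtain C where "C \<ge> 0" "\<And>x. norm (pderivs [] f x) \<le> C / (1 + norm x) ^ p"
    using schwartz_decay[OF 0] by metis
  then show ?case by auto
next
  case (Suc q)
  have "\<forall>i. \<exists>C\<ge>0. \<forall>x z. norm ((dir_deriv z ^^ q) (partial i f) x) \<le> C * norm z ^ q / (1 + norm x) ^ p"
    using Suc.IH[OF schwartz_partial[OF Suc.prems]] by blast
  then obtain C where C: "\<And>i. C i \<ge> 0"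
    "\<And>i x z. norm ((dir_deriv z ^^ q) (partial i f) x) \<le> C i * norm z ^ q / (1 + norm x) ^ p"
    by metis
  have "norm ((dir_deriv z ^^ Suc q) f x) \<le> (\<Sum>i\<in>UNIV. C i) * norm z ^ Suc q / (1 + norm x) ^ p" for x z
  proof -
    have "norm ((dir_deriv z ^^ Suc q) f x) \<le> (\<Sum>i\<in>UNIV. norm z * (C i * norm z ^ q / (1 + norm x) ^ p))"
      unfolding dir_deriv_pow_Suc[OF Suc.prems]
    proof (rule sum_norm_le)
      show "norm (of_real (z $ i) * (dir_deriv z ^^ q) (partial i f) x) \<le> norm z * (C i * norm z ^ q / (1 + norm x) ^ p)" for i
        unfolding norm_mult using component_le_norm_cart[of z i] by (intro mult_mono C(2)) auto
    qed
    also have "\<dots> = (\<Sum>i\<in>UNIV. C i) * norm z ^ Suc q / (1 + norm x) ^ p"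
      by (simp add: sum_distrib_right sum_distrib_left sum_divide_distrib mult_ac)
    finally show ?thesis .
  qed
  then show ?case using C(1) by (intro exI[of _ "\<Sum>i\<in>UNIV. C i"]) (auto intro: sum_nonneg)
qed

text \<open>Expanding one directional derivative puts one factor \<open>y $ i\<close> into the
  monomial and one partial derivative onto \<open>f\<close>. The total degree stays below
  \<open>r\<close>, where the moments of \<theta> vanish; \<open>m\<close> records the degree
  collected so far.\<close>

lemma dir_deriv_pow_moment:
  fixes \<theta> f :: "real ^ 'd::finite \<Rightarrow> complex"
  assumes \<theta>: "\<theta> \<in> schwartz" "\<And>m. mi_order m < r \<Longrightarrow> (LINT x|lborel. monomial m x *\<^sub>R \<theta> x) = 0"
    and f: "f \<in> schwartz" and "mi_order m + q < r"
  shows "has_bochner_integral lborel (\<lambda>y. monomial m y *\<^sub>R \<theta> y * (dir_deriv (c *\<^sub>R y) ^^ q) f x) 0"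
  using f assms(4)
proof (induction q arbitrary: f m)
  case 0
  have [measurable]: "\<theta> \<in> borel_measurable borel" by (intro smooth_measurable schwartz_smooth \<theta>)
  have [measurable]: "monomial m \<in> borel_measurable borel" unfolding monomial_def[abs_def] by measurable
  have "integrable lborel (\<lambda>y. monomial m y *\<^sub>R \<theta> y)"
  proof (rule Bochner_Integration.integrable_bound)
    show "integrable lborel (\<lambda>x. (1 + norm x) ^ mi_order m * norm (\<theta> x))"
      by (rule schwartz_weighted_integrable[OF \<theta>(1)])
    show "AE x in lborel. norm (monomial m x *\<^sub>R \<theta> x) \<le> norm ((1 + norm x) ^ mi_order m * norm (\<theta> x))"
      by (auto simp: abs_mult intro!: AE_I2 mult_right_mono abs_monomial_le)
  qed measurable
  then have "has_bochner_integral lborel (\<lambda>y. monomial m y *\<^sub>R \<theta> y) 0"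
    using \<theta>(2)[of m] 0 by (simp add: has_bochner_integral_iff)
  then have "has_bochner_integral lborel (\<lambda>y. monomial m y *\<^sub>R \<theta> y * f x) (0 * f x)"
    by (intro has_bochner_integral_mult_left)
  then show ?case by simp
next
  case (Suc q)
  have "has_bochner_integral lborel (\<lambda>y. \<Sum>i\<in>UNIV. of_real c *
     (monomial (m(i := Suc (m i))) y *\<^sub>R \<theta> y * (dir_deriv (c *\<^sub>R y) ^^ q) (partial i f) x)) (\<Sum>i\<in>(UNIV::'d set). of_real c * 0)"
  proof (intro has_bochner_integral_sum has_bochner_integral_mult_right)
    fix i
    have "mi_order (m(i := Suc (m i))) = Suc (mi_order m)"
      unfolding mi_order_def by (simp add: sum.remove[of UNIV i])
    then have "mi_order (m(i := Suc (m i))) + q < r" using Suc.prems(2) by linarith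
    then show "has_bochner_integral lborel (\<lambda>y. monomial (m(i := Suc (m i))) y *\<^sub>R \<theta> y * (dir_deriv (c *\<^sub>R y) ^^ q) (partial i f) x) 0"
      by (rule Suc.IH[OF schwartz_partial[OF Suc.prems(1)]])
  qed
  moreover have "(\<Sum>i\<in>UNIV. of_real c *
     (monomial (m(i := Suc (m i))) y *\<^sub>R \<theta> y * (dir_deriv (c *\<^sub>R y) ^^ q) (partial i f) x))
     = monomial m y *\<^sub>R \<theta> y * (dir_deriv (c *\<^sub>R y) ^^ Suc q) f x" for y
  proof -
    have "monomial (m(i := Suc (m i))) y = y $ i * monomial m y" for i
      unfolding monomial_def by (simp add: prod.remove[of UNIV i])
    then show ?thesis
      unfolding dir_deriv_pow_Suc[OF Suc.prems(1)] sum_distrib_left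
      by (simp add: scaleR_conv_of_real[where 'a=complex] mult_ac)
  qed
  ultimately show ?case by simp
qed

text \<open>The derivative of the remainder is the remainder of the shifted family
  \<open>D (Suc i)\<close>, one order lower. Each integration costs a factor |t| \<le> 1, so the
  constant remains \<open>B\<close>.\<close>

lemma taylor_bound:
  fixes D :: "nat \<Rightarrow> real \<Rightarrow> complex"
  assumes "\<And>i t. (D i has_vector_derivative D (Suc i) t) (at t)"
    and "\<And>t. \<bar>t\<bar> \<le> 1 \<Longrightarrow> norm (D p t) \<le> B" and "\<bar>t\<bar> \<le> 1"
  shows "norm (D 0 t - (\<Sum>i<p. of_real (t ^ i / fact i) * D i 0)) \<le> B"
  using assms
proof (induction p arbitrary: D t)
  case (Suc p)
  let ?E = "\<lambda>t. D 0 t - (\<Sum>i<Suc p. of_real (t ^ i / fact i) * D i 0)"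
  let ?E' = "\<lambda>t. D 1 t - (\<Sum>i<p. of_real (t ^ i / fact i) * D (Suc i) 0)"
  have d: "(?E has_vector_derivative ?E' t) (at t)" for t
  proof -
    have "((\<lambda>t. of_real (t ^ i / fact i)) has_vector_derivative of_real (of_nat i * t ^ (i - 1) / fact i)) (at t)" for i
      by (rule has_vector_derivative_of_real) (auto intro!: derivative_eq_intros)
    then have "(?E has_vector_derivative (D (Suc 0) t - (\<Sum>i<Suc p. of_real (of_nat i * t ^ (i - 1) / fact i) * D i 0))) (at t)"
      by (intro has_vector_derivative_diff Suc.prems(1) has_vector_derivative_sum has_vector_derivative_mult_left)
    also have "(\<Sum>i<Suc p. of_real (of_nat i * t ^ (i - 1) / fact i) * D i 0) = (\<Sum>i<p. of_real (t ^ i / fact i) * D (Suc i) 0)"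
      by (subst sum.lessThan_Suc_shift) (simp add: field_simps del: of_nat_Suc)
    finally show ?thesis by simp
  qed
  have "norm (?E' t) \<le> B" if "\<bar>t\<bar> \<le> 1" for t
    using Suc.IH[of "\<lambda>i. D (Suc i)" t] Suc.prems that by simp
  then have "norm (?E t - ?E 0 - of_real t * 0) \<le> B * \<bar>t\<bar>"
    using Suc.prems(3) d by (intro norm_linepath_bound[where g' = ?E']) auto
  also have "?E 0 = 0"
    by (subst sum.lessThan_Suc_shift) simp
  also have "B * \<bar>t\<bar> \<le> B"
    using Suc.prems(3) order_trans[OF norm_ge_zero Suc.prems(2)[of 0]] by (simp add: mult_left_le)
  finally show ?case by simp
qed simp

lemma has_vector_derivative_dir_deriv:
  assumes "f \<in> smooth UNIV"
  shows "((\<lambda>t. f (x + t *\<^sub>R z)) has_vector_derivative dir_deriv z f (x + t *\<^sub>R z)) (at t)"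
proof -
  have "((\<lambda>t. x + t *\<^sub>R z) has_derivative (\<lambda>h. h *\<^sub>R z)) (at t)"
    by (auto intro!: derivative_eq_intros)
  from has_derivative_compose[OF this smooth_has_derivative[OF assms]]
  show ?thesis
    by (simp add: has_vector_derivative_def dir_deriv_def scaleR_sum_right sum_distrib_left scaleR_conv_of_real[where 'a=complex] mult_ac)
qed

text \<open>The convolution is the integral over y of f (x - y/t) \<theta> y. The part of the Taylor
  polynomial of \<open>f\<close> of degree below \<open>r\<close> integrates to 0, and the remainder
  is of size (|y| / t)^r. The weight in \<open>x\<close> makes the bound integrable in the next
  lemma.\<close>

lemma conv_moment_decay:
  fixes \<theta> f :: "real ^ 'd::finite \<Rightarrow> complex"
  assumes \<theta>: "\<theta> \<in> schwartz" "\<And>m. mi_order m < r \<Longrightarrow> (LINT x|lborel. monomial m x *\<^sub>R \<theta> x) = 0"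
    and f: "f \<in> schwartz"
  shows "\<exists>C\<ge>0. \<forall>t\<ge>1. \<forall>x. norm (conv f (dilate t \<theta>) x) \<le> C / t ^ r / (1 + norm x) ^ p"
proof -
  obtain C where C: "C \<ge> 0" "\<And>x z. norm ((dir_deriv z ^^ r) f x) \<le> C * norm z ^ r / (1 + norm x) ^ p"
    using dir_deriv_pow_bound[OF f] by metis
  \<comment> \<open>The weight has r powers from the Taylor remainder and p from comparing the decay
    of \<open>f\<close> at the intermediate point with that at \<open>x\<close>.\<close>
  define I where "I = (LINT y|lborel. (1 + norm y) ^ (r + p) * norm (\<theta> y))"
  have I: "I \<ge> 0" unfolding I_def by (intro Bochner_Integration.integral_nonneg) auto
  have "norm (conv f (dilate t \<theta>) x) \<le> C * I / t ^ r / (1 + norm x) ^ p" if t: "t \<ge> 1" for t x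
  proof -
    \<comment> \<open>The i-th directional derivative of \<open>f\<close> along -y/t. On the line
      starting at \<open>x\<close> with this direction, the parameter 1 is the point x -
      y/t.\<close>
    define D where "D i y = (dir_deriv ((- 1 / t) *\<^sub>R y) ^^ i) f" for i y
    have Ds: "D i y \<in> schwartz" for i y unfolding D_def by (rule schwartz_dir_deriv_pow[OF f])
    have i0: "integrable lborel (\<lambda>y. f (x - (1 / t) *\<^sub>R y) * \<theta> y)"
    proof -
      obtain M where "\<And>z. norm (f z) \<le> M" using bdd_smooth_bounded[OF schwartz_bdd_smooth[OF f]] by metis
      then show ?thesis
        by (intro integrable_bounded_mult[OF schwartz_integrable[OF \<theta>(1)]]
            measurable_compose[OF _ smooth_measurable[OF schwartz_smooth[OF f]]]) auto
    qed
    have hb: "has_bochner_integral lborel (\<lambda>y. \<theta> y * D i y x) 0" if "i < r" for i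
      using dir_deriv_pow_moment[where r = r, OF \<theta> f, where m = "\<lambda>_. 0" and q = i and c = "- 1 / t" and x = x] that
      by (simp add: D_def monomial_def mi_order_def)
    let ?P = "\<lambda>y. \<Sum>i<r. of_real (1 ^ i / fact i) * (\<theta> y * D i y x)"
    have hP: "has_bochner_integral lborel ?P (\<Sum>i<r. of_real (1 ^ i / fact i) * 0)"
      by (intro has_bochner_integral_sum has_bochner_integral_mult_right hb) auto
    have "conv f (dilate t \<theta>) x = (LINT y|lborel. f (x - (1 / t) *\<^sub>R y) * \<theta> y) - (LINT y|lborel. ?P y)"
      using has_bochner_integral_integral_eq[OF hP] t
      by (simp add: conv_dilate_right[OF schwartz_bdd_smooth[OF f] schwartz_integrable[OF \<theta>(1)]])
    also have "\<dots> = (LINT y|lborel. f (x - (1 / t) *\<^sub>R y) * \<theta> y - ?P y)"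
      using i0 hP by (subst Bochner_Integration.integral_diff) (auto simp: has_bochner_integral_iff)
    also have "norm \<dots> \<le> (LINT y|lborel. norm (f (x - (1 / t) *\<^sub>R y) * \<theta> y - ?P y))"
      by (rule integral_norm_bound)
    also have "\<dots> \<le> (LINT y|lborel. C / t ^ r / (1 + norm x) ^ p * ((1 + norm y) ^ (r + p) * norm (\<theta> y)))"
    proof (intro integral_mono integrable_norm Bochner_Integration.integrable_diff i0 integrable_mult_right
        schwartz_weighted_integrable \<theta>)
      show "integrable lborel ?P" using hP by (simp add: has_bochner_integral_iff)
      fix y :: "real ^ 'd"
      let ?z = "(- 1 / t) *\<^sub>R y"
      have pos: "0 < 1 + norm v" for v :: "real ^ 'd" by (simp add: add_pos_nonneg)
      have nz: "norm ?z = norm y / t" using t by simp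
      have "norm (D 0 y (x + 1 *\<^sub>R ?z) - (\<Sum>i<r. of_real (1 ^ i / fact i) * D i y (x + 0 *\<^sub>R ?z)))
        \<le> C / t ^ r / (1 + norm x) ^ p * (1 + norm y) ^ (r + p)"
      proof (rule taylor_bound[where D = "\<lambda>i s. D i y (x + s *\<^sub>R ?z)"])
        show "((\<lambda>s. D i y (x + s *\<^sub>R ?z)) has_vector_derivative D (Suc i) y (x + s *\<^sub>R ?z)) (at s)" for i s
          using has_vector_derivative_dir_deriv[OF schwartz_smooth[OF Ds[of i y]], of x ?z s]
          by (simp add: D_def)
        fix s :: real assume s: "\<bar>s\<bar> \<le> 1"
        let ?v = "x + s *\<^sub>R ?z"
        \<comment> \<open>Peetre's inequality 1 + |x| \<le> (1 + |v|) (1 + |y|): as t \<ge> 1, the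
          point v differs from \<open>x\<close> by at most |y|.\<close>
        have "norm (s *\<^sub>R ?z) \<le> 1 * norm y"
          unfolding norm_scaleR[of s] nz using s t mult_right_mono[OF t norm_ge_zero[of y]]
          by (intro mult_mono) (auto simp: field_simps)
        then have "norm x \<le> norm ?v + norm y"
          using norm_triangle_ineq4[of ?v "s *\<^sub>R ?z"] by simp
        also have "\<dots> \<le> (1 + norm ?v) * (1 + norm y) - 1" by (simp add: algebra_simps)
        finally have "(1 + norm x) ^ p \<le> ((1 + norm ?v) * (1 + norm y)) ^ p" by (intro power_mono) auto
        then have w: "1 / (1 + norm ?v) ^ p \<le> (1 + norm y) ^ p / (1 + norm x) ^ p"
          using pos[of ?v] pos[of x] by (simp add: divide_simps power_mult_distrib mult_ac)
        have "norm (D r y ?v) \<le> C * (norm y / t) ^ r / (1 + norm ?v) ^ p"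
          unfolding D_def using C(2)[of ?z ?v] unfolding nz .
        also have "\<dots> = C / t ^ r * norm y ^ r * (1 / (1 + norm ?v) ^ p)" by (simp add: power_divide)
        also have "\<dots> \<le> C / t ^ r * (1 + norm y) ^ r * ((1 + norm y) ^ p / (1 + norm x) ^ p)"
          using C(1) t by (intro mult_mono w power_mono) auto
        also have "\<dots> = C / t ^ r / (1 + norm x) ^ p * (1 + norm y) ^ (r + p)"
          by (simp add: power_add)
        finally show "norm (D r y ?v) \<le> C / t ^ r / (1 + norm x) ^ p * (1 + norm y) ^ (r + p)" .
      qed simp
      from mult_right_mono[OF this norm_ge_zero[of "\<theta> y"]]
      have "norm ((f (x - (1 / t) *\<^sub>R y) - (\<Sum>i<r. of_real (1 ^ i / fact i) * D i y x)) * \<theta> y)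
        \<le> C / t ^ r / (1 + norm x) ^ p * (1 + norm y) ^ (r + p) * norm (\<theta> y)"
        by (simp add: norm_mult D_def)
      moreover have "(f (x - (1 / t) *\<^sub>R y) - (\<Sum>i<r. of_real (1 ^ i / fact i) * D i y x)) * \<theta> y
        = f (x - (1 / t) *\<^sub>R y) * \<theta> y - ?P y"
        by (simp add: left_diff_distrib right_diff_distrib sum_distrib_right sum_distrib_left mult_ac)
      ultimately show "norm (f (x - (1 / t) *\<^sub>R y) * \<theta> y - ?P y)
        \<le> C / t ^ r / (1 + norm x) ^ p * ((1 + norm y) ^ (r + p) * norm (\<theta> y))"
        by (simp add: mult.assoc)
    qed
    also have "\<dots> = C * I / t ^ r / (1 + norm x) ^ p" by (simp add: I_def)
    finally show ?thesis .
  qed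
  then show ?thesis using C(1) I by (intro exI[of _ "C * I"]) auto
qed

lemma l1_conv_moment_decay:
  fixes \<theta> f :: "real ^ 'd::finite \<Rightarrow> complex"
  assumes \<theta>: "\<theta> \<in> schwartz" "\<And>m. mi_order m < r \<Longrightarrow> (LINT x|lborel. monomial m x *\<^sub>R \<theta> x) = 0"
    and f: "f \<in> schwartz"
  shows "\<exists>C\<ge>0. \<forall>t\<ge>1. l1 (conv f (dilate t \<theta>)) \<le> C / t ^ r"
proof -
  let ?W = "\<lambda>x::real^'d. 1 / (1 + norm x) ^ (2 * CARD('d))"
  have W: "integrable lborel ?W" using integrable_inverse_norm_power[where 'a="real^'d"] by simp
  obtain C where C: "C \<ge> 0" "\<And>t x. t \<ge> 1 \<Longrightarrow> norm (conv f (dilate t \<theta>) x) \<le> C / t ^ r / (1 + norm x) ^ (2 * CARD('d))"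
    using conv_moment_decay[where r = r, OF assms, where p = "2 * CARD('d)"] by auto
  have "l1 (conv f (dilate t \<theta>)) \<le> C * (LINT x|lborel. ?W x) / t ^ r" if t: "t \<ge> 1" for t
  proof -
    have "integrable lborel (conv f (dilate t \<theta>))"
      using t by (intro integrable_conv schwartz_bdd_smooth schwartz_integrable f schwartz_dilate \<theta>) auto
    then have "l1 (conv f (dilate t \<theta>)) \<le> (LINT x|lborel. C / t ^ r * ?W x)"
      unfolding l1_def using C(2)[OF t] W by (intro integral_mono integrable_norm integrable_mult_right) auto
    also have "\<dots> = C / t ^ r * (LINT x|lborel. ?W x)" by (rule integral_mult_right_zero)
    finally show ?thesis by (simp only: times_divide_eq_left)
  qed
  then show ?thesis using C(1) by (intro exI[of _ "C * (LINT x|lborel. ?W x)"]) (auto intro!: mult_nonneg_nonneg Bochner_Integration.integral_nonneg)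
qed

subsection \<open>The Fourier transform\<close>

lemma cis_diff_bound: "norm (cis a - cis b) \<le> \<bar>a - b\<bar>"
proof -
  have "cis a - cis b = cis b * (cis (a - b) - 1)"
    by (simp add: right_diff_distrib cis_mult)
  then show ?thesis
    using iexp_approx1[of "a - b" 0] by (simp add: norm_mult cis_conv_exp)
qed

lemma cis_second_order_bound: "norm (cis (a + h) - cis a - \<i> * of_real h * cis a) \<le> h\<^sup>2"
proof -
  have "cis (a + h) - cis a - \<i> * of_real h * cis a = cis a * (cis h - 1 - \<i> * of_real h)"
    by (simp add: right_diff_distrib cis_mult mult_ac)
  moreover have "norm (cis h - 1 - \<i> * of_real h) \<le> h\<^sup>2"
  proof -
    have "2 * norm (cis h - 1 - \<i> * of_real h) \<le> h\<^sup>2"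
      using iexp_approx1[of h 1] by (simp add: cis_conv_exp power2_eq_square algebra_simps)
    with norm_ge_zero[of "cis h - 1 - \<i> * of_real h"] show ?thesis by linarith
  qed
  ultimately show ?thesis by (simp add: norm_mult)
qed

lemma cis_inner_measurable [measurable]: "(\<lambda>x. cis (- (u \<bullet> x))) \<in> borel_measurable borel"
  by (intro borel_measurable_continuous_onI continuous_intros)

lemma integrable_cis_mult:
  assumes "integrable lborel f"
  shows "integrable lborel (\<lambda>x::'a::euclidean_space. cis (- (u \<bullet> x)) * f x)"
  by (rule integrable_bounded_mult[OF assms, where B = 1]) auto

lemma integral_diff_diff_mult:
  fixes A B D :: "'a \<Rightarrow> complex"
  assumes "integrable M A" "integrable M B" "integrable M D"
  shows "(LINT x|M. A x - B x - c * D x) = (LINT x|M. A x) - (LINT x|M. B x) - c * (LINT x|M. D x)"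
  using assms by simp

lemma norm_fourier_le: "norm (fourier f u) \<le> l1 f"
  using integral_norm_bound[of lborel "\<lambda>x. cis (- (u \<bullet> x)) * f x"]
  by (simp add: fourier_def l1_def norm_mult)

lemma fourier_cmult: "fourier (\<lambda>x. c * f x) u = c * fourier f u"
  by (simp add: fourier_def mult.left_commute)

lemma fourier_sum:
  assumes "\<And>a. a \<in> A \<Longrightarrow> integrable lborel (f a)"
  shows "fourier (\<lambda>x. \<Sum>a\<in>A. f a x) u = (\<Sum>a\<in>A. fourier (f a) u)"
  using assms by (simp add: fourier_def sum_distrib_left Bochner_Integration.integral_sum integrable_cis_mult)

lemma fourier_lipschitz:
  fixes f :: "real ^ 'd::finite \<Rightarrow> complex"
  assumes "f \<in> schwartz"
  shows "norm (fourier f u - fourier f v) \<le> (LINT x|lborel. (1 + norm x) ^ 1 * norm (f x)) * norm (u - v)"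
proof -
  note int = integrable_cis_mult[OF schwartz_integrable[OF assms]]
  have "fourier f u - fourier f v = (LINT x|lborel. cis (- (u \<bullet> x)) * f x - cis (- (v \<bullet> x)) * f x)"
    using int by (simp add: fourier_def)
  also have "norm \<dots> \<le> (LINT x|lborel. norm (cis (- (u \<bullet> x)) * f x - cis (- (v \<bullet> x)) * f x))"
    by (rule integral_norm_bound)
  also have "\<dots> \<le> (LINT x|lborel. norm (u - v) * ((1 + norm x) ^ 1 * norm (f x)))"
  proof (intro integral_mono integrable_norm Bochner_Integration.integrable_diff int integrable_mult_right
      schwartz_weighted_integrable assms)
    fix x
    have "norm (cis (- (u \<bullet> x)) - cis (- (v \<bullet> x))) \<le> \<bar>(v - u) \<bullet> x\<bar>"
      using cis_diff_bound[of "- (u \<bullet> x)" "- (v \<bullet> x)"] by (simp add: inner_diff_left)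
    also have "\<dots> \<le> norm (v - u) * norm x" by (rule Cauchy_Schwarz_ineq2)
    also have "\<dots> \<le> norm (u - v) * (1 + norm x) ^ 1"
      by (simp add: norm_minus_commute mult_left_mono)
    finally have "norm (cis (- (u \<bullet> x)) - cis (- (v \<bullet> x))) * norm (f x) \<le> norm (u - v) * (1 + norm x) ^ 1 * norm (f x)"
      by (rule mult_right_mono) simp
    then show "norm (cis (- (u \<bullet> x)) * f x - cis (- (v \<bullet> x)) * f x) \<le> norm (u - v) * ((1 + norm x) ^ 1 * norm (f x))"
      by (simp add: norm_mult mult.assoc flip: left_diff_distrib)
  qed
  finally show ?thesis by (simp add: mult.commute)
qed

text \<open>The second order error of \<open>cis\<close> is at most t^2 |x_i|^2, which is integrable
  against a Schwartz function and so stays quadratic after integration.\<close>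

lemma fourier_has_partial:
  fixes f :: "real ^ 'd::finite \<Rightarrow> complex"
  assumes "f \<in> schwartz"
  shows "((\<lambda>t. fourier f (u + t *\<^sub>R axis i 1)) has_vector_derivative fourier (\<lambda>x. - \<i> * (of_real (x $ i) * f x)) u) (at 0)"
proof (rule has_vector_derivative_quadratic)
  fix t :: real
  let ?e = "axis i (1::real) :: real ^ 'd"
  note int = integrable_cis_mult[OF schwartz_integrable[OF assms]]
  have int2: "integrable lborel (\<lambda>x. cis (- (u \<bullet> x)) * (- \<i> * (of_real (x $ i) * f x)))"
    by (intro integrable_cis_mult schwartz_integrable schwartz_cmult schwartz_coordinate assms)
  define R where "R x = cis (- ((u + t *\<^sub>R ?e) \<bullet> x)) * f x - cis (- (u \<bullet> x)) * f x
        - of_real t * (cis (- (u \<bullet> x)) * (- \<i> * (of_real (x $ i) * f x)))" for x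
  have Ri: "integrable lborel R"
    unfolding R_def by (intro Bochner_Integration.integrable_diff integrable_mult_right int int2)
  have R: "fourier f (u + t *\<^sub>R ?e) - fourier f u - of_real t * fourier (\<lambda>x. - \<i> * (of_real (x $ i) * f x)) u
     = (LINT x|lborel. R x)"
    unfolding fourier_def R_def
    by (subst integral_diff_diff_mult[OF int[of "u + t *\<^sub>R ?e"] int[of u] int2, of "of_real t"]) (rule refl)
  have "norm (LINT x|lborel. R x) \<le> (LINT x|lborel. norm (R x))"
    by (rule integral_norm_bound)
  also have "\<dots> \<le> (LINT x|lborel. t\<^sup>2 * ((1 + norm x) ^ 2 * norm (f x)))"
  proof (intro integral_mono integrable_norm Ri integrable_mult_right schwartz_weighted_integrable assms)
    fix x :: "real ^ 'd"
    have xi: "(u + t *\<^sub>R ?e) \<bullet> x = u \<bullet> x + t * x $ i"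
      by (simp add: inner_add_left inner_commute[of "axis i 1"] cart_eq_inner_axis)
    have "norm (cis (- (u \<bullet> x) + - (t * x $ i)) - cis (- (u \<bullet> x)) - \<i> * of_real (- (t * x $ i)) * cis (- (u \<bullet> x))) \<le> (- (t * x $ i))\<^sup>2"
      by (rule cis_second_order_bound)
    also have "\<dots> = t\<^sup>2 * \<bar>x $ i\<bar>\<^sup>2" by (simp add: power_mult_distrib)
    also have "\<dots> \<le> t\<^sup>2 * (1 + norm x)\<^sup>2"
      using component_le_norm_cart[of x i] by (intro mult_left_mono power_mono) auto
    finally have "norm (cis (- (u \<bullet> x) + - (t * x $ i)) - cis (- (u \<bullet> x)) - \<i> * of_real (- (t * x $ i)) * cis (- (u \<bullet> x))) * norm (f x)
      \<le> t\<^sup>2 * (1 + norm x)\<^sup>2 * norm (f x)"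
      by (rule mult_right_mono) simp
    then show "norm (R x) \<le> t\<^sup>2 * ((1 + norm x) ^ 2 * norm (f x))"
      unfolding R_def xi by (simp add: norm_mult[symmetric] algebra_simps)
  qed
  finally have "norm (fourier f (u + t *\<^sub>R ?e) - fourier f u - of_real t * fourier (\<lambda>x. - \<i> * (of_real (x $ i) * f x)) u)
      \<le> t\<^sup>2 * (LINT x|lborel. (1 + norm x) ^ 2 * norm (f x))"
    by (simp only: R integral_mult_right_zero)
  then show "norm (fourier f (u + t *\<^sub>R ?e) - fourier f (u + 0 *\<^sub>R ?e) - of_real t * fourier (\<lambda>x. - \<i> * (of_real (x $ i) * f x)) u)
      \<le> (LINT x|lborel. (1 + norm x) ^ 2 * norm (f x)) * t\<^sup>2"
    by (simp only: mult.commute[of "t\<^sup>2"] scaleR_zero_left add_0_right)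
qed

text \<open>Translating \<open>f\<close> by t in direction \<open>i\<close> multiplies its transform
  by \<open>cis (t * u $ i)\<close>. The derivative at t = 0 is computed once from the translates of
  \<open>f\<close> and once from \<open>cis\<close>, and derivatives are unique.\<close>

lemma fourier_partial:
  fixes f :: "real ^ 'd::finite \<Rightarrow> complex"
  assumes f: "f \<in> schwartz"
  shows "fourier (partial i f) u = \<i> * of_real (u $ i) * fourier f u"
proof -
  let ?e = "axis i (1::real) :: real ^ 'd"
  let ?W = "\<lambda>x::real^'d. 1 / (1 + norm x) ^ (2 * CARD('d))"
  have W: "integrable lborel ?W" using integrable_inverse_norm_power[where 'a="real^'d"] by simp
  obtain C where C: "C \<ge> 0" "\<And>x. norm (pderivs [i, i] f x) \<le> C / (1 + norm x) ^ (2 * CARD('d))"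
    using schwartz_decay[OF f] by metis
  \<comment> \<open>Along a segment of length at most 1 one has 1 + |x| \<le> 2 (1 + |v|), hence one
    factor 2 for each power of the weight.\<close>
  let ?C = "C * 2 ^ (2 * CARD('d))"
  have pos: "0 < 1 + norm v" for v :: "real ^ 'd" by (simp add: add_pos_nonneg)
  have rem: "norm (f (x + t *\<^sub>R ?e) - f x - of_real t * partial i f x) \<le> (?C * ?W x) * t\<^sup>2" if t: "\<bar>t\<bar> \<le> 1" for x t
  proof (rule second_order_bound[OF schwartz_smooth[OF f]])
    fix s :: real assume s: "\<bar>s\<bar> \<le> \<bar>t\<bar>"
    let ?v = "x + s *\<^sub>R ?e"
    have "norm x \<le> norm ?v + norm (s *\<^sub>R ?e)" using norm_triangle_ineq4[of ?v "s *\<^sub>R ?e"] by simp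
    then have "norm x \<le> norm ?v + 1" using s t by simp
    moreover have "1 \<le> 1 + norm ?v" by simp
    ultimately have "norm x + 1 \<le> (norm ?v + 1) + (1 + norm ?v)" by (rule add_mono)
    then have "1 + norm x \<le> (1 + norm ?v) + (1 + norm ?v)" by (simp only: add.commute)
    then have "1 + norm x \<le> 2 * (1 + norm ?v)" by (simp only: mult_2)
    then have "(1 + norm x) ^ (2 * CARD('d)) \<le> (2 * (1 + norm ?v)) ^ (2 * CARD('d))"
      by (rule power_mono[OF _ less_imp_le[OF pos]])
    then have "1 / (1 + norm ?v) ^ (2 * CARD('d)) \<le> 2 ^ (2 * CARD('d)) * ?W x"
      unfolding power_mult_distrib using pos[of ?v] pos[of x] by (simp add: divide_simps mult_ac)
    from mult_left_mono[OF this C(1)] show "norm (partial i (partial i f) ?v) \<le> ?C * ?W x"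
      using C(2)[of ?v] by (simp add: pderivs_Cons mult.assoc)
  qed
  note int = integrable_cis_mult[OF schwartz_integrable[OF f]]
  have int1: "integrable lborel (\<lambda>x. cis (- (u \<bullet> x)) * partial i f x)"
    by (intro integrable_cis_mult schwartz_integrable schwartz_partial f)
  have "((\<lambda>t. cis (t * u $ i) * fourier f u) has_vector_derivative fourier (partial i f) u) (at 0)"
  proof (rule has_vector_derivative_quadratic)
    fix t :: real assume t: "\<bar>t\<bar> \<le> 1"
    have sh: "integrable lborel (\<lambda>x. f (x + t *\<^sub>R ?e))"
      using integrable_lborel_affine[OF schwartz_integrable[OF f], of 1 "t *\<^sub>R ?e"] by (simp add: add.commute)
    define R where "R x = cis (- (u \<bullet> x)) * f (x + t *\<^sub>R ?e) - cis (- (u \<bullet> x)) * f x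
      - of_real t * (cis (- (u \<bullet> x)) * partial i f x)" for x
    have Ri: "integrable lborel R"
      unfolding R_def by (intro Bochner_Integration.integrable_diff integrable_mult_right int int1 integrable_cis_mult sh)
    have ue: "u \<bullet> (x + t *\<^sub>R ?e) = u \<bullet> x + t * u $ i" for x
      by (simp add: inner_add_right cart_eq_inner_axis)
    have "fourier f u = (LINT x|lborel. cis (- (u \<bullet> (t *\<^sub>R ?e + 1 *\<^sub>R x))) * f (t *\<^sub>R ?e + 1 *\<^sub>R x))"
      unfolding fourier_def using integral_lborel_affine[OF int[of u], where c = 1 and t = "t *\<^sub>R ?e"] by simp
    also have "\<dots> = (LINT x|lborel. cis (- (t * u $ i)) * (cis (- (u \<bullet> x)) * f (x + t *\<^sub>R ?e)))"
    proof (intro Bochner_Integration.integral_cong refl)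
      fix x
      have "cis (- (u \<bullet> (x + t *\<^sub>R ?e))) = cis (- (t * u $ i)) * cis (- (u \<bullet> x))"
        unfolding ue cis_mult by (simp add: algebra_simps)
      then show "cis (- (u \<bullet> (t *\<^sub>R ?e + 1 *\<^sub>R x))) * f (t *\<^sub>R ?e + 1 *\<^sub>R x) = cis (- (t * u $ i)) * (cis (- (u \<bullet> x)) * f (x + t *\<^sub>R ?e))"
        by (simp add: add.commute mult.assoc)
    qed
    also have "\<dots> = cis (- (t * u $ i)) * fourier (\<lambda>x. f (x + t *\<^sub>R ?e)) u"
      by (simp add: fourier_def)
    finally have "cis (t * u $ i) * fourier f u = fourier (\<lambda>x. f (x + t *\<^sub>R ?e)) u"
      by (simp add: mult.assoc[symmetric] cis_mult)
    then have R: "cis (t * u $ i) * fourier f u - cis (0 * u $ i) * fourier f u - of_real t * fourier (partial i f) u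
      = (LINT x|lborel. R x)"
      unfolding fourier_def R_def
      by (subst integral_diff_diff_mult[OF integrable_cis_mult[OF sh, of u] int[of u] int1, of "of_real t"]) simp
    have "norm (LINT x|lborel. R x) \<le> (LINT x|lborel. norm (R x))"
      by (rule integral_norm_bound)
    also have "\<dots> \<le> (LINT x|lborel. (?C * t\<^sup>2) * ?W x)"
    proof (intro integral_mono integrable_norm Ri integrable_mult_right W)
      fix x :: "real ^ 'd"
      have "R x = cis (- (u \<bullet> x)) * (f (x + t *\<^sub>R ?e) - f x - of_real t * partial i f x)"
        by (simp add: R_def algebra_simps)
      then show "norm (R x) \<le> ?C * t\<^sup>2 * ?W x"
        using rem[OF t, of x] by (simp add: norm_mult mult_ac)
    qed
    also have "\<dots> = (?C * t\<^sup>2) * (LINT x|lborel. ?W x)" by (rule integral_mult_right_zero)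
    finally show "norm (cis (t * u $ i) * fourier f u - cis (0 * u $ i) * fourier f u - of_real t * fourier (partial i f) u)
       \<le> (?C * (LINT x|lborel. ?W x)) * t\<^sup>2"
      unfolding R by (simp only: mult_ac)
  qed
  moreover have "((\<lambda>t. cis (t * u $ i) * fourier f u) has_vector_derivative (\<i> * of_real (u $ i)) * fourier f u) (at 0)"
  proof (rule has_vector_derivative_mult_left, rule has_vector_derivative_quadratic)
    show "norm (cis (t * u $ i) - cis (0 * u $ i) - of_real t * (\<i> * of_real (u $ i))) \<le> (u $ i)\<^sup>2 * t\<^sup>2" for t
      using cis_second_order_bound[of 0 "t * u $ i"] by (simp add: power_mult_distrib mult_ac)
  qed
  ultimately show ?thesis by (rule vector_derivative_unique_at)
qed

lemma fourier_pderivs_replicate: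
  "f \<in> schwartz \<Longrightarrow> fourier (pderivs (replicate q i) f) u = (\<i> * of_real (u $ i)) ^ q * fourier f u"
  by (induction q arbitrary: f) (simp_all add: pderivs_Cons schwartz_partial fourier_partial mult_ac)

lemma fourier_smooth:
  fixes f :: "real ^ 'd::finite \<Rightarrow> complex"
  assumes "f \<in> schwartz"
  shows "fourier f \<in> smooth UNIV"
proof (rule smooth_coinduct[where X = "{fourier f |f. f \<in> schwartz}"])
  show "fourier f \<in> {fourier f |f. f \<in> schwartz}" using assms by blast
next
  fix g :: "real ^ 'd \<Rightarrow> complex" assume "g \<in> {fourier f |f. f \<in> schwartz}"
  then obtain f where g: "g = fourier f" "f \<in> schwartz" by blast
  have "(LINT x|lborel. (1 + norm x) ^ 1 * norm (f x))-lipschitz_on UNIV g"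
    unfolding lipschitz_on_def dist_norm g(1) using fourier_lipschitz[OF g(2)]
    by (auto intro!: Bochner_Integration.integral_nonneg)
  then show "continuous_on UNIV g" by (rule lipschitz_on_continuous_on)
  show "\<exists>h\<in>{fourier f |f. f \<in> schwartz}. \<forall>x. ((\<lambda>t. g (x + t *\<^sub>R axis i 1)) has_vector_derivative h x) (at 0)" for i
    unfolding g(1) using fourier_has_partial[OF g(2)] schwartz_cmult[OF schwartz_coordinate[OF g(2)]] by blast
qed

lemma partial_fourier: "f \<in> schwartz \<Longrightarrow> partial i (fourier f) = fourier (\<lambda>x. - \<i> * (of_real (x $ i) * f x))"
  by (rule ext, rule partial_eqI) (rule fourier_has_partial)

lemma pderivs_fourier:
  assumes "f \<in> schwartz"
  obtains g where "g \<in> schwartz" "pderivs w (fourier f) = fourier g"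
proof -
  have "\<exists>g\<in>schwartz. pderivs w (fourier f) = fourier g"
    using assms
  proof (induction w arbitrary: f)
    case (Cons i w)
    have "(\<lambda>x. - \<i> * (of_real (x $ i) * f x)) \<in> schwartz"
      by (intro schwartz_cmult schwartz_coordinate Cons.prems)
    from Cons.IH[OF this] show ?case by (simp add: pderivs_Cons partial_fourier Cons.prems)
  qed auto
  then show ?thesis using that by blast
qed

text \<open>Derivatives of the transform are transforms of Schwartz functions \<open>g\<close>, and
  powers of a coordinate turn into derivatives of \<open>g\<close>; l1 norms bound the
  result.\<close>

lemma fourier_schwartz:
  fixes f :: "real ^ 'd::finite \<Rightarrow> complex"
  assumes "f \<in> schwartz"
  shows "fourier f \<in> schwartz"
  unfolding schwartz_iff
proof (intro conjI allI fourier_smooth assms)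
  fix w :: "'d list" and q
  obtain g where g: "g \<in> schwartz" "pderivs w (fourier f) = fourier g"
    using pderivs_fourier[OF assms] by metis
  have "(1 + norm u) ^ q * norm (fourier g u) \<le> (1 + real CARD('d)) ^ q * (l1 g + (\<Sum>i\<in>UNIV. l1 (pderivs (replicate q i) g)))" for u
  proof -
    have "(1 + norm u) ^ q * norm (fourier g u)
      \<le> ((1 + real CARD('d)) ^ q * (1 + (\<Sum>i\<in>UNIV. \<bar>(u $ i) ^ q\<bar>))) * norm (fourier g u)"
      by (intro mult_right_mono one_plus_norm_power_le) auto
    also have "\<dots> = (1 + real CARD('d)) ^ q * (norm (fourier g u) + (\<Sum>i\<in>UNIV. norm (fourier (pderivs (replicate q i) g) u)))"
      by (simp add: fourier_pderivs_replicate g norm_mult norm_power power_abs algebra_simps flip: sum_distrib_left)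
    also have "\<dots> \<le> (1 + real CARD('d)) ^ q * (l1 g + (\<Sum>i\<in>UNIV. l1 (pderivs (replicate q i) g)))"
      by (intro mult_left_mono add_mono sum_mono norm_fourier_le) auto
    finally show ?thesis .
  qed
  then show "\<exists>C. \<forall>x. (1 + norm x) ^ q * norm (pderivs w (fourier f) x) \<le> C"
    unfolding g(2) by blast
qed

section \<open>Multiplication formula and inversion at the origin\<close>

lemma fourier_dilate:
  assumes "integrable lborel f" "a > 0"
  shows "fourier (dilate a f) u = fourier f ((1 / a) *\<^sub>R u)"
  using integral_lborel_affine[OF integrable_cis_mult[OF assms(1), of "(1 / a) *\<^sub>R u"], of a 0] assms(2)
  by (simp add: fourier_def dilate_def scaleR_conv_of_real[where 'a=complex] mult_ac flip: integral_mult_right_zero)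

text \<open>Fubini for an integrand of modulus |f u| |g y|. The formula is behind both
  \<open>conv_ift\<close> and \<open>integral_fourier\<close>.\<close>

lemma fourier_multiplication:
  fixes f g :: "real ^ 'd::finite \<Rightarrow> complex"
  assumes f: "integrable lborel f" and g: "integrable lborel g"
  shows "(LINT y|lborel. fourier f y * g y) = (LINT u|lborel. f u * fourier g u)"
proof -
  have [measurable]: "f \<in> borel_measurable borel" "g \<in> borel_measurable borel"
    using borel_measurable_integrable[OF f] borel_measurable_integrable[OF g] by simp_all
  have [measurable]: "(\<lambda>p. cis (- (fst p \<bullet> snd p))) \<in> borel_measurable (borel :: ((real^'d) \<times> (real^'d)) measure)"
    by (intro borel_measurable_continuous_onI continuous_intros)
  have [measurable]: "(\<lambda>p. cis (- (fst p \<bullet> snd p))) \<in> borel_measurable ((borel :: (real^'d) measure) \<Otimes>\<^sub>M (borel :: (real^'d) measure))"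
    by (simp add: borel_prod)
  have "integrable (lborel \<Otimes>\<^sub>M lborel) (\<lambda>(u, y). cis (- (u \<bullet> y)) * (f u * g y))"
  proof (rule lborel_pair.Fubini_integrable)
    show "(\<lambda>(u, y). cis (- (u \<bullet> y)) * (f u * g y)) \<in> borel_measurable (lborel \<Otimes>\<^sub>M lborel)"
      by (simp add: case_prod_beta')
    show "integrable lborel (\<lambda>u. LINT y|lborel. norm (case (u, y) of (u, y) \<Rightarrow> cis (- (u \<bullet> y)) * (f u * g y)))"
      using f by (simp add: norm_mult)
    show "AE u in lborel. integrable lborel (\<lambda>y. case (u, y) of (u, y) \<Rightarrow> cis (- (u \<bullet> y)) * (f u * g y))"
      using g by (auto intro!: AE_I2 integrable_cis_mult)
  qed
  from lborel_pair.Fubini_integral[OF this]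
  have "(LINT y|lborel. LINT u|lborel. cis (- (u \<bullet> y)) * (f u * g y)) = (LINT u|lborel. LINT y|lborel. cis (- (u \<bullet> y)) * (f u * g y))"
    by simp
  moreover have "(LINT u|lborel. cis (- (u \<bullet> y)) * (f u * g y)) = fourier f y * g y" for y
    by (simp add: fourier_def inner_commute mult.assoc[symmetric])
  moreover have "(LINT y|lborel. cis (- (u \<bullet> y)) * (f u * g y)) = f u * fourier g u" for u
    by (simp add: fourier_def mult.left_commute)
  ultimately show ?thesis by simp
qed

text \<open>The inverse Fourier transform, without the factor \<open>(2\<pi>)\<^sup>-\<^sup>d\<close>.\<close>

definition ift :: "(real ^ 'd::finite \<Rightarrow> complex) \<Rightarrow> real ^ 'd \<Rightarrow> complex" where
  "ift g x = fourier g (- x)"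

lemma ift_schwartz: "g \<in> schwartz \<Longrightarrow> ift g \<in> schwartz"
  using schwartz_dilation[OF fourier_schwartz, of g "-1"] by (simp add: ift_def[abs_def])

lemma partial_ift:
  assumes "g \<in> schwartz"
  shows "partial i (ift g) = ift (\<lambda>u. \<i> * (of_real (u $ i) * g u))"
proof -
  have "ift g = (\<lambda>x. fourier g ((-1) *\<^sub>R x + 0))" by (simp add: ift_def fun_eq_iff)
  then have "pderivs [i] (ift g) = (\<lambda>x. of_real (-1) ^ length [i] * pderivs [i] (fourier g) ((-1) *\<^sub>R x + 0))"
    by (simp only: pderivs_affine[OF fourier_smooth[OF assms]])
  moreover define h where "h x = of_real (x $ i) * g x" for x
  have "partial i (fourier g) = (\<lambda>u. - \<i> * fourier h u)"
    unfolding partial_fourier[OF assms] h_def by (rule ext, rule fourier_cmult)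
  ultimately show ?thesis
    by (simp add: pderivs_Cons ift_def fun_eq_iff fourier_cmult flip: h_def)
qed

text \<open>As a function of y, \<open>ift g (x - y)\<close> is the Fourier transform of
  \<open>g\<close> times a character, so the multiplication formula applies. This turns division by
  \<open>fourier \<theta>\<close> on the frequency side into a factorization of a
  convolution.\<close>

lemma conv_ift:
  fixes g \<theta> :: "real ^ 'd::finite \<Rightarrow> complex"
  assumes g: "g \<in> schwartz" and \<theta>: "\<theta> \<in> schwartz"
  shows "conv (ift g) \<theta> = ift (\<lambda>u. g u * fourier \<theta> u)"
proof
  fix x
  let ?g = "\<lambda>u. cis (- ((- x) \<bullet> u)) * g u"
  have "ift g (x - y) = fourier ?g y" for y
    unfolding ift_def fourier_def
    by (intro Bochner_Integration.integral_cong refl) (simp add: mult.assoc[symmetric] cis_mult inner_diff_left)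
  then have "conv (ift g) \<theta> x = (LINT y|lborel. fourier ?g y * \<theta> y)" by (simp add: conv_def)
  also have "\<dots> = (LINT u|lborel. ?g u * fourier \<theta> u)"
    by (intro fourier_multiplication integrable_cis_mult schwartz_integrable g \<theta>)
  finally show "conv (ift g) \<theta> x = ift (\<lambda>u. g u * fourier \<theta> u) x"
    by (simp add: ift_def fourier_def mult.assoc)
qed

text \<open>The integrand factors over the coordinates. In one variable the transform is, up to the
  factor sqrt (2 pi), the characteristic function of the standard normal distribution.\<close>

lemma
  fixes u :: "real ^ 'd::finite"
  shows integrable_gaussian: "integrable lborel (\<lambda>x::real^'d. complex_of_real (exp (- (norm x)\<^sup>2 / 2)))"
    and fourier_gaussian: "fourier (\<lambda>x. complex_of_real (exp (- (norm x)\<^sup>2 / 2))) u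
      = of_real (sqrt (2 * pi)) ^ CARD('d) * of_real (exp (- (norm u)\<^sup>2 / 2))"
proof -
  define h where "h v t = cis (- (v * t)) * complex_of_real (exp (- t\<^sup>2 / 2))" for v t :: real
  have sn: "std_normal_density t = 1 / sqrt (2 * pi) * exp (- t\<^sup>2 / 2)" for t
    by (simp add: std_normal_density_def)
  have h1: "integrable lborel (h v)" for v
  proof -
    have "integrable lborel (\<lambda>t. complex_of_real (sqrt (2 * pi) * std_normal_density t))"
      by (intro integrable_of_real integrable_mult_right) simp
    then have "integrable lborel (\<lambda>t. complex_of_real (exp (- t\<^sup>2 / 2)))" by (simp add: sn)
    then show ?thesis unfolding h_def using integrable_cis_mult[of _ v] by simp
  qed
  have h2: "(LINT t|lborel. h v t) = of_real (sqrt (2 * pi)) * of_real (exp (- v\<^sup>2 / 2))" for v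
  proof -
    have "complex_of_real (exp (- v\<^sup>2 / 2)) = char std_normal_distribution (- v)"
      by (simp add: char_std_normal_distribution)
    also have "\<dots> = (LINT t|lborel. std_normal_density t *\<^sub>R iexp (- v * t))"
      unfolding char_def by (subst integral_density) auto
    also have "\<dots> = (LINT t|lborel. of_real (1 / sqrt (2 * pi)) * h v t)"
      unfolding h_def sn cis_conv_exp
      by (intro Bochner_Integration.integral_cong refl) (simp add: scaleR_conv_of_real[where 'a=complex] mult_ac)
    also have "\<dots> = of_real (1 / sqrt (2 * pi)) * (LINT t|lborel. h v t)" by simp
    finally show ?thesis by (simp add: field_simps)
  qed
  have prod: "cis (- (v \<bullet> x)) * complex_of_real (exp (- (norm x)\<^sup>2 / 2)) = (\<Prod>b\<in>Basis. h (v \<bullet> b) (x \<bullet> b))" for v x :: "real ^ 'd"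
  proof -
    have cis_sum: "cis (\<Sum>b\<in>A. f b) = (\<Prod>b\<in>A. cis (f b))" if "finite A" for A :: "(real ^ 'd) set" and f
      using that by induction (simp_all add: cis_mult[symmetric])
    have "v \<bullet> x = (\<Sum>b\<in>Basis. (v \<bullet> b) * (x \<bullet> b))" by (rule euclidean_inner)
    moreover have "(norm x)\<^sup>2 = (\<Sum>b\<in>Basis. (x \<bullet> b)\<^sup>2)"
      unfolding power2_norm_eq_inner by (subst euclidean_inner) (simp add: power2_eq_square)
    ultimately show ?thesis
      by (simp add: h_def prod.distrib cis_sum sum_negf[symmetric] sum_divide_distrib exp_sum)
  qed
  show "integrable lborel (\<lambda>x::real^'d. complex_of_real (exp (- (norm x)\<^sup>2 / 2)))"
    using integrable_lborel_prod[of "\<lambda>b. h (0 \<bullet> b)", OF h1] prod[of 0] by simp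
  have "(norm u)\<^sup>2 = (\<Sum>b\<in>Basis. (u \<bullet> b)\<^sup>2)"
    unfolding power2_norm_eq_inner by (subst euclidean_inner) (simp add: power2_eq_square)
  then show "fourier (\<lambda>x. complex_of_real (exp (- (norm x)\<^sup>2 / 2))) u
      = of_real (sqrt (2 * pi)) ^ CARD('d) * of_real (exp (- (norm u)\<^sup>2 / 2))"
    unfolding fourier_def prod integral_lborel_prod[of "\<lambda>b. h (u \<bullet> b)", OF h1] h2
    by (simp add: prod.distrib exp_sum sum_negf[symmetric] sum_divide_distrib)
qed

text \<open>A Gaussian factor \<gamma> (\<delta> x) is inserted, carried to the other side by the
  multiplication formula, and removed by dominated convergence as \<delta> tends to 0. One factor
  sqrt (2 pi)^d comes from \<open>fourier \<gamma>\<close>, the other from the integral of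
  \<gamma>.\<close>

lemma integral_fourier:
  fixes g :: "real ^ 'd::finite \<Rightarrow> complex"
  assumes g: "g \<in> schwartz"
  shows "(LINT x|lborel. fourier g x) = of_real (2 * pi) ^ CARD('d) * g 0"
proof -
  define \<gamma> where "\<gamma> x = complex_of_real (exp (- (norm x)\<^sup>2 / 2))" for x :: "real ^ 'd"
  have \<gamma>i: "integrable lborel \<gamma>" unfolding \<gamma>_def[abs_def] by (rule integrable_gaussian)
  have \<gamma>F: "fourier \<gamma> u = of_real (sqrt (2 * pi)) ^ CARD('d) * \<gamma> u" for u
    unfolding \<gamma>_def[abs_def] by (rule fourier_gaussian)
  have \<gamma>1: "norm (\<gamma> x) \<le> 1" for x by (simp add: \<gamma>_def)
  have [measurable]: "\<gamma> \<in> borel_measurable borel" using borel_measurable_integrable[OF \<gamma>i] by simp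
  note Fi = schwartz_integrable[OF fourier_schwartz[OF g]]
  have [measurable]: "fourier g \<in> borel_measurable borel" "g \<in> borel_measurable borel"
    by (auto intro: smooth_measurable schwartz_smooth fourier_schwartz g)
  obtain M where M: "\<And>x. norm (g x) \<le> M" using bdd_smooth_bounded[OF schwartz_bdd_smooth[OF g]] by metis
  have isC: "isCont g 0" "isCont \<gamma> 0"
    using smooth_continuous[OF schwartz_smooth[OF g], of UNIV]
    by (auto simp: continuous_on_eq_continuous_at \<gamma>_def[abs_def] intro!: continuous_intros)
  define \<delta> where "\<delta> n = inverse (real (Suc n))" for n
  have \<delta>: "\<delta> n > 0" "\<delta> \<longlonglongrightarrow> 0" for n
    by (simp_all add: \<delta>_def) (use LIMSEQ_inverse_real_of_nat in \<open>simp add: \<delta>_def[abs_def]\<close>)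
  have lim0: "(\<lambda>n. \<delta> n *\<^sub>R x) \<longlonglongrightarrow> 0" for x :: "real ^ 'd"
    using tendsto_scaleR[OF \<delta>(2) tendsto_const[of x]] by simp
  have eq: "(LINT x|lborel. fourier g x * \<gamma> (\<delta> n *\<^sub>R x)) = (LINT v|lborel. g (\<delta> n *\<^sub>R v) * fourier \<gamma> v)" for n
  proof -
    let ?a = "\<delta> n"
    have a: "?a > 0" by (rule \<delta>)
    have "of_real (?a ^ CARD('d)) * (LINT x|lborel. fourier g x * \<gamma> (?a *\<^sub>R x)) = (LINT x|lborel. fourier g x * dilate ?a \<gamma> x)"
      by (simp add: dilate_def mult.left_commute flip: integral_mult_right_zero)
    also have "\<dots> = (LINT u|lborel. g u * fourier (dilate ?a \<gamma>) u)"
      by (intro fourier_multiplication schwartz_integrable g integral_dilate \<gamma>i a)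
    also have "\<dots> = (LINT u|lborel. g u * fourier \<gamma> ((1 / ?a) *\<^sub>R u))"
      by (simp add: fourier_dilate[OF \<gamma>i a])
    also have "\<dots> = of_real (?a ^ CARD('d)) * (LINT v|lborel. g (?a *\<^sub>R v) * fourier \<gamma> v)"
    proof -
      have "integrable lborel (\<lambda>u. fourier \<gamma> ((1 / ?a) *\<^sub>R u) * g u)"
        by (rule integrable_bounded_mult[OF schwartz_integrable[OF g], where B = "sqrt (2 * pi) ^ CARD('d)"])
          (auto simp: \<gamma>F norm_mult norm_power \<gamma>1 intro!: mult_left_le)
      then have "integrable lborel (\<lambda>u. g u * fourier \<gamma> ((1 / ?a) *\<^sub>R u))" by (simp add: mult.commute)
      from integral_lborel_affine[OF this, of ?a 0] show ?thesis
        using a by (simp add: scaleR_conv_of_real[where 'a=complex])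
    qed
    finally show ?thesis using a by simp
  qed
  have l1: "(\<lambda>n. LINT x|lborel. fourier g x * \<gamma> (\<delta> n *\<^sub>R x)) \<longlonglongrightarrow> (LINT x|lborel. fourier g x * \<gamma> 0)"
  proof (rule integral_dominated_convergence[where w = "\<lambda>x. norm (fourier g x)"])
    show "AE x in lborel. (\<lambda>n. fourier g x * \<gamma> (\<delta> n *\<^sub>R x)) \<longlonglongrightarrow> fourier g x * \<gamma> 0"
      by (intro AE_I2 tendsto_mult tendsto_const isCont_tendsto_compose[OF isC(2)] lim0)
    show "AE x in lborel. norm (fourier g x * \<gamma> (\<delta> n *\<^sub>R x)) \<le> norm (fourier g x)" for n
      by (auto simp: norm_mult intro!: AE_I2 mult_left_le \<gamma>1)
  qed (use Fi in auto)
  have Fg: "integrable lborel (fourier \<gamma>)" unfolding \<gamma>F[abs_def] using \<gamma>i by simp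
  have l2: "(\<lambda>n. LINT v|lborel. g (\<delta> n *\<^sub>R v) * fourier \<gamma> v) \<longlonglongrightarrow> (LINT v|lborel. g 0 * fourier \<gamma> v)"
  proof (rule integral_dominated_convergence[where w = "\<lambda>v. M * norm (fourier \<gamma> v)"])
    show "AE v in lborel. (\<lambda>n. g (\<delta> n *\<^sub>R v) * fourier \<gamma> v) \<longlonglongrightarrow> g 0 * fourier \<gamma> v"
      by (intro AE_I2 tendsto_mult tendsto_const isCont_tendsto_compose[OF isC(1)] lim0)
    show "AE v in lborel. norm (g (\<delta> n *\<^sub>R v) * fourier \<gamma> v) \<le> M * norm (fourier \<gamma> v)" for n
      by (auto simp: norm_mult intro!: AE_I2 mult_right_mono M)
    show "integrable lborel (\<lambda>v. M * norm (fourier \<gamma> v))" using Fg by simp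
  qed (auto simp: \<gamma>F)
  have "(LINT x|lborel. fourier g x * \<gamma> 0) = (LINT v|lborel. g 0 * fourier \<gamma> v)"
    using l1 l2 unfolding eq by (rule LIMSEQ_unique)
  moreover have "\<gamma> 0 = 1" by (simp add: \<gamma>_def)
  moreover have "(LINT v|lborel. \<gamma> v) = of_real (sqrt (2 * pi)) ^ CARD('d)"
    using \<gamma>F[of 0] \<open>\<gamma> 0 = 1\<close> by (simp add: fourier_def)
  ultimately have "(LINT x|lborel. fourier g x) = g 0 * (of_real (sqrt (2 * pi)) ^ CARD('d) * of_real (sqrt (2 * pi)) ^ CARD('d))"
    by (simp add: \<gamma>F)
  also have "complex_of_real (sqrt (2 * pi)) * of_real (sqrt (2 * pi)) = of_real (2 * pi)"
    by (subst of_real_mult[symmetric]) simp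
  then have "complex_of_real (sqrt (2 * pi)) ^ CARD('d) * of_real (sqrt (2 * pi)) ^ CARD('d) = of_real (2 * pi) ^ CARD('d)"
    by (simp only: power_mult_distrib[symmetric])
  finally show ?thesis by (simp only: mult.commute)
qed

lemma integral_ift:
  fixes g :: "real ^ 'd::finite \<Rightarrow> complex"
  assumes g: "g \<in> schwartz"
  shows "(LINT x|lborel. ift g x) = of_real (2 * pi) ^ CARD('d) * g 0"
  using integral_fourier[OF g] integral_lborel_affine[OF schwartz_integrable[OF fourier_schwartz[OF g]], of "-1" 0]
  by (simp add: ift_def)

subsection \<open>Cutoff functions and the Littlewood--Paley decomposition\<close>

text \<open>The power of 1 / t makes the family closed under differentiation up to linear
  combinations; q = 0 is the classical flat function exp (- 1 / t).\<close>

definition flat :: "nat \<Rightarrow> real \<Rightarrow> complex" where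
  "flat q t = (if t > 0 then of_real ((1 / t) ^ q * exp (- 1 / t)) else 0)"

text \<open>A single term of the series of exp (1 / t) beats the power of 1 / t and leaves t^2, so
  that the derivative at 0 vanishes.\<close>

lemma norm_flat_le: "norm (flat q t) \<le> fact (q + 2) * t\<^sup>2"
proof (cases "t > 0")
  case True
  have "(1 / t) ^ (q + 2) / fact (q + 2) \<le> exp (1 / t)"
  proof -
    have "summable (\<lambda>n. inverse (fact n) * (1 / t) ^ n)" by (rule summable_exp)
    from sum_le_suminf[OF this, of "{q + 2}"] True show ?thesis
      by (simp add: exp_def divide_inverse mult.commute)
  qed
  then have "(1 / t) ^ (q + 2) \<le> fact (q + 2) * exp (1 / t)"
    by (simp only: pos_divide_le_eq[OF fact_gt_zero] mult.commute)
  then have "(1 / t) ^ (q + 2) * (exp (- 1 / t) * t\<^sup>2) \<le> fact (q + 2) * exp (1 / t) * (exp (- 1 / t) * t\<^sup>2)"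
    by (rule mult_right_mono) simp
  moreover have "(1 / t) ^ (q + 2) * (exp (- 1 / t) * t\<^sup>2) = (1 / t) ^ q * exp (- 1 / t)"
    using True by (simp add: power_add power_one_over power2_eq_square)
  moreover have "exp (1 / t) * exp (- 1 / t) = 1" by (simp flip: exp_add)
  ultimately have "(1 / t) ^ q * exp (- 1 / t) \<le> fact (q + 2) * t\<^sup>2"
    by (metis mult.assoc mult.right_neutral)
  then show ?thesis using True by (simp add: flat_def norm_mult norm_power norm_divide)
qed (simp add: flat_def)

lemma flat_has_derivative: "(flat q has_vector_derivative flat (q + 2) t - of_nat q * flat (q + 1) t) (at t)"
proof (cases "t = 0")
  case True
  have "(flat q has_vector_derivative 0) (at 0)"
  proof (rule has_vector_derivative_quadratic)
    show "norm (flat q t - flat q 0 - of_real t * 0) \<le> fact (q + 2) * t\<^sup>2" for t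
      using norm_flat_le[of q t] by (simp add: flat_def)
  qed
  then show ?thesis using True by (simp add: flat_def)
next
  case False
  show ?thesis
  proof (cases "t > 0")
    case True
    have "((\<lambda>t. (1 / t) ^ q * exp (- 1 / t)) has_real_derivative (1 / t) ^ (q + 2) * exp (- 1 / t) - real q * ((1 / t) ^ (q + 1) * exp (- 1 / t))) (at t)"
    proof -
      have "((\<lambda>t. (1 / t) ^ q * exp (- 1 / t)) has_real_derivative
          (1 / t) ^ q * (exp (- 1 / t) * (1 / t\<^sup>2)) + (real q * (1 / t) ^ (q - 1) * (- 1 / t\<^sup>2)) * exp (- 1 / t)) (at t)"
        using True by (auto intro!: derivative_eq_intros simp: power2_eq_square)
      moreover have "real q * (1 / t) ^ (q - 1) * (- 1 / t\<^sup>2) = - real q * (1 / t) ^ (q + 1)"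
        using True by (cases q) (simp_all add: power_one_over power2_eq_square field_simps)
      then have "(1 / t) ^ q * (exp (- 1 / t) * (1 / t\<^sup>2)) + (real q * (1 / t) ^ (q - 1) * (- 1 / t\<^sup>2)) * exp (- 1 / t)
        = (1 / t) ^ (q + 2) * exp (- 1 / t) - real q * ((1 / t) ^ (q + 1) * exp (- 1 / t))"
        by (simp only:) (simp add: power_add power_one_over power2_eq_square)
      ultimately show ?thesis by (simp only:)
    qed
    then have "((\<lambda>t. complex_of_real ((1 / t) ^ q * exp (- 1 / t))) has_vector_derivative
      of_real ((1 / t) ^ (q + 2) * exp (- 1 / t) - real q * ((1 / t) ^ (q + 1) * exp (- 1 / t)))) (at t)"
      by (rule has_vector_derivative_of_real)
    then have "(flat q has_vector_derivative
      of_real ((1 / t) ^ (q + 2) * exp (- 1 / t) - real q * ((1 / t) ^ (q + 1) * exp (- 1 / t)))) (at t)"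
      by (rule has_vector_derivative_transform_within_open[where S = "{0<..}"]) (use True in \<open>auto simp: flat_def\<close>)
    then show ?thesis using True by (simp add: flat_def)
  next
    case False
    have "((\<lambda>t. 0) has_vector_derivative 0) (at t)" by simp
    then have "(flat q has_vector_derivative 0) (at t)"
      by (rule has_vector_derivative_transform_within_open[where S = "{..<0}"])
        (use False \<open>t \<noteq> 0\<close> in \<open>auto simp: flat_def\<close>)
    then show ?thesis using False by (simp add: flat_def)
  qed
qed

lemma power2_norm_add_axis:
  fixes v :: "real ^ 'd::finite"
  shows "(norm (v + t *\<^sub>R axis i 1))\<^sup>2 = (norm v)\<^sup>2 + 2 * t * (v $ i) + t\<^sup>2"
proof -
  have "v \<bullet> axis i 1 = v $ i" by (simp add: cart_eq_inner_axis)
  then show ?thesis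
    unfolding power2_norm_eq_inner
    by (simp add: inner_add_left inner_add_right inner_commute[of "axis i 1" v] inner_axis_axis power2_eq_square distrib_left)
qed

text \<open>The squared norm is a polynomial in the coordinates, hence smooth at the centre too.
  Differentiation produces \<open>flat\<close> with larger index, so the induction runs over all
  \<open>q\<close>; the factor \<open>s\<close> chooses between the inside and the outside of a
  ball.\<close>

lemma flat_norm_Ck:
  fixes a :: "real ^ 'd::finite"
  shows "(\<lambda>x. flat q (s * (c - (norm (x - a))\<^sup>2))) \<in> Ck k UNIV"
proof (induction k arbitrary: q)
  have cont: "continuous_on UNIV (\<lambda>x. flat q (s * (c - (norm (x - a))\<^sup>2)))" for q
  proof -
    have "continuous_on UNIV (flat q)"
      using flat_has_derivative by (intro continuous_at_imp_continuous_on) (auto intro: has_vector_derivative_continuous)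
    then show ?thesis
      by (rule continuous_on_compose2) (auto intro!: continuous_intros)
  qed
  {
    case 0
    show ?case using cont by simp
  next
    case (Suc k)
    let ?u = "\<lambda>x. s * (c - (norm (x - a))\<^sup>2)"
    let ?D = "\<lambda>i x. (flat (q + 2) (?u x) + (- of_nat q) * flat (q + 1) (?u x)) * (of_real (- 2 * s) * (of_real (x $ i) + of_real (- (a $ i))))"
    show ?case
    proof (rule Ck_SucI[where g = ?D])
      show "?D i \<in> Ck k UNIV" for i
        by (intro Ck_mult Ck_add Ck_const Ck_coordinate Suc.IH open_UNIV)
      fix i x
      have "((\<lambda>t. ?u (x + t *\<^sub>R axis i 1)) has_real_derivative (- 2 * s * (x $ i - a $ i))) (at 0)"
      proof -
        have "?u (x + t *\<^sub>R axis i 1) = s * (c - ((norm (x - a))\<^sup>2 + 2 * t * (x $ i - a $ i) + t\<^sup>2))" for t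
        proof -
          have "x + t *\<^sub>R axis i 1 - a = (x - a) + t *\<^sub>R axis i 1" by simp
          then show ?thesis by (simp only: power2_norm_add_axis vector_minus_component)
        qed
        moreover have "((\<lambda>t. s * (c - ((norm (x - a))\<^sup>2 + 2 * t * (x $ i - a $ i) + t\<^sup>2))) has_real_derivative
            (- 2 * s * (x $ i - a $ i))) (at 0)"
          by (auto intro!: derivative_eq_intros simp: algebra_simps)
        ultimately show ?thesis by (simp only:)
      qed
      then have 1: "((\<lambda>t. ?u (x + t *\<^sub>R axis i 1)) has_vector_derivative (- 2 * s * (x $ i - a $ i))) (at 0)"
        by (simp add: has_real_derivative_iff_has_vector_derivative)
      have 2: "(flat q has_vector_derivative flat (q + 2) (?u x) - of_nat q * flat (q + 1) (?u x)) (at (?u (x + 0 *\<^sub>R axis i 1)))"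
        using flat_has_derivative[of q "?u x"] by simp
      show "((\<lambda>t. flat q (?u (x + t *\<^sub>R axis i 1))) has_vector_derivative ?D i x) (at 0)"
        using vector_diff_chain_at[OF 1 2]
        by (simp add: o_def scaleR_conv_of_real[where 'a=complex] mult.commute)
    qed (use cont in auto)
  }
qed

text \<open>The quotient A / (A + B), where \<open>A\<close> is positive exactly within radius
  \<open>r2\<close> and \<open>B\<close> exactly beyond \<open>r1\<close>; since r1 < r2, the
  denominator never vanishes.\<close>

lemma smooth_ball_cutoff:
  fixes a :: "real ^ 'd::finite"
  assumes "0 \<le> r1" "r1 < r2"
  obtains \<rho> where "\<rho> \<in> smooth UNIV" "\<And>x. norm (x - a) \<le> r1 \<Longrightarrow> \<rho> x = 1" "\<And>x. r2 \<le> norm (x - a) \<Longrightarrow> \<rho> x = 0"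
proof -
  define A B where "A x = flat 0 (1 * (r2\<^sup>2 - (norm (x - a))\<^sup>2))" and "B x = flat 0 (- 1 * (r1\<^sup>2 - (norm (x - a))\<^sup>2))"
    for x :: "real ^ 'd"
  have sm: "A \<in> Ck k UNIV" "B \<in> Ck k UNIV" for k
    unfolding A_def[abs_def] B_def[abs_def] by (rule flat_norm_Ck)+
  have A0: "r2 \<le> norm (x - a) \<Longrightarrow> A x = 0" and B0: "norm (x - a) \<le> r1 \<Longrightarrow> B x = 0" for x
    using assms by (auto simp: A_def B_def flat_def power_mono not_less)
  have A1: "A x = of_real (exp (- 1 / (r2\<^sup>2 - (norm (x - a))\<^sup>2)))" if "norm (x - a) < r2" for x
    using that assms by (auto simp: A_def flat_def power_strict_mono)
  have B1: "B x = of_real (exp (- 1 / ((norm (x - a))\<^sup>2 - r1\<^sup>2)))" if "norm (x - a) > r1" for x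
    using that assms by (auto simp: B_def flat_def power_strict_mono)
  have nz: "A x + B x \<noteq> 0" for x
  proof (cases "norm (x - a) < r2")
    case True
    note A1[OF this]
    moreover have "B x = 0 \<or> B x = of_real (exp (- 1 / ((norm (x - a))\<^sup>2 - r1\<^sup>2)))"
      using B0[of x] B1[of x] by linarith
    ultimately show ?thesis
      by (auto simp flip: of_real_add) (metis add_pos_pos exp_gt_zero less_irrefl)
  next
    case False
    with assms have "norm (x - a) > r1" by simp
    from B1[OF this] A0[of x] False show ?thesis by auto
  qed
  show ?thesis
  proof
    show "(\<lambda>x. A x * inverse (A x + B x)) \<in> smooth UNIV"
      unfolding smooth_def by (intro INT_I Ck_mult Ck_inverse Ck_add sm nz open_UNIV)
    show "A x * inverse (A x + B x) = 1" if "norm (x - a) \<le> r1" for x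
      using B0[OF that] nz[of x] by simp
    show "A x * inverse (A x + B x) = 0" if "r2 \<le> norm (x - a)" for x
      using A0[OF that] by simp
  qed
qed

text \<open>The function 1 - \<Prod> (1 - \<rho> x) over a finite subcover is 1 as soon as one
  \<rho> x is. It provides the witness for the choice made in \<open>cutoff\<close>.\<close>

lemma exists_test_function_eq_1:
  fixes K :: "(real ^ 'd::finite) set"
  assumes "compact K" "open \<Omega>" "K \<subseteq> \<Omega>"
  shows "\<exists>\<eta>. \<eta> \<in> test_functions \<Omega> \<and> (\<exists>V. open V \<and> K \<subseteq> V \<and> (\<forall>x\<in>V. \<eta> x = 1))"
proof -
  have "\<exists>r>0. cball x r \<subseteq> \<Omega>" if "x \<in> K" for x
    using that assms open_contains_cball by blast
  then obtain r where r: "\<And>x. x \<in> K \<Longrightarrow> r x > 0" "\<And>x. x \<in> K \<Longrightarrow> cball x (r x) \<subseteq> \<Omega>" by metis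
  have "\<exists>\<rho>. \<rho> \<in> smooth UNIV \<and> (\<forall>y. norm (y - x) \<le> r x / 2 \<longrightarrow> \<rho> y = 1) \<and> (\<forall>y. r x \<le> norm (y - x) \<longrightarrow> \<rho> y = 0)"
    if x: "x \<in> K" for x
  proof -
    obtain \<rho> where "\<rho> \<in> smooth UNIV" "\<And>y. norm (y - x) \<le> r x / 2 \<Longrightarrow> \<rho> y = 1" "\<And>y. r x \<le> norm (y - x) \<Longrightarrow> \<rho> y = 0"
      using smooth_ball_cutoff[of "r x / 2" "r x" x] r(1)[OF x] by auto
    then show ?thesis by blast
  qed
  then obtain \<rho> where \<rho>: "\<And>x. x \<in> K \<Longrightarrow> \<rho> x \<in> smooth UNIV"
    "\<And>x y. x \<in> K \<Longrightarrow> norm (y - x) \<le> r x / 2 \<Longrightarrow> \<rho> x y = 1" "\<And>x y. x \<in> K \<Longrightarrow> r x \<le> norm (y - x) \<Longrightarrow> \<rho> x y = 0"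
    by metis
  have cover: "K \<subseteq> (\<Union>x\<in>K. ball x (r x / 2))" using r(1) by force
  obtain F where F: "F \<subseteq> K" "finite F" "K \<subseteq> (\<Union>x\<in>F. ball x (r x / 2))"
    using compactE_image[OF assms(1) _ cover] by (metis open_ball)
  define \<eta> where "\<eta> y = 1 + (- 1) * (\<Prod>x\<in>F. 1 + (- 1) * \<rho> x y)" for y
  have "\<eta> \<in> smooth UNIV"
    unfolding \<eta>_def[abs_def] smooth_def using \<rho>(1) F(1)
    by (intro INT_I Ck_add Ck_mult Ck_prod Ck_const open_UNIV) (auto dest: smooth_CkD)
  moreover have supp: "closure {y. \<eta> y \<noteq> 0} \<subseteq> (\<Union>x\<in>F. cball x (r x))"
  proof (rule closure_minimal)
    show "{y. \<eta> y \<noteq> 0} \<subseteq> (\<Union>x\<in>F. cball x (r x))"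
    proof safe
      fix y assume y: "\<eta> y \<noteq> 0"
      have "\<exists>x\<in>F. \<rho> x y \<noteq> 0"
        using y by (rule contrapos_np) (simp add: \<eta>_def)
      then obtain x where x: "x \<in> F" "\<rho> x y \<noteq> 0" by blast
      then have "norm (y - x) < r x" using \<rho>(3)[of x y] F(1) by force
      then show "y \<in> (\<Union>x\<in>F. cball x (r x))" using x(1) by (auto simp: dist_norm norm_minus_commute intro!: bexI[of _ x])
    qed
    show "closed (\<Union>x\<in>F. cball x (r x))" using F(2) by (intro closed_UN) auto
  qed
  moreover have "compact (closure {y. \<eta> y \<noteq> 0})"
  proof -
    have "compact (\<Union>x\<in>F. cball x (r x))" using F(2) by (intro compact_UN) auto
    then show ?thesis using compact_closure bounded_subset[OF compact_imp_bounded supp] bounded_subset closure_subset by metis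
  qed
  moreover have "(\<Union>x\<in>F. cball x (r x)) \<subseteq> \<Omega>" using r(2) F(1) by blast
  ultimately have "\<eta> \<in> test_functions \<Omega>" by (auto simp: test_functions_def)
  moreover have "\<eta> y = 1" if "y \<in> (\<Union>x\<in>F. ball x (r x / 2))" for y
  proof -
    obtain x where x: "x \<in> F" "dist x y < r x / 2" using \<open>y \<in> _\<close> by auto
    then have "1 + (- 1) * \<rho> x y = 0" using \<rho>(2)[of x y] F(1) by (auto simp: dist_norm norm_minus_commute)
    then have "(\<Prod>x\<in>F. 1 + (- 1) * \<rho> x y) = 0" using x(1) F(2) by (auto simp: prod_zero_iff)
    then show ?thesis by (simp add: \<eta>_def)
  qed
  ultimately show ?thesis using F(3) by (intro exI[of _ \<eta>] conjI exI[of _ "\<Union>x\<in>F. ball x (r x / 2)"]) auto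
qed

section \<open>Frequency profiles supported in an annulus\<close>

definition annular :: "real \<Rightarrow> real \<Rightarrow> (real ^ 'd::finite \<Rightarrow> complex) set" where
  "annular a b = {g \<in> smooth UNIV. \<forall>u. norm u < a \<or> b < norm u \<longrightarrow> g u = 0}"

lemma annular_schwartz: "g \<in> annular a b \<Longrightarrow> g \<in> schwartz"
  by (rule bounded_support_schwartz[of g b]) (auto simp: annular_def)

text \<open>Gluing: the product is smooth on \<open>U\<close> and is 0 on the open complement of
  \<open>F\<close>, so \<open>h\<close> may be singular outside \<open>U\<close>.\<close>

lemma smooth_supported_mult:
  assumes g: "g \<in> smooth UNIV" and U: "open U" "closed F" "F \<subseteq> U" "\<And>x. x \<notin> F \<Longrightarrow> g x = 0"
    and h: "\<And>k. h \<in> Ck k U"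
  shows "(\<lambda>x. g x * h x) \<in> smooth UNIV"
proof -
  have "(\<lambda>x. g x * h x) \<in> Ck k (U \<union> - F)" for k
  proof (rule Ck_Un)
    show "(\<lambda>x. g x * h x) \<in> Ck k U"
      using Ck_subset[OF smooth_CkD[OF g] subset_UNIV] by (intro Ck_mult U h)
    show "(\<lambda>x. g x * h x) \<in> Ck k (- F)"
      by (rule Ck_cong[of _ "\<lambda>x. 0"]) (use U in \<open>auto intro: Ck_const\<close>)
  qed (use U in auto)
  moreover have "U \<union> - F = UNIV" using U by auto
  ultimately show ?thesis by (simp add: smooth_def)
qed

lemma closed_annulus: "closed {u::real^'d::finite. a \<le> norm u \<and> norm u \<le> b}"
  by (intro closed_Collect_conj closed_Collect_le continuous_intros)

text \<open>Outside the annulus \<open>g\<close> is 0, so zeros of \<open>h\<close> there do no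
  harm. This is the division by a Fourier transform that is known to be nonzero on the annulus
  alone.\<close>

lemma annular_divide:
  assumes g: "g \<in> annular a b" and h: "h \<in> smooth UNIV" "\<And>u. a \<le> norm u \<Longrightarrow> norm u \<le> b \<Longrightarrow> h u \<noteq> 0"
  shows "(\<lambda>u. g u * inverse (h u)) \<in> annular a b" "g u * inverse (h u) * h u = g u"
proof -
  have "open {u. h u \<noteq> 0}"
    using smooth_continuous[OF h(1), of UNIV] by (intro open_Collect_neq continuous_intros)
  then have "(\<lambda>u. g u * inverse (h u)) \<in> smooth UNIV"
    using g h smooth_CkD[OF h(1)]
    by (intro smooth_supported_mult[where U = "{u. h u \<noteq> 0}", OF _ _ closed_annulus[of a b]] Ck_inverse)
      (auto simp: annular_def intro: Ck_subset)
  then show "(\<lambda>u. g u * inverse (h u)) \<in> annular a b" using g by (auto simp: annular_def)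
  show "g u * inverse (h u) * h u = g u"
  proof (cases "a \<le> norm u \<and> norm u \<le> b")
    case False
    then have "g u = 0" using g by (auto simp: annular_def not_le)
    then show ?thesis by simp
  qed (use h(2)[of u] in simp)
qed

text \<open>Multiply \<open>g\<close> by the sum of the u_i^2 divided by |u|^2, which is 1: the
  quotient is smooth as a > 0, and each factor i u_i is a derivative on the other side. The
  \<open>G i\<close> are annular again, so the step can be iterated.\<close>

lemma annular_decomposition:
  fixes g :: "real ^ 'd::finite \<Rightarrow> complex"
  assumes g: "g \<in> annular a b" and "a > 0"
  obtains G where "\<And>i. G i \<in> annular a b" "ift g = (\<lambda>x. \<Sum>i\<in>UNIV. partial i (ift (G i)) x)"
proof -
  define S where "S u = (\<Sum>j\<in>UNIV. complex_of_real (u $ j) * of_real (u $ j))" for u :: "real ^ 'd"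
  have S: "S \<in> smooth UNIV"
    unfolding S_def[abs_def] by (intro smooth_sum smooth_mult smooth_coordinate)
  have Sn: "S u = of_real ((norm u)\<^sup>2)" for u
    by (simp add: S_def norm_vec_def L2_set_def sum_nonneg power2_eq_square)
  have Snz: "S u \<noteq> 0" if "a \<le> norm u" for u
    using that \<open>a > 0\<close> by (auto simp: Sn)
  define G where "G i u = - \<i> * (of_real (u $ i) * (g u * inverse (S u)))" for i u
  have gS: "(\<lambda>u. g u * inverse (S u)) \<in> annular a b" and gS': "g u * inverse (S u) * S u = g u" for u
    using annular_divide[OF g S Snz] by auto
  have G: "G i \<in> annular a b" for i
  proof -
    have "G i \<in> smooth UNIV"
      unfolding G_def[abs_def] using gS
      by (intro smooth_cmult smooth_mult[OF smooth_coordinate]) (simp add: annular_def)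
    with g show ?thesis by (simp add: annular_def G_def)
  qed
  have dec: "g u = (\<Sum>i\<in>UNIV. \<i> * (of_real (u $ i) * G i u))" for u
  proof -
    have "(\<Sum>i\<in>UNIV. \<i> * (of_real (u $ i) * G i u)) = (\<Sum>i\<in>UNIV. g u * inverse (S u) * (of_real (u $ i) * of_real (u $ i)))"
      by (intro sum.cong refl) (simp add: G_def algebra_simps)
    also have "\<dots> = g u * inverse (S u) * S u" by (simp add: S_def sum_distrib_left)
    finally show ?thesis by (simp add: gS')
  qed
  have "ift g x = (\<Sum>i\<in>UNIV. partial i (ift (G i)) x)" for x
  proof -
    have "ift g x = fourier (\<lambda>u. \<Sum>i\<in>UNIV. \<i> * (of_real (u $ i) * G i u)) (- x)"
      unfolding ift_def by (rule arg_cong[of _ _ "\<lambda>g. fourier g (- x)"]) (rule ext, rule dec)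
    also have "\<dots> = (\<Sum>i\<in>UNIV. fourier (\<lambda>u. \<i> * (of_real (u $ i) * G i u)) (- x))"
      by (intro fourier_sum schwartz_integrable schwartz_cmult schwartz_coordinate annular_schwartz[OF G])
    finally show ?thesis by (simp add: partial_ift[OF annular_schwartz[OF G]] ift_def)
  qed
  then show ?thesis by (intro that[of G] G ext)
qed

section \<open>Moving derivatives across a convolution\<close>

lemma conv_partial_right:
  assumes "f \<in> schwartz" "g \<in> schwartz"
  shows "conv f (partial i g) = conv (partial i f) g"
proof -
  note b = schwartz_bdd_smooth schwartz_integrable schwartz_partial
  have "conv f (partial i g) = conv (partial i g) f"
    by (intro conv_commute b assms)
  also have "\<dots> = partial i (conv g f)"
    by (intro partial_conv[symmetric] b assms)
  also have "conv g f = conv f g" by (intro conv_commute b assms)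
  also have "partial i (conv f g) = conv (partial i f) g" by (intro partial_conv b assms)
  finally show ?thesis .
qed

lemma conv_pderivs_right:
  "f \<in> schwartz \<Longrightarrow> g \<in> schwartz \<Longrightarrow> conv f (pderivs w g) = conv (pderivs w f) g"
proof (induction w arbitrary: f g)
  case (Cons i w)
  then show ?case
    using partial_pderivs[OF schwartz_smooth, of f i w]
    by (simp add: pderivs_Cons schwartz_partial conv_partial_right schwartz_pderivs)
qed simp

lemma conv_sum_right:
  assumes "f \<in> bdd_smooth" "\<And>i. i \<in> A \<Longrightarrow> integrable lborel (F i)"
  shows "conv f (\<lambda>x. \<Sum>i\<in>A. c * F i x) = (\<lambda>x. \<Sum>i\<in>A. c * conv f (F i) x)"
proof
  fix x
  have "conv f (\<lambda>x. \<Sum>i\<in>A. c * F i x) x = (LINT y|lborel. (\<Sum>i\<in>A. c * (f (x - y) * F i y)))"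
    by (simp add: conv_def sum_distrib_left mult_ac)
  also have "\<dots> = (\<Sum>i\<in>A. (LINT y|lborel. c * (f (x - y) * F i y)))"
    by (intro Bochner_Integration.integral_sum integrable_mult_right conv_integrable assms)
  finally show "conv f (\<lambda>x. \<Sum>i\<in>A. c * F i x) x = (\<Sum>i\<in>A. c * conv f (F i) x)"
    by (simp add: conv_def)
qed

lemma partial_dilate: "f \<in> smooth UNIV \<Longrightarrow> partial i (dilate a f) = (\<lambda>x. of_real a * dilate a (partial i f) x)"
  using pderivs_dilate[of f "[i]" a] by (simp add: pderivs_Cons)

lemma dilate_ift_decomposition:
  fixes g :: "real ^ 'd::finite \<Rightarrow> complex"
  assumes G: "\<And>i. G i \<in> annular a b" "ift g = (\<lambda>x. \<Sum>i\<in>UNIV. partial i (ift (G i)) x)" and t: "t > 0"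
  shows "dilate t (ift g) = (\<lambda>x. \<Sum>i\<in>UNIV. of_real (1 / t) * partial i (dilate t (ift (G i))) x)"
  using t by (simp add: partial_dilate[OF schwartz_smooth[OF ift_schwartz[OF annular_schwartz[OF G(1)]]]] G(2))
    (simp add: dilate_def fun_eq_iff sum_distrib_left)

text \<open>Each decomposition of \<open>g\<close> yields a factor 1 / t from the dilation, and the
  derivative it creates is moved onto \<open>f\<close>, which is not dilated.\<close>

lemma l1_conv_annular_decay:
  fixes g f :: "real ^ 'd::finite \<Rightarrow> complex"
  assumes "g \<in> annular a b" "a > 0" "f \<in> schwartz"
  shows "\<exists>C\<ge>0. \<forall>t>0. l1 (conv f (dilate t (ift g))) \<le> C / t ^ M"
  using assms(1,3)
proof (induction M arbitrary: f g)
  case 0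
  have "l1 (conv f (dilate t (ift g))) \<le> l1 f * l1 (ift g)" if "t > 0" for t
    using integrable_conv(2)[of f "dilate t (ift g)"] that 0
    by (simp add: l1_dilate schwartz_bdd_smooth schwartz_integrable schwartz_dilate ift_schwartz annular_schwartz)
  then show ?case by (intro exI[of _ "l1 f * l1 (ift g)"]) (auto intro: mult_nonneg_nonneg l1_nonneg)
next
  case (Suc M)
  obtain G where G: "\<And>i. G i \<in> annular a b" "ift g = (\<lambda>x. \<Sum>i\<in>UNIV. partial i (ift (G i)) x)"
    using annular_decomposition[OF Suc.prems(1) \<open>a > 0\<close>] by metis
  have "\<forall>i. \<exists>C\<ge>0. \<forall>t>0. l1 (conv (partial i f) (dilate t (ift (G i)))) \<le> C / t ^ M"
    using Suc.IH[OF G(1) schwartz_partial[OF Suc.prems(2)]] by blast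
  then obtain C where C: "\<And>i. C i \<ge> 0" "\<And>i t. t > 0 \<Longrightarrow> l1 (conv (partial i f) (dilate t (ift (G i)))) \<le> C i / t ^ M"
    by metis
  have "l1 (conv f (dilate t (ift g))) \<le> (\<Sum>i\<in>UNIV. C i) / t ^ Suc M" if t: "t > 0" for t
  proof -
    let ?F = "\<lambda>i. conv (partial i f) (dilate t (ift (G i)))"
    have Gs: "dilate t (ift (G i)) \<in> schwartz" for i
      by (intro schwartz_dilate ift_schwartz annular_schwartz[OF G(1)] t)
    have Fi: "integrable lborel (?F i)" for i
      by (intro integrable_conv(1) schwartz_bdd_smooth schwartz_integrable schwartz_partial Suc.prems(2) Gs)
    have "conv f (dilate t (ift g)) = (\<lambda>x. \<Sum>i\<in>UNIV. of_real (1 / t) * conv f (partial i (dilate t (ift (G i)))) x)"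
      unfolding dilate_ift_decomposition[OF G t]
      by (rule conv_sum_right[OF schwartz_bdd_smooth[OF Suc.prems(2)] schwartz_integrable[OF schwartz_partial[OF Gs]]])
    also have "\<dots> = (\<lambda>x. \<Sum>i\<in>UNIV. of_real (1 / t) * ?F i x)"
      by (simp only: conv_partial_right[OF Suc.prems(2) Gs])
    finally have "l1 (conv f (dilate t (ift g))) \<le> (\<Sum>i\<in>UNIV. l1 (\<lambda>x. of_real (1 / t) * ?F i x))"
      by (simp only:) (intro l1_sum integrable_mult_right Fi finite)
    also have "\<dots> \<le> (\<Sum>i\<in>UNIV. 1 / t * (C i / t ^ M))"
      unfolding l1_cmult using t by (intro sum_mono mult_mono C) (auto simp: l1_nonneg norm_divide)
    also have "\<dots> = (\<Sum>i\<in>UNIV. C i) / t ^ Suc M"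
      by (simp add: sum_divide_distrib mult.commute)
    finally show ?thesis .
  qed
  then show ?case using C(1) by (intro exI[of _ "\<Sum>i\<in>UNIV. C i"]) (auto intro: sum_nonneg)
qed

text \<open>Brings the factor whose seminorm is known to the front, where
  \<open>dist_conv_conv_bound\<close> expects it.\<close>

lemma conv_rotate:
  assumes "f \<in> bdd_smooth" "integrable lborel f" "g \<in> bdd_smooth" "integrable lborel g" "h \<in> bdd_smooth" "integrable lborel h"
  shows "conv f (conv g h) = conv h (conv f g)"
proof -
  have "conv f (conv g h) = conv (conv g h) f"
    by (intro conv_commute assms integrable_conv)
  also have "\<dots> = conv (conv g f) h" by (intro conv_swap assms)
  also have "conv g f = conv f g" by (intro conv_commute assms)
  also have "conv (conv f g) h = conv h (conv f g)"
    by (intro conv_commute[symmetric] assms integrable_conv)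
  finally show ?thesis .
qed

lemma conv_diff_right:
  assumes "f \<in> bdd_smooth" "integrable lborel g" "integrable lborel h"
  shows "conv f (\<lambda>x. g x - h x) = (\<lambda>x. conv f g x - conv f h x)"
  using conv_integrable[OF assms(1,2)] conv_integrable[OF assms(1,3)]
  by (simp add: conv_def fun_eq_iff right_diff_distrib)

text \<open>\<Delta> at scale 2^l is the difference of \<Phi> at the scales 2^l and 2^(l-1), so the
  pieces telescope to the convolution of \<psi> with \<Phi> at scale 2^L. The latter approaches
  \<psi> at the rate 2^(-L), with all derivatives up to order \<open>N\<close>, hence also under
  \<open>U\<close>.\<close>

lemma (in bounded_functional) littlewood_paley_bound:
  assumes \<psi>: "\<psi> \<in> bdd_smooth" and \<Phi>: "\<Phi> \<in> schwartz" "(LINT x|lborel. \<Phi> x) = 1"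
    and \<Delta>: "\<Delta> = (\<lambda>x. \<Phi> x - dilate (1 / 2) \<Phi> x)"
    and P0: "\<And>x. norm (dist_conv U (conv \<psi> \<Phi>) x) \<le> P0"
    and P: "\<And>l x. l \<ge> 1 \<Longrightarrow> norm (dist_conv U (conv \<psi> (dilate (2 ^ l) \<Delta>)) x) \<le> P l"
    and B: "\<And>L. (\<Sum>l=1..L. P l) \<le> B"
  shows "norm (dist_conv U \<psi> x) \<le> P0 + B"
proof -
  note b = schwartz_bdd_smooth schwartz_integrable schwartz_dilate
  have \<Phi>i: "integrable lborel (dilate (2 ^ l) \<Phi>)" for l by (intro b \<Phi>) auto
  have cb: "conv \<psi> (dilate (2 ^ l) \<Phi>) \<in> bdd_smooth" for l by (intro conv_bdd_smooth \<psi> \<Phi>i)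
  have step: "norm (dist_conv U (conv \<psi> (dilate (2 ^ L) \<Phi>)) x) \<le> P0 + (\<Sum>l=1..L. P l)" for L
  proof (induction L)
    case 0
    then show ?case using P0 by simp
  next
    case (Suc L)
    have "dilate (2 ^ Suc L) \<Delta> = (\<lambda>x. dilate (2 ^ Suc L) \<Phi> x - dilate (2 ^ Suc L) (dilate (1 / 2) \<Phi>) x)"
      unfolding \<Delta> by (simp add: dilate_def fun_eq_iff right_diff_distrib)
    also have "dilate (2 ^ Suc L) (dilate (1 / 2) \<Phi>) = dilate (2 ^ L) \<Phi>"
      by (simp add: dilate_dilate)
    finally have "conv \<psi> (dilate (2 ^ Suc L) \<Delta>) = (\<lambda>x. conv \<psi> (dilate (2 ^ Suc L) \<Phi>) x - conv \<psi> (dilate (2 ^ L) \<Phi>) x)"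
      using conv_diff_right[OF \<psi> \<Phi>i[of "Suc L"] \<Phi>i[of L]] by simp
    then have "dist_conv U (conv \<psi> (dilate (2 ^ Suc L) \<Delta>)) x
      = dist_conv U (conv \<psi> (dilate (2 ^ Suc L) \<Phi>)) x - dist_conv U (conv \<psi> (dilate (2 ^ L) \<Phi>)) x"
      using dist_conv_diff[OF cb[of "Suc L"] cb[of L]] by simp
    with P[of "Suc L" x] Suc.IH show ?case
      using norm_triangle_sub[of "dist_conv U (conv \<psi> (dilate (2 ^ Suc L) \<Phi>)) x" "dist_conv U (conv \<psi> (dilate (2 ^ L) \<Phi>)) x"]
      by simp
  qed
  obtain M where M: "M \<ge> 0" "\<And>w x. length w \<le> N \<Longrightarrow> norm (pderivs w \<psi> x) \<le> M"
    "\<And>w x y. length w \<le> N \<Longrightarrow> norm (pderivs w \<psi> x - pderivs w \<psi> y) \<le> M * norm (x - y)"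
    using bdd_smooth_lipschitz[OF \<psi>] by metis
  define J where "J = (LINT y|lborel. (1 + norm y) ^ 1 * norm (\<Phi> y))"
  have J: "J \<ge> 0" unfolding J_def by (intro Bochner_Integration.integral_nonneg) auto
  have err: "norm (dist_conv U \<psi> x - dist_conv U (conv \<psi> (dilate (2 ^ L) \<Phi>)) x) \<le> C * (M / 2 ^ L * J)" for L
  proof -
    have "norm (dist_conv U (\<lambda>x. \<psi> x - conv \<psi> (dilate (2 ^ L) \<Phi>) x) x) \<le> C * (M / 2 ^ L * J)"
    proof (rule dist_conv_bound)
      show "(\<lambda>x. \<psi> x - conv \<psi> (dilate (2 ^ L) \<Phi>) x) \<in> bdd_smooth" by (intro bdd_smooth_diff \<psi> cb)
      show "0 \<le> M / 2 ^ L * J" using M J by simp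
      fix w :: "'d list" and z assume w: "length w \<le> N"
      have "pderivs w (\<lambda>x. \<psi> x - conv \<psi> (dilate (2 ^ L) \<Phi>) x) z = pderivs w \<psi> z - conv (pderivs w \<psi>) (dilate (2 ^ L) \<Phi>) z"
        using \<psi> cb \<Phi>i by (simp add: pderivs_diff bdd_smooth_smooth pderivs_conv)
      then show "norm (pderivs w (\<lambda>x. \<psi> x - conv \<psi> (dilate (2 ^ L) \<Phi>) x) z) \<le> M / 2 ^ L * J"
        using approximate_identity_bound[OF bdd_smooth_pderivs[OF \<psi>] M(3)[OF w] \<Phi>, of "2 ^ L"] by (simp add: J_def)
    qed
    then show ?thesis using dist_conv_diff[OF \<psi> cb] by simp
  qed
  have "(\<lambda>L. P0 + B + C * (M * (1 / 2) ^ L * J)) \<longlonglongrightarrow> P0 + B + C * (M * 0 * J)"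
    by (intro tendsto_intros LIMSEQ_power_zero) auto
  moreover have "norm (dist_conv U \<psi> x) \<le> P0 + B + C * (M * (1 / 2) ^ L * J)" for L
  proof -
    have "norm (dist_conv U \<psi> x) \<le> norm (dist_conv U (conv \<psi> (dilate (2 ^ L) \<Phi>)) x) + C * (M / 2 ^ L * J)"
      using err[of L] norm_triangle_sub[of "dist_conv U \<psi> x" "dist_conv U (conv \<psi> (dilate (2 ^ L) \<Phi>)) x"] by linarith
    with step[of L] B[of L] show ?thesis by (simp add: power_one_over)
  qed
  ultimately show ?thesis by (intro LIMSEQ_le_const) auto
qed

lemma dilate_half_ift:
  assumes "g \<in> schwartz"
  shows "ift (\<lambda>u. g (2 *\<^sub>R u)) = dilate (1 / 2) (ift g)"
proof
  fix x :: "real ^ 'a"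
  have i: "integrable lborel (\<lambda>u. cis (- ((- x) \<bullet> u)) * g (2 *\<^sub>R u))"
    using integrable_lborel_affine[OF schwartz_integrable[OF assms], of 2 0] by (intro integrable_cis_mult) simp
  show "ift (\<lambda>u. g (2 *\<^sub>R u)) x = dilate (1 / 2) (ift g) x"
    using integral_lborel_affine[OF i, of "1 / 2" 0]
    by (simp add: ift_def fourier_def dilate_def scaleR_conv_of_real[where 'a=complex])
qed

text \<open>The profile is \<sigma> u - \<sigma> (2 u) for a cutoff \<sigma>: the two terms agree
  for |u| below r1/2 and vanish beyond r2. The second one is the dilation by 1/2 on the other
  side.\<close>

lemma littlewood_paley_functions:
  fixes r1 r2 :: real
  assumes "0 < r1" "r1 < r2"
  obtains \<Phi> :: "real ^ 'd::finite \<Rightarrow> complex" and g where "\<Phi> \<in> schwartz" "(LINT x|lborel. \<Phi> x) = 1"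
    "g \<in> annular (r1 / 2) r2" "ift g = (\<lambda>x. \<Phi> x - dilate (1 / 2) \<Phi> x)"
proof -
  obtain \<rho> :: "real ^ 'd \<Rightarrow> complex" where \<rho>: "\<rho> \<in> smooth UNIV" "\<And>x. norm x \<le> r1 \<Longrightarrow> \<rho> x = 1" "\<And>x. r2 \<le> norm x \<Longrightarrow> \<rho> x = 0"
    using smooth_ball_cutoff[of r1 r2 0] assms by (auto simp: less_imp_le)
  \<comment> \<open>\<open>ift\<close> carries no factor (2 pi)^(-d); the constant restores it so
    that \<Phi> has integral 1.\<close>
  define c where "c = inverse (complex_of_real (2 * pi) ^ CARD('d))"
  have c: "complex_of_real (2 * pi) ^ CARD('d) * c = 1"
    unfolding c_def by (rule right_inverse) simp
  define \<sigma> where "\<sigma> u = c * \<rho> u" for u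
  have \<sigma>: "\<sigma> \<in> schwartz"
    unfolding \<sigma>_def[abs_def] by (intro schwartz_cmult bounded_support_schwartz[of \<rho> r2] \<rho>) auto
  have \<sigma>2: "(\<lambda>u. \<sigma> (2 *\<^sub>R u)) \<in> schwartz" by (intro schwartz_dilation \<sigma>) simp
  let ?g = "\<lambda>u. \<sigma> u + (- 1) * \<sigma> (2 *\<^sub>R u)"
  show ?thesis
  proof
    show "ift \<sigma> \<in> schwartz" by (rule ift_schwartz[OF \<sigma>])
    show "(LINT x|lborel. ift \<sigma> x) = 1"
      using integral_ift[OF \<sigma>] \<rho>(2)[of 0] assms c by (simp add: \<sigma>_def)
    have "?g u = 0" if "norm u < r1 / 2 \<or> r2 < norm u" for u
      using that \<rho>(2)[of u] \<rho>(2)[of "2 *\<^sub>R u"] \<rho>(3)[of u] \<rho>(3)[of "2 *\<^sub>R u"] assms by (auto simp: \<sigma>_def)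
    moreover have "?g \<in> smooth UNIV" by (intro smooth_add smooth_cmult schwartz_smooth \<sigma> \<sigma>2)
    ultimately show "?g \<in> annular (r1 / 2) r2" by (simp add: annular_def)
    show "ift ?g = (\<lambda>x. ift \<sigma> x - dilate (1 / 2) (ift \<sigma>) x)"
    proof
      fix x
      have "ift ?g x = ift \<sigma> x - ift (\<lambda>u. \<sigma> (2 *\<^sub>R u)) x"
        using integrable_cis_mult[OF schwartz_integrable[OF \<sigma>], of "- x"] integrable_cis_mult[OF schwartz_integrable[OF \<sigma>2], of "- x"]
        by (simp add: ift_def fourier_def right_diff_distrib)
      then show "ift ?g x = ift \<sigma> x - dilate (1 / 2) (ift \<sigma>) x" by (simp only: dilate_half_ift[OF \<sigma>])
    qed
  qed
qed

subsection \<open>Comparison of the two families of bounds\<close>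

text \<open>On either side of \<open>j\<close> the exponent is injective in \<open>l\<close>, so
  each half is at most a full geometric series.\<close>

lemma two_sided_geometric_sum_le:
  fixes \<rho> :: real
  assumes "0 < \<rho>" "\<rho> < 1"
  shows "(\<Sum>l=1..L. \<rho> ^ (if l \<le> j then j - l else l - j)) \<le> 2 / (1 - \<rho>)"
proof -
  have part: "(\<Sum>l\<in>A. \<rho> ^ f l) \<le> 1 / (1 - \<rho>)" if "inj_on f A" "finite A" for f and A :: "nat set"
  proof -
    have "(\<Sum>l\<in>A. \<rho> ^ f l) = (\<Sum>i\<in>f ` A. \<rho> ^ i)" using that by (simp add: sum.reindex)
    also have "\<dots> \<le> (\<Sum>i. \<rho> ^ i)" using that assms by (intro sum_le_suminf summable_geometric) auto
    finally show ?thesis using assms by (simp add: suminf_geometric)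
  qed
  have "(\<Sum>l=1..L. \<rho> ^ (if l \<le> j then j - l else l - j))
      = (\<Sum>l\<in>{1..L} \<inter> {..j}. \<rho> ^ (j - l)) + (\<Sum>l\<in>{1..L} - {..j}. \<rho> ^ (l - j))"
    by (subst sum.Int_Diff[of "{1..L}" _ "{..j}"]) (auto intro!: arg_cong2[of _ _ _ _ "(+)"] sum.cong)
  also have "\<dots> \<le> 1 / (1 - \<rho>) + 1 / (1 - \<rho>)"
    by (intro add_mono part) (auto simp: inj_on_def)
  finally show ?thesis by simp
qed

text \<open>One decomposition of \<open>g\<close> gains 1 / 2^l and moves one derivative onto
  \<open>\<psi> n\<close>. The bound \<open>E\<close> is demanded for every profile in the annulus,
  with its own constant, because each step replaces \<open>g\<close> by other profiles.\<close>

lemma (in bounded_functional) annular_derivative_bound: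
  fixes \<Theta> :: "nat \<Rightarrow> real ^ 'd \<Rightarrow> complex"
  assumes "a > 0" and \<Theta>: "\<And>j. \<Theta> j \<in> schwartz"
    and E: "\<And>g. g \<in> annular a b \<Longrightarrow> \<exists>D\<ge>0. \<forall>l j. l1 (conv (\<Theta> j) (dilate (2 ^ l) (ift g))) \<le> D * E l j"
      "\<And>l j. 0 \<le> E l j"
    and "g \<in> annular a b"
    and "\<And>n. n \<ge> (1::nat) \<Longrightarrow> \<psi> n \<in> schwartz"
    and "\<And>n w x. n \<ge> 1 \<Longrightarrow> length w = q \<Longrightarrow> norm (dist_conv U (pderivs w (\<psi> n)) x) \<le> B n"
  shows "\<exists>D\<ge>0. \<forall>l j n x. n \<ge> 1 \<longrightarrow>
    norm (dist_conv U (conv (\<Theta> j) (conv (dilate (2 ^ l) (ift g)) (\<psi> n))) x) \<le> D * (E l j * B n / (2 ^ l) ^ q)"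
  using assms(5-7)
proof (induction q arbitrary: g \<psi>)
  case 0
  obtain D where D: "D \<ge> 0" "\<And>l j. l1 (conv (\<Theta> j) (dilate (2 ^ l) (ift g))) \<le> D * E l j"
    using E(1)[OF 0(1)] by metis
  have fs: "dilate (2 ^ l) (ift g) \<in> schwartz" for l
    using 0(1) by (intro schwartz_dilate ift_schwartz annular_schwartz[of g a b]) auto
  have "norm (dist_conv U (conv (\<Theta> j) (conv (dilate (2 ^ l) (ift g)) (\<psi> n))) x) \<le> D * (E l j * B n / (2 ^ l) ^ 0)"
    if n: "n \<ge> 1" for l j n x
  proof -
    note b = schwartz_bdd_smooth schwartz_integrable
    let ?h = "conv (\<Theta> j) (dilate (2 ^ l) (ift g))"
    have "conv (\<Theta> j) (conv (dilate (2 ^ l) (ift g)) (\<psi> n)) = conv (\<psi> n) ?h"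
      by (intro conv_rotate b \<Theta> fs 0(2) n)
    moreover have "norm (dist_conv U (conv (\<psi> n) ?h) x) \<le> B n * (LINT y|lborel. norm (?h y))"
    proof (rule dist_conv_conv_bound)
      show "\<psi> n \<in> bdd_smooth" by (intro b 0(2) n)
      show "integrable lborel ?h" by (intro integrable_conv b \<Theta> fs)
      show "norm (dist_conv U (\<psi> n) x) \<le> B n" for x using 0(3)[OF n, of "[]"] by simp
    qed
    moreover have "0 \<le> B n" by (rule order_trans[OF norm_ge_zero 0(3)[OF n, of "[]"]]) simp
    then have "B n * (LINT y|lborel. norm (?h y)) \<le> B n * (D * E l j)"
      using D(2)[of j l] by (intro mult_left_mono) (simp add: l1_def)
    ultimately show ?thesis by (simp add: mult_ac)
  qed
  then show ?case using D(1) by blast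
next
  case (Suc q)
  obtain G where G: "\<And>i. G i \<in> annular a b" "ift g = (\<lambda>x. \<Sum>i\<in>UNIV. partial i (ift (G i)) x)"
    using annular_decomposition[OF Suc.prems(1) \<open>a > 0\<close>] by metis
  have "\<forall>i. \<exists>D\<ge>0. \<forall>l j n x. n \<ge> 1 \<longrightarrow>
    norm (dist_conv U (conv (\<Theta> j) (conv (dilate (2 ^ l) (ift (G i))) (partial i (\<psi> n)))) x) \<le> D * (E l j * B n / (2 ^ l) ^ q)"
  proof
    fix i
    show "\<exists>D\<ge>0. \<forall>l j n x. n \<ge> 1 \<longrightarrow>
      norm (dist_conv U (conv (\<Theta> j) (conv (dilate (2 ^ l) (ift (G i))) (partial i (\<psi> n)))) x) \<le> D * (E l j * B n / (2 ^ l) ^ q)"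
    proof (rule Suc.IH[OF G(1)])
      show "partial i (\<psi> n) \<in> schwartz" if "n \<ge> 1" for n by (intro schwartz_partial Suc.prems that)
      show "norm (dist_conv U (pderivs w (partial i (\<psi> n))) x) \<le> B n" if "n \<ge> 1" "length w = q" for n w x
        using Suc.prems(3)[OF that(1), of "i # w" x] that(2) by (simp add: pderivs_Cons)
    qed
  qed
  then obtain D where D: "\<And>i. D i \<ge> 0" "\<And>i l j n x. n \<ge> 1 \<Longrightarrow>
    norm (dist_conv U (conv (\<Theta> j) (conv (dilate (2 ^ l) (ift (G i))) (partial i (\<psi> n)))) x) \<le> D i * (E l j * B n / (2 ^ l) ^ q)"
    by metis
  have "norm (dist_conv U (conv (\<Theta> j) (conv (dilate (2 ^ l) (ift g)) (\<psi> n))) x)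
     \<le> (\<Sum>i\<in>UNIV. D i) * (E l j * B n / (2 ^ l) ^ Suc q)" if n: "n \<ge> 1" for l j n x
  proof -
    note b = schwartz_bdd_smooth schwartz_integrable
    let ?t = "2 ^ l :: real"
    have t0: "0 < ?t" by simp
    let ?f = "\<lambda>i. dilate ?t (ift (G i))"
    have fs: "?f i \<in> schwartz" for i
      by (intro schwartz_dilate ift_schwartz annular_schwartz[OF G(1)]) auto
    have gs: "dilate ?t (ift g) \<in> schwartz"
      by (intro schwartz_dilate ift_schwartz annular_schwartz[OF Suc.prems(1)]) auto
    have \<psi>: "\<psi> n \<in> schwartz" "partial i (\<psi> n) \<in> schwartz" for i by (intro schwartz_partial Suc.prems n)+
    have F: "integrable lborel (conv (?f i) (partial i (\<psi> n)))" "conv (?f i) (partial i (\<psi> n)) \<in> bdd_smooth" for i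
      by (intro integrable_conv conv_bdd_smooth b fs \<psi>)+
    have H: "conv (\<Theta> j) (conv (?f i) (partial i (\<psi> n))) \<in> bdd_smooth" for i
      by (intro conv_bdd_smooth b \<Theta> F)
    have "conv (dilate ?t (ift g)) (\<psi> n) = conv (\<psi> n) (dilate ?t (ift g))"
      by (intro conv_commute b gs \<psi>)
    also have "\<dots> = (\<lambda>x. \<Sum>i\<in>UNIV. of_real (1 / ?t) * conv (\<psi> n) (partial i (?f i)) x)"
      unfolding dilate_ift_decomposition[OF G t0]
      by (rule conv_sum_right[OF b(1)[OF \<psi>(1)] b(2)[OF schwartz_partial[OF fs]]])
    also have "(\<lambda>i. conv (\<psi> n) (partial i (?f i))) = (\<lambda>i. conv (?f i) (partial i (\<psi> n)))"
      unfolding conv_partial_right[OF \<psi>(1) fs] by (intro ext conv_commute b \<psi> fs)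
    finally have "conv (\<Theta> j) (conv (dilate ?t (ift g)) (\<psi> n))
       = (\<lambda>x. \<Sum>i\<in>UNIV. of_real (1 / ?t) * conv (\<Theta> j) (conv (?f i) (partial i (\<psi> n))) x)"
      by (simp only:) (rule conv_sum_right[OF b(1)[OF \<Theta>] F(1)])
    then have "dist_conv U (conv (\<Theta> j) (conv (dilate ?t (ift g)) (\<psi> n))) x
       = (\<Sum>i\<in>UNIV. of_real (1 / ?t) * dist_conv U (conv (\<Theta> j) (conv (?f i) (partial i (\<psi> n)))) x)"
      by (simp only: dist_conv_sum[OF finite bdd_smooth_cmult[OF H]] dist_conv_cmult[OF H])
    also have "norm \<dots> \<le> (\<Sum>i\<in>UNIV. 1 / ?t * (D i * (E l j * B n / ?t ^ q)))"
    proof (rule sum_norm_le)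
      have t: "norm (complex_of_real (1 / ?t)) = 1 / ?t" by (simp add: norm_divide norm_power)
      show "norm (of_real (1 / ?t) * dist_conv U (conv (\<Theta> j) (conv (?f i) (partial i (\<psi> n)))) x) \<le> 1 / ?t * (D i * (E l j * B n / ?t ^ q))" for i
        unfolding norm_mult t by (intro mult_left_mono D(2) n) simp
    qed
    also have "\<dots> = (\<Sum>i\<in>UNIV. D i) * (E l j * B n / ?t ^ Suc q)"
      by (simp add: sum_distrib_left sum_distrib_right sum_divide_distrib mult_ac)
    finally show ?thesis .
  qed
  then show ?case using D(1) by (intro exI[of _ "\<Sum>i\<in>UNIV. D i"]) (auto intro: sum_nonneg)
qed

lemma powr_two_power: "((2::real) ^ l) powr s = 2 powr (real l * s)"
  by (simp add: powr_powr flip: powr_realpow)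

lemma two_power_power_eq_powr: "((2::real) ^ l) ^ k = 2 powr (real l * real k)"
  by (simp add: powr_realpow power_mult flip: of_nat_mult)

text \<open>A common dilation preserves the l1 norm, so the ratio of the two scales is all that
  matters.\<close>

lemma l1_conv_dilate_dilate:
  assumes f: "f \<in> schwartz" and g: "g \<in> schwartz" and "0 < a" "0 < c"
  shows "l1 (conv (dilate a f) (dilate c g)) = l1 (conv f (dilate (c / a) g))"
proof -
  note b = schwartz_bdd_smooth schwartz_integrable schwartz_dilate
  have ca: "c / a > 0" using assms by simp
  have "dilate c g = dilate a (dilate (c / a) g)" using assms by (simp add: dilate_dilate)
  then have "conv (dilate a f) (dilate c g) = dilate a (conv f (dilate (c / a) g))"
    by (simp only:) (intro conv_dilate b f g ca assms)
  then show ?thesis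
    by (simp only:) (intro l1_dilate integrable_conv b f g ca assms)
qed

text \<open>With n = 2^l R, the bound on k-th derivatives gives the piece at frequency 2^l the size
  2^(l s) / 2^(l k) = 2^(-\<beta> l), times the l1 norm \<open>E l j\<close> of the interaction with
  scale j. \<open>E\<close> decays in |l - j| faster than 2^(-\<beta> l) varies, so the sum is a
  multiple of 2^(-\<beta> j).\<close>

lemma (in bounded_functional) regularization_imp_zygmund_bound:
  fixes \<phi> \<theta> :: "real ^ 'd \<Rightarrow> complex" and s A :: real
  assumes \<phi>: "\<phi> \<in> schwartz" "(LINT x|lborel. \<phi> x) = 1"
    and \<theta>: "\<theta> \<in> schwartz" "\<And>m. mi_order m < r \<Longrightarrow> (LINT x|lborel. monomial m x *\<^sub>R \<theta> x) = 0"
    and r: "real k - s < real r"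
    and A: "\<And>w n x. length w = k \<Longrightarrow> n \<ge> 1 \<Longrightarrow> norm (dist_conv U (pderivs w (dilate (real n) \<phi>)) x) \<le> A * real n powr s"
  shows "\<exists>D. \<forall>j x. norm (dist_conv U (dilate (2 ^ j) \<theta>) x) \<le> D * 2 powr (- (real k - s) * real j)"
proof -
  define \<beta> where "\<beta> = real k - s"
  note b = schwartz_bdd_smooth schwartz_integrable schwartz_dilate
  obtain \<Phi> :: "real ^ 'd \<Rightarrow> complex" and g where \<Phi>: "\<Phi> \<in> schwartz" "(LINT x|lborel. \<Phi> x) = 1"
    and g: "g \<in> annular (1 / 2) 2" "ift g = (\<lambda>x. \<Phi> x - dilate (1 / 2) \<Phi> x)"
    using littlewood_paley_functions[of 1 2] by auto
  \<comment> \<open>The transform of \<phi> is 1 at the origin, hence nonzero nearby; division by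
    \<open>R\<close> brings the ball of radius 2, which contains the annulus, into that
    neighbourhood. \<open>R\<close> is an integer so that 2^l R is an index of the regularization
    sequence.\<close>
  obtain R :: nat where R: "R \<ge> 1" "\<And>u. norm u \<le> 2 \<Longrightarrow> fourier \<phi> ((1 / real R) *\<^sub>R u) \<noteq> 0"
  proof -
    have "isCont (fourier \<phi>) 0"
      using smooth_continuous[OF fourier_smooth[OF \<phi>(1)], of UNIV] by (simp add: continuous_on_eq_continuous_at)
    moreover have "fourier \<phi> 0 = 1" using \<phi>(2) by (simp add: fourier_def)
    ultimately obtain d where d: "d > 0" "\<And>v. dist v 0 < d \<Longrightarrow> dist (fourier \<phi> v) 1 < 1"
      unfolding continuous_at_eps_delta by (metis zero_less_one)
    obtain R :: nat where R: "2 / d < real R" using reals_Archimedean2 by blast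
    have "0 < 2 / d" using d(1) by simp
    then have R0: "0 < real R" using R by linarith
    show ?thesis
    proof
      show "R \<ge> 1" using R0 by simp
      show "fourier \<phi> ((1 / real R) *\<^sub>R u) \<noteq> 0" if "norm u \<le> 2" for u
      proof -
        have "2 < d * real R" using R d(1) by (simp add: divide_less_eq mult.commute)
        then have "norm u < d * real R" using that by linarith
        then have "dist ((1 / real R) *\<^sub>R u) 0 < d" using R0 by (simp add: divide_less_eq)
        from d(2)[OF this] show ?thesis by auto
      qed
    qed
  qed
  have R0: "0 < real R" using R(1) by simp
  define h where "h = fourier (dilate (real R) \<phi>)"
  have hs: "h \<in> smooth UNIV" unfolding h_def by (intro fourier_smooth b \<phi> R0)
  have hnz: "h u \<noteq> 0" if "norm u \<le> 2" for u
    unfolding h_def fourier_dilate[OF schwartz_integrable[OF \<phi>(1)] R0] by (rule R(2)[OF that])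
  define g1 where "g1 u = g u * inverse (h u)" for u
  have g1: "g1 \<in> annular (1 / 2) 2" "\<And>u. g1 u * h u = g u"
    unfolding g1_def using annular_divide[OF g(1) hs hnz] by auto
  note g1s = ift_schwartz[OF annular_schwartz[OF g1(1)]]
  have "conv (ift g1) (dilate (real R) \<phi>) = ift g"
    using conv_ift[OF annular_schwartz[OF g1(1)] b(3)[OF \<phi>(1) R0]] g1(2) by (simp add: h_def)
  then have \<Delta>: "dilate (2 ^ l) (ift g) = conv (dilate (2 ^ l) (ift g1)) (dilate (real (2 ^ l * R)) \<phi>)" for l
    using conv_dilate[OF b(1)[OF g1s] b(2)[OF b(3)[OF \<phi>(1) R0]], of "2 ^ l"] by (simp add: dilate_dilate)
  \<comment> \<open>If \<beta> is negative, 2^(-\<beta> l) grows for l > j; \<open>M\<close>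
    derivatives outweigh this growth.\<close>
  obtain M :: nat where M: "- \<beta> < real M" using reals_Archimedean2 by blast
  \<comment> \<open>The smaller of the surplus decay rates on the two sides of j.\<close>
  define \<delta> where "\<delta> = min (real r - \<beta>) (real M + \<beta>)"
  have \<delta>: "\<delta> > 0" "\<delta> \<le> real r - \<beta>" "\<delta> \<le> real M + \<beta>" using r M by (auto simp: \<delta>_def \<beta>_def)
  define \<rho> where "\<rho> = (2::real) powr (- \<delta>)"
  have \<rho>: "0 < \<rho>" "\<rho> < 1" using \<delta>(1) by (auto simp: \<rho>_def powr_less_one)
  have \<rho>_pow: "\<rho> ^ n = 2 powr (- \<delta> * real n)" for n
    by (simp add: \<rho>_def powr_power mult.commute)
  \<comment> \<open>The moments of \<theta> act where \<theta> is the finer of the two functions,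
    the derivatives of the annular function where that one is.\<close>
  define E where "E l j = (if l \<le> j then 1 / (2 ^ (j - l)) ^ r else 1 / (2 ^ (l - j)) ^ M :: real)" for l j :: nat
  have E0: "0 \<le> E l j" for l j by (simp add: E_def)
  have E1: "E l j * 2 powr (- \<beta> * real l) \<le> 2 powr (- \<beta> * real j) * \<rho> ^ (if l \<le> j then j - l else l - j)" for l j
  proof (cases "l \<le> j")
    case True
    have "E l j * 2 powr (- \<beta> * real l) = 2 powr (- (real (j - l) * real r) + - \<beta> * real l)"
      using True by (simp only: E_def if_True two_power_power_eq_powr powr_add powr_minus divide_inverse mult_1_left)
    also have "\<dots> = 2 powr (- \<beta> * real j + - (real r - \<beta>) * real (j - l))"
      using True by (simp add: of_nat_diff algebra_simps)
    also have "\<dots> \<le> 2 powr (- \<beta> * real j + - \<delta> * real (j - l))"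
      using \<delta>(2) by (intro powr_mono add_left_mono mult_right_mono) auto
    finally show ?thesis using True by (simp only: powr_add \<rho>_pow if_True)
  next
    case False
    have "E l j * 2 powr (- \<beta> * real l) = 2 powr (- (real (l - j) * real M) + - \<beta> * real l)"
      using False by (simp only: E_def if_False two_power_power_eq_powr powr_add powr_minus divide_inverse mult_1_left)
    also have "\<dots> = 2 powr (- \<beta> * real j + - (real M + \<beta>) * real (l - j))"
      using False by (simp add: of_nat_diff algebra_simps)
    also have "\<dots> \<le> 2 powr (- \<beta> * real j + - \<delta> * real (l - j))"
      using \<delta>(3) by (intro powr_mono add_left_mono mult_right_mono) auto
    finally show ?thesis using False by (simp only: powr_add \<rho>_pow if_False)
  qed
  have E2: "\<exists>D\<ge>0. \<forall>l j. l1 (conv (dilate (2 ^ j) \<theta>) (dilate (2 ^ l) (ift f))) \<le> D * E l j"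
    if f: "f \<in> annular (1 / 2) 2" for f
  proof -
    note fs = ift_schwartz[OF annular_schwartz[OF f]]
    obtain D1 where D1: "D1 \<ge> 0" "\<And>t. t \<ge> 1 \<Longrightarrow> l1 (conv (ift f) (dilate t \<theta>)) \<le> D1 / t ^ r"
      using l1_conv_moment_decay[where r = r, OF \<theta> fs] by auto
    obtain D2 where D2: "D2 \<ge> 0" "\<And>t. t > 0 \<Longrightarrow> l1 (conv \<theta> (dilate t (ift f))) \<le> D2 / t ^ M"
      using l1_conv_annular_decay[OF f _ \<theta>(1), of M] by auto
    have "l1 (conv (dilate (2 ^ j) \<theta>) (dilate (2 ^ l) (ift f))) \<le> max D1 D2 * E l j" for l j
    proof (cases "l \<le> j")
      case True
      have "conv (dilate (2 ^ j) \<theta>) (dilate (2 ^ l) (ift f)) = conv (dilate (2 ^ l) (ift f)) (dilate (2 ^ j) \<theta>)"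
        by (intro conv_commute b \<theta> fs) auto
      then have "l1 (conv (dilate (2 ^ j) \<theta>) (dilate (2 ^ l) (ift f))) = l1 (conv (ift f) (dilate (2 ^ j / 2 ^ l) \<theta>))"
        using l1_conv_dilate_dilate[OF fs \<theta>(1), of "2 ^ l" "2 ^ j"] by simp
      also have "(2::real) ^ j / 2 ^ l = 2 ^ (j - l)" using True by (simp add: power_diff)
      also have "l1 (conv (ift f) (dilate (2 ^ (j - l)) \<theta>)) \<le> D1 / (2 ^ (j - l)) ^ r"
        by (rule D1(2)) simp
      also have "\<dots> \<le> max D1 D2 / (2 ^ (j - l)) ^ r" by (intro divide_right_mono) auto
      finally show ?thesis using True by (simp add: E_def)
    next
      case False
      have "l1 (conv (dilate (2 ^ j) \<theta>) (dilate (2 ^ l) (ift f))) = l1 (conv \<theta> (dilate (2 ^ l / 2 ^ j) (ift f)))"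
        using l1_conv_dilate_dilate[OF \<theta>(1) fs, of "2 ^ j" "2 ^ l"] by simp
      also have "(2::real) ^ l / 2 ^ j = 2 ^ (l - j)" using False by (simp add: power_diff)
      also have "l1 (conv \<theta> (dilate (2 ^ (l - j)) (ift f))) \<le> D2 / (2 ^ (l - j)) ^ M"
        by (rule D2(2)) simp
      also have "\<dots> \<le> max D1 D2 / (2 ^ (l - j)) ^ M" by (intro divide_right_mono) auto
      finally show ?thesis using False by (simp add: E_def)
    qed
    then show ?thesis using D1(1) by (intro exI[of _ "max D1 D2"]) auto
  qed
  have "\<exists>D\<ge>0. \<forall>l j n x. n \<ge> 1 \<longrightarrow> norm (dist_conv U (conv (dilate (2 ^ j) \<theta>) (conv (dilate (2 ^ l) (ift g1)) (dilate (real n) \<phi>))) x)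
     \<le> D * (E l j * (A * real n powr s) / (2 ^ l) ^ k)"
    by (rule annular_derivative_bound[where a = "1 / 2" and b = 2, OF _ _ E2 E0 g1(1)])
      (auto intro: b \<phi> \<theta> A)
  then obtain D where D: "D \<ge> 0" "\<And>l j n x. n \<ge> 1 \<Longrightarrow>
     norm (dist_conv U (conv (dilate (2 ^ j) \<theta>) (conv (dilate (2 ^ l) (ift g1)) (dilate (real n) \<phi>))) x)
     \<le> D * (E l j * (A * real n powr s) / (2 ^ l) ^ k)"
    by metis
  have A0: "0 \<le> A"
  proof -
    have "0 \<le> A * real 1 powr s"
      by (rule order_trans[OF norm_ge_zero A[of "replicate k undefined" 1 0]]) auto
    then show ?thesis by simp
  qed
  have "\<forall>w. \<exists>D\<ge>0. \<forall>t\<ge>1. \<forall>x. norm (conv (pderivs w \<Phi>) (dilate t \<theta>) x) \<le> D / t ^ r / (1 + norm x) ^ 0"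
    by (intro allI conv_moment_decay[where r = r] \<theta> schwartz_pderivs \<Phi>)
  then obtain Dw where Dw: "\<And>w. Dw w \<ge> 0" "\<And>w t x. t \<ge> 1 \<Longrightarrow> norm (conv (pderivs w \<Phi>) (dilate t \<theta>) x) \<le> Dw w / t ^ r"
    by (simp only: power_0 div_by_1) metis
  define D0 where "D0 = (\<Sum>w\<in>{w. length w \<le> N}. Dw w)"
  have fin: "finite {w :: 'd list. length w \<le> N}"
    using finite_lists_length_le[OF finite_class.finite_UNIV, of N] by simp
  have D0: "Dw w \<le> D0" if "length w \<le> N" for w
    unfolding D0_def using that Dw(1) by (intro member_le_sum fin) auto
  have D0': "D0 \<ge> 0" unfolding D0_def by (intro sum_nonneg Dw)
  let ?B = "D * A * real R powr s * (2 / (1 - \<rho>))"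
  have "norm (dist_conv U (dilate (2 ^ j) \<theta>) x) \<le> (C * D0 + ?B) * 2 powr (- (real k - s) * real j)" for j x
  proof -
    let ?\<theta> = "dilate (2 ^ j) \<theta>"
    have \<theta>j: "?\<theta> \<in> schwartz" by (intro b \<theta>) auto
    have "norm (dist_conv U ?\<theta> x) \<le> C * (D0 / (2 ^ j) ^ r) + ?B * 2 powr (- \<beta> * real j)"
    proof (rule littlewood_paley_bound[OF b(1)[OF \<theta>j] \<Phi> g(2)])
      fix x
      \<comment> \<open>After the swap the derivatives taken by \<open>U\<close> fall on \<Phi>,
        which is independent of j; the moments of \<theta> then give 2^(-j r), and r >
        \<beta>.\<close>
      have eq: "conv ?\<theta> \<Phi> = conv \<Phi> ?\<theta>" by (intro conv_commute b(1,2) \<theta>j \<Phi>)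
      show "norm (dist_conv U (conv ?\<theta> \<Phi>) x) \<le> C * (D0 / (2 ^ j) ^ r)"
        unfolding eq
      proof (rule dist_conv_bound)
        show "conv \<Phi> ?\<theta> \<in> bdd_smooth" by (intro conv_bdd_smooth b(1,2) \<theta>j \<Phi>)
        show "0 \<le> D0 / (2 ^ j) ^ r" using D0' by simp
        fix w :: "'d list" and z assume w: "length w \<le> N"
        have "norm (conv (pderivs w \<Phi>) ?\<theta> z) \<le> Dw w / (2 ^ j) ^ r" by (rule Dw(2)) simp
        also have "\<dots> \<le> D0 / (2 ^ j) ^ r" by (intro divide_right_mono D0 w) simp
        finally show "norm (pderivs w (conv \<Phi> ?\<theta>) z) \<le> D0 / (2 ^ j) ^ r"
          by (simp add: pderivs_conv b(1,2) \<theta>j \<Phi>)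
      qed
    next
      fix l x
      show "norm (dist_conv U (conv ?\<theta> (dilate (2 ^ l) (ift g))) x)
        \<le> D * A * real R powr s * 2 powr (- \<beta> * real j) * \<rho> ^ (if l \<le> j then j - l else l - j)"
      proof -
        have "norm (dist_conv U (conv ?\<theta> (dilate (2 ^ l) (ift g))) x) \<le> D * (E l j * (A * real (2 ^ l * R) powr s) / (2 ^ l) ^ k)"
          unfolding \<Delta> using R(1) by (intro D(2)) simp
        also have "\<dots> = D * A * real R powr s * (E l j * ((2 ^ l) powr s / (2 ^ l) ^ k))"
          by (simp add: powr_mult)
        also have "(2 ^ l) powr s / (2 ^ l) ^ k = 2 powr (- \<beta> * real l)"
          unfolding powr_two_power two_power_power_eq_powr by (simp add: \<beta>_def algebra_simps flip: powr_diff)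
        also have "D * A * real R powr s * (E l j * 2 powr (- \<beta> * real l))
          \<le> D * A * real R powr s * (2 powr (- \<beta> * real j) * \<rho> ^ (if l \<le> j then j - l else l - j))"
          using D(1) A0 by (intro mult_left_mono E1) auto
        finally show ?thesis by (simp only: mult.assoc)
      qed
    next
      fix L
      have "(\<Sum>l=1..L. D * A * real R powr s * 2 powr (- \<beta> * real j) * \<rho> ^ (if l \<le> j then j - l else l - j))
        = D * A * real R powr s * 2 powr (- \<beta> * real j) * (\<Sum>l=1..L. \<rho> ^ (if l \<le> j then j - l else l - j))"
        by (simp only: sum_distrib_left)
      also have "\<dots> \<le> D * A * real R powr s * 2 powr (- \<beta> * real j) * (2 / (1 - \<rho>))"
        using D(1) A0 by (intro mult_left_mono two_sided_geometric_sum_le \<rho>) auto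
      finally show "(\<Sum>l=1..L. D * A * real R powr s * 2 powr (- \<beta> * real j) * \<rho> ^ (if l \<le> j then j - l else l - j))
        \<le> ?B * 2 powr (- \<beta> * real j)"
        by (simp only: mult_ac)
    qed
    moreover have "C * (D0 / (2 ^ j) ^ r) \<le> C * D0 * 2 powr (- \<beta> * real j)"
    proof -
      have "1 / (2 ^ j) ^ r = 2 powr (- (real j * real r))"
        by (simp add: two_power_power_eq_powr powr_minus divide_inverse)
      also have "\<dots> \<le> 2 powr (- \<beta> * real j)"
        using r mult_right_mono[of \<beta> "real r" "real j"] by (intro powr_mono) (auto simp: \<beta>_def algebra_simps)
      finally have "C * D0 * (1 / (2 ^ j) ^ r) \<le> C * D0 * 2 powr (- \<beta> * real j)"
        using C_nonneg D0' by (intro mult_left_mono) auto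
      then show ?thesis by simp
    qed
    ultimately show ?thesis by (simp add: distrib_right flip: \<beta>_def)
  qed
  then show ?thesis by blast
qed

text \<open>The piece at frequency 2^l is bounded by the seminorm of \<theta> at that scale times
  the l1 norm of a derivative of \<phi>_n convolved with \<kappa>_l. This norm is estimated in two
  ways, according to whether 2^l is below or above n.\<close>

lemma (in bounded_functional) zygmund_imp_regularization_bound:
  fixes \<phi> \<theta> :: "real ^ 'd \<Rightarrow> complex" and s A \<epsilon> :: real
  assumes \<phi>: "\<phi> \<in> schwartz" and \<theta>: "\<theta> \<in> schwartz"
    and \<epsilon>: "\<epsilon> > 0" "\<And>u. \<epsilon> / 2 \<le> norm u \<Longrightarrow> norm u \<le> 2 * \<epsilon> \<Longrightarrow> fourier \<theta> u \<noteq> 0"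
    and A: "\<And>j x. j \<ge> 1 \<Longrightarrow> norm (dist_conv U (dilate (2 ^ j) \<theta>) x) \<le> A * 2 powr (- (real k - s) * real j)"
    and s: "s > 0" and w: "length w \<le> k"
  shows "\<exists>D. \<forall>n\<ge>1. \<forall>x. norm (dist_conv U (pderivs w (dilate (real n) \<phi>)) x) \<le> D * real n powr s"
proof -
  define \<beta> where "\<beta> = real k - s"
  note b = schwartz_bdd_smooth schwartz_integrable schwartz_dilate schwartz_pderivs
  obtain \<Phi> :: "real ^ 'd \<Rightarrow> complex" and g where \<Phi>: "\<Phi> \<in> schwartz" "(LINT x|lborel. \<Phi> x) = 1"
    and g: "g \<in> annular (\<epsilon> / 2) (2 * \<epsilon>)" "ift g = (\<lambda>x. \<Phi> x - dilate (1 / 2) \<Phi> x)"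
    using littlewood_paley_functions[of \<epsilon> "2 * \<epsilon>"] \<epsilon>(1) by auto
  define g2 where "g2 u = g u * inverse (fourier \<theta> u)" for u
  have g2: "g2 \<in> annular (\<epsilon> / 2) (2 * \<epsilon>)" "\<And>u. g2 u * fourier \<theta> u = g u"
    unfolding g2_def using annular_divide[OF g(1) fourier_smooth[OF \<theta>] \<epsilon>(2)] by auto
  define \<kappa> where "\<kappa> = ift g2"
  have \<kappa>: "\<kappa> \<in> schwartz" unfolding \<kappa>_def by (intro ift_schwartz annular_schwartz[OF g2(1)])
  have "conv \<kappa> \<theta> = ift g"
    using conv_ift[OF annular_schwartz[OF g2(1)] \<theta>] g2(2) by (simp add: \<kappa>_def)
  then have \<Delta>: "dilate (2 ^ l) (ift g) = conv (dilate (2 ^ l) \<kappa>) (dilate (2 ^ l) \<theta>)" for l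
    using conv_dilate[OF b(1)[OF \<kappa>] b(2)[OF \<theta>], of "2 ^ l"] by simp
  obtain M :: nat where M: "- \<beta> < real M" using reals_Archimedean2 by blast
  \<comment> \<open>Relative to n^s, the terms decay like 2^(-s (j-l)) below j and like 2^(-(M +
    \<beta>) (l-j)) above.\<close>
  define \<delta> where "\<delta> = min s (real M + \<beta>)"
  have \<delta>: "\<delta> > 0" "\<delta> \<le> s" "\<delta> \<le> real M + \<beta>" using s M by (auto simp: \<delta>_def)
  define \<rho> where "\<rho> = (2::real) powr (- \<delta>)"
  have \<rho>: "0 < \<rho>" "\<rho> < 1" using \<delta>(1) by (auto simp: \<rho>_def powr_less_one)
  have \<rho>_pow: "\<rho> ^ n = 2 powr (- \<delta> * real n)" for n
    by (simp add: \<rho>_def powr_power mult.commute)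
  \<comment> \<open>For 2^l below n all derivatives are moved onto \<kappa>; its dilation then costs
    2^l for each of them.\<close>
  define D1 where "D1 = l1 \<phi> * l1 (pderivs w \<kappa>)"
  have D1: "D1 \<ge> 0" by (simp add: D1_def l1_nonneg)
  obtain D2 where D2: "D2 \<ge> 0" "\<And>t. t > 0 \<Longrightarrow> l1 (conv (pderivs w \<phi>) (dilate t \<kappa>)) \<le> D2 / t ^ M"
    using l1_conv_annular_decay[OF g2(1) _ b(4)[OF \<phi>], of w M] \<epsilon>(1) unfolding \<kappa>_def by auto
  \<comment> \<open>The power of 2 stems from n \<le> 2^(j+1): j is merely the integer part of the
    binary logarithm of n.\<close>
  define D3 where "D3 = max D1 (D2 * 2 powr (real M + \<beta>))"
  have D3: "D3 \<ge> 0" "D1 \<le> D3" "D2 * 2 powr (real M + \<beta>) \<le> D3" using D1 by (auto simp: D3_def)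
  have A0: "0 \<le> A"
  proof -
    have "0 \<le> A * 2 powr (- (real k - s) * real 1)"
      by (rule order_trans[OF norm_ge_zero A[of 1 0]]) simp
    then show ?thesis by (simp add: zero_le_mult_iff)
  qed
  let ?\<phi> = "\<lambda>n. dilate (real n) \<phi>"
  have l1_low: "l1 (conv (pderivs w (?\<phi> n)) (dilate (2 ^ l) \<kappa>)) \<le> D1 * (2 ^ l) ^ length w" if n: "n \<ge> 1" for n l :: nat
  proof -
    have \<phi>n: "?\<phi> n \<in> schwartz" using n by (intro b \<phi>) simp
    have \<kappa>l: "dilate (2 ^ l) \<kappa> \<in> schwartz" by (intro b \<kappa>) simp
    have "l1 (conv (pderivs w (?\<phi> n)) (dilate (2 ^ l) \<kappa>)) = l1 (conv (?\<phi> n) (pderivs w (dilate (2 ^ l) \<kappa>)))"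
      by (simp only: conv_pderivs_right[OF \<phi>n \<kappa>l])
    also have "\<dots> \<le> l1 (?\<phi> n) * l1 (pderivs w (dilate (2 ^ l) \<kappa>))"
      by (intro integrable_conv b \<phi>n \<kappa>l)
    also have "l1 (?\<phi> n) = l1 \<phi>" using n by (intro l1_dilate b \<phi>) simp
    also have "l1 (pderivs w (dilate (2 ^ l) \<kappa>)) = (2 ^ l) ^ length w * l1 (pderivs w \<kappa>)"
      unfolding pderivs_dilate[OF schwartz_smooth[OF \<kappa>]] l1_cmult
      by (subst l1_dilate) (auto intro: b \<kappa> simp: norm_power)
    finally show ?thesis by (simp add: D1_def mult_ac)
  qed
  \<comment> \<open>For 2^l above n the derivatives stay on \<phi>_n, and beyond the factor n for
    each of them the ratio of the scales decides.\<close>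
  have l1_high: "l1 (conv (pderivs w (?\<phi> n)) (dilate (2 ^ l) \<kappa>)) \<le> D2 * real n ^ length w * (real n / 2 ^ l) ^ M" if n: "n \<ge> 1" for n l :: nat
  proof -
    have n0: "0 < real n" using n by simp
    have dn: "dilate (real n) (pderivs w \<phi>) \<in> schwartz" by (intro b \<phi> n0)
    have \<kappa>l: "dilate (2 ^ l) \<kappa> \<in> schwartz" by (intro b \<kappa>) simp
    have "conv (pderivs w (?\<phi> n)) (dilate (2 ^ l) \<kappa>) = (\<lambda>x. of_real (real n) ^ length w * conv (dilate (real n) (pderivs w \<phi>)) (dilate (2 ^ l) \<kappa>) x)"
      unfolding pderivs_dilate[OF schwartz_smooth[OF \<phi>]] by (simp add: conv_def fun_eq_iff mult.assoc)
    then have "l1 (conv (pderivs w (?\<phi> n)) (dilate (2 ^ l) \<kappa>)) = real n ^ length w * l1 (conv (dilate (real n) (pderivs w \<phi>)) (dilate (2 ^ l) \<kappa>))"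
      by (simp only: l1_cmult norm_power norm_of_real abs_of_nat)
    also have "l1 (conv (dilate (real n) (pderivs w \<phi>)) (dilate (2 ^ l) \<kappa>)) = l1 (conv (pderivs w \<phi>) (dilate (2 ^ l / real n) \<kappa>))"
      by (intro l1_conv_dilate_dilate b \<phi> \<kappa> n0) simp
    also have "\<dots> \<le> D2 / (2 ^ l / real n) ^ M" using n0 by (intro D2(2)) simp
    finally show ?thesis using n0 by (simp add: power_divide mult_ac mult_left_mono)
  qed
  have main: "norm (dist_conv U (pderivs w (?\<phi> n)) x) \<le> P * l1 \<phi> + A * D3 * real n powr s * (2 / (1 - \<rho>))"
    if n: "n \<ge> 1" and P: "\<And>x. norm (dist_conv U (pderivs w \<Phi>) x) \<le> P" for n x P
  proof -
    have n0: "0 < real n" using n by simp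
    have \<phi>n: "?\<phi> n \<in> schwartz" by (intro b \<phi> n0)
    obtain j where j: "2 ^ j \<le> n" "n < 2 ^ (j + 1)"
      using ex_power_ivl1[of 2 n] n by auto
    have jn: "2 ^ j \<le> real n" "real n \<le> 2 ^ (j + 1)"
      using j by (metis of_nat_le_iff of_nat_numeral of_nat_power, metis less_imp_le of_nat_le_iff of_nat_numeral of_nat_power)
    show ?thesis
    proof (rule littlewood_paley_bound[OF b(1)[OF b(4)[OF \<phi>n]] \<Phi> g(2)])
      fix x
      have "conv (pderivs w (?\<phi> n)) \<Phi> = conv (?\<phi> n) (pderivs w \<Phi>)"
        by (rule conv_pderivs_right[symmetric, OF \<phi>n \<Phi>(1)])
      also have "\<dots> = conv (pderivs w \<Phi>) (?\<phi> n)"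
        by (intro conv_commute b(1,2,4) \<phi>n \<Phi>)
      finally have "norm (dist_conv U (conv (pderivs w (?\<phi> n)) \<Phi>) x) \<le> P * l1 (?\<phi> n)"
        unfolding l1_def by (simp only:) (intro dist_conv_conv_bound b(1,2,4) \<phi>n \<Phi> P)
      then show "norm (dist_conv U (conv (pderivs w (?\<phi> n)) \<Phi>) x) \<le> P * l1 \<phi>"
        using n0 by (simp add: l1_dilate b \<phi>)
    next
      fix l :: nat and x assume l: "l \<ge> 1"
      let ?\<kappa> = "dilate (2 ^ l) \<kappa>" and ?\<theta> = "dilate (2 ^ l) \<theta>"
      have \<kappa>l: "?\<kappa> \<in> schwartz" "?\<theta> \<in> schwartz" by (intro b \<kappa> \<theta>; simp)+
      have "conv (pderivs w (?\<phi> n)) (dilate (2 ^ l) (ift g)) = conv ?\<theta> (conv (pderivs w (?\<phi> n)) ?\<kappa>)"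
        unfolding \<Delta> by (intro conv_rotate b(1,2,4) \<phi>n \<kappa>l)
      then have 1: "norm (dist_conv U (conv (pderivs w (?\<phi> n)) (dilate (2 ^ l) (ift g))) x)
         \<le> (A * 2 powr (- (real k - s) * real l)) * l1 (conv (pderivs w (?\<phi> n)) ?\<kappa>)"
        unfolding l1_def by (simp only:) (intro dist_conv_conv_bound integrable_conv b(1,2,4) \<phi>n \<kappa>l A l)
      have 2: "2 powr (- \<beta> * real l) * l1 (conv (pderivs w (?\<phi> n)) ?\<kappa>) \<le> D3 * (real n powr s * \<rho> ^ (if l \<le> j then j - l else l - j))"
      proof (cases "l \<le> j")
        case True
        have "2 powr (- \<beta> * real l) * l1 (conv (pderivs w (?\<phi> n)) ?\<kappa>) \<le> 2 powr (- \<beta> * real l) * (D1 * (2 ^ l) ^ k)"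
          by (intro mult_left_mono order_trans[OF l1_low[OF n]] power_increasing w D1) auto
        also have "\<dots> = D1 * 2 powr (s * real l)"
          unfolding two_power_power_eq_powr by (simp add: \<beta>_def algebra_simps flip: powr_add)
        also have "2 powr (s * real l) = (2 ^ j) powr s * 2 powr (- s * real (j - l))"
          unfolding powr_two_power using True by (simp add: of_nat_diff algebra_simps flip: powr_add)
        also have "D1 * ((2 ^ j) powr s * 2 powr (- s * real (j - l))) \<le> D3 * (real n powr s * 2 powr (- \<delta> * real (j - l)))"
          using jn(1) s \<delta>(2) D1 D3 by (intro mult_mono powr_mono2 powr_mono mult_right_mono) auto
        finally show ?thesis using True by (simp only: \<rho>_pow if_True)
      next
        case False
        have n1: "1 \<le> real n" using n by simp
        have "2 powr (- \<beta> * real l) * l1 (conv (pderivs w (?\<phi> n)) ?\<kappa>) \<le> 2 powr (- \<beta> * real l) * (D2 * real n ^ k * (real n / 2 ^ l) ^ M)"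
          by (intro mult_left_mono order_trans[OF l1_high[OF n]] mult_right_mono power_increasing w D2 n1) auto
        also have "\<dots> = D2 * (real n powr s * (real n powr (real M + \<beta>) * 2 powr (- (real M + \<beta>) * real l)))"
        proof -
          have "real n ^ k * (real n / 2 ^ l) ^ M = real n powr (real k + real M) * 2 powr (- (real l * real M))"
            unfolding power_divide two_power_power_eq_powr
            using n0 by (simp add: powr_add powr_realpow powr_minus divide_inverse)
          moreover have "real n powr (real k + real M) = real n powr s * real n powr (real M + \<beta>)"
            by (simp add: \<beta>_def add.commute flip: powr_add)
          moreover have "2 powr (- \<beta> * real l) * 2 powr (- (real l * real M)) = 2 powr (- (real M + \<beta>) * real l)"
            by (simp add: algebra_simps flip: powr_add)
          ultimately show ?thesis by (simp add: mult_ac)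
        qed
        also have "real n powr (real M + \<beta>) \<le> (2 ^ (j + 1)) powr (real M + \<beta>)"
          using jn(2) M by (intro powr_mono2) auto
        also have "(2 ^ (j + 1)) powr (real M + \<beta>) * 2 powr (- (real M + \<beta>) * real l) = 2 powr (real M + \<beta>) * 2 powr (- (real M + \<beta>) * real (l - j))"
          unfolding powr_two_power using False by (simp add: of_nat_diff algebra_simps flip: powr_add)
        also have "D2 * (real n powr s * (2 powr (real M + \<beta>) * 2 powr (- (real M + \<beta>) * real (l - j))))
          = (D2 * 2 powr (real M + \<beta>)) * (real n powr s * 2 powr (- (real M + \<beta>) * real (l - j)))" by (simp only: mult_ac)
        also have "\<dots> \<le> D3 * (real n powr s * 2 powr (- \<delta> * real (l - j)))"
        proof -
          have "2 powr (- (real M + \<beta>) * real (l - j)) \<le> 2 powr (- \<delta> * real (l - j))"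
            using \<delta>(3) by (intro powr_mono mult_right_mono) auto
          then show ?thesis using D3 by (intro mult_mono mult_left_mono) auto
        qed
        finally show ?thesis using False D2(1) by (simp only: \<rho>_pow if_False) (simp add: mult_left_mono mult_right_mono)
      qed
      show "norm (dist_conv U (conv (pderivs w (?\<phi> n)) (dilate (2 ^ l) (ift g))) x)
        \<le> A * D3 * real n powr s * \<rho> ^ (if l \<le> j then j - l else l - j)"
        using order_trans[OF 1[folded \<beta>_def, unfolded mult.assoc] mult_left_mono[OF 2 A0]] by (simp only: mult.assoc)
    next
      fix L
      have "(\<Sum>l=1..L. A * D3 * real n powr s * \<rho> ^ (if l \<le> j then j - l else l - j))
        = A * D3 * real n powr s * (\<Sum>l=1..L. \<rho> ^ (if l \<le> j then j - l else l - j))"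
        by (simp only: sum_distrib_left)
      also have "\<dots> \<le> A * D3 * real n powr s * (2 / (1 - \<rho>))"
        using A0 D3 by (intro mult_left_mono two_sided_geometric_sum_le \<rho>) auto
      finally show "(\<Sum>l=1..L. A * D3 * real n powr s * \<rho> ^ (if l \<le> j then j - l else l - j)) \<le> A * D3 * real n powr s * (2 / (1 - \<rho>))" .
    qed
  qed
  obtain P where P: "P \<ge> 0" "\<And>x. norm (dist_conv U (pderivs w \<Phi>) x) \<le> P"
    using dist_conv_lipschitz[OF b(1)[OF b(4)[OF \<Phi>(1)]]] by metis
  have "norm (dist_conv U (pderivs w (?\<phi> n)) x) \<le> (P * l1 \<phi> + A * D3 * (2 / (1 - \<rho>))) * real n powr s" if n: "n \<ge> 1" for n x
  proof -
    \<comment> \<open>The low frequency term is bounded in n, and n^s \<ge> 1 absorbs it.\<close>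
    have "1 \<le> real n powr s" using n s by (intro ge_one_powr_ge_zero) auto
    then have "P * l1 \<phi> * 1 \<le> P * l1 \<phi> * real n powr s"
      using P(1) by (intro mult_left_mono) (auto simp: l1_nonneg)
    with main[OF n P(2), of x] show ?thesis by (simp add: algebra_simps)
  qed
  then show ?thesis by blast
qed

subsection \<open>Compactly supported distributions\<close>

text \<open>At distance \<epsilon> from \<open>K\<close> the argument of \<phi> has size at least n
  \<epsilon>, so decay of order q cancels the factor n^q that differentiation and normalization
  produce.\<close>

lemma (in bounded_functional) dilate_bound_away_from_support:
  fixes \<phi> :: "real ^ 'd \<Rightarrow> complex"
  assumes \<phi>: "\<phi> \<in> schwartz" and \<epsilon>: "\<epsilon> > 0"
  shows "\<exists>D\<ge>0. \<forall>n\<ge>1. \<forall>x. (\<forall>y\<in>K. \<epsilon> \<le> norm (x - y)) \<longrightarrow> norm (dist_conv U (pderivs w (dilate (real n) \<phi>)) x) \<le> D"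
proof -
  \<comment> \<open>One power of n for each derivative in \<open>w @ v\<close>, and d powers from
    the normalization in \<open>dilate\<close>.\<close>
  define q where "q v = length (w @ v) + CARD('d)" for v :: "'d list"
  have "\<forall>v. \<exists>B\<ge>0. \<forall>z. norm (pderivs (w @ v) \<phi> z) \<le> B / (1 + norm z) ^ q v"
    using schwartz_decay[OF \<phi>] by metis
  then obtain B where B: "\<And>v. B v \<ge> 0" "\<And>v z. norm (pderivs (w @ v) \<phi> z) \<le> B v / (1 + norm z) ^ q v"
    by metis
  define D where "D = (\<Sum>v\<in>{v. length v \<le> N}. B v * (1 / \<epsilon>) ^ q v)"
  have fin: "finite {v :: 'd list. length v \<le> N}"
    using finite_lists_length_le[OF finite_class.finite_UNIV, of N] by simp
  have D: "D \<ge> 0" unfolding D_def using \<epsilon> by (intro sum_nonneg mult_nonneg_nonneg B) auto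
  have "norm (dist_conv U (pderivs w (dilate (real n) \<phi>)) x) \<le> C * D"
    if n: "n \<ge> 1" and x: "\<forall>y\<in>K. \<epsilon> \<le> norm (x - y)" for n x
  proof (rule dist_conv_bound_on[OF _ D])
    have n0: "0 < real n" using n by simp
    show "pderivs w (dilate (real n) \<phi>) \<in> bdd_smooth"
      by (intro schwartz_bdd_smooth schwartz_pderivs schwartz_dilate \<phi> n0)
    fix v :: "'d list" and y assume v: "length v \<le> N" and y: "y \<in> K"
    define z where "z = x - y"
    have z: "\<epsilon> \<le> norm z" using x y by (simp add: z_def)
    have ratio: "real n / (1 + norm (real n *\<^sub>R z)) \<le> 1 / \<epsilon>"
    proof -
      have "real n * \<epsilon> \<le> real n * norm z" using z by (intro mult_left_mono) auto
      then have "real n * \<epsilon> \<le> 1 + norm (real n *\<^sub>R z)" by simp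
      then show ?thesis using \<epsilon> by (simp add: divide_simps add_pos_nonneg)
    qed
    have "norm (pderivs v (pderivs w (dilate (real n) \<phi>)) z) = real n ^ q v * norm (pderivs (w @ v) \<phi> (real n *\<^sub>R z))"
      unfolding pderivs_append[symmetric] unfolding pderivs_dilate[OF schwartz_smooth[OF \<phi>]]
      by (simp add: q_def dilate_def norm_mult norm_power power_add)
    also have "\<dots> \<le> real n ^ q v * (B v / (1 + norm (real n *\<^sub>R z)) ^ q v)"
      by (intro mult_left_mono B) simp
    also have "\<dots> = B v * (real n / (1 + norm (real n *\<^sub>R z))) ^ q v"
      by (simp add: power_divide)
    also have "\<dots> \<le> B v * (1 / \<epsilon>) ^ q v"
      by (intro mult_left_mono power_mono ratio B) (simp add: add_pos_nonneg)
    also have "\<dots> \<le> D"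
      unfolding D_def using v \<epsilon> by (intro member_le_sum fin) (auto intro!: mult_nonneg_nonneg B)
    finally show "norm (pderivs v (pderivs w (dilate (real n) \<phi>)) (x - y)) \<le> D" by (simp add: z_def)
  qed
  then show ?thesis using D C_nonneg by (intro exI[of _ "C * D"]) auto
qed

text \<open>A pointwise Leibniz rule: the constant depends on \<eta> and the word, and
  \<open>f\<close> is controlled at the single point x. This locality later confines the estimate to
  the support of the cutoff.\<close>

lemma pderivs_mult_bound:
  fixes \<eta> :: "real ^ 'd::finite \<Rightarrow> complex"
  assumes "\<eta> \<in> bdd_smooth"
  shows "\<exists>B\<ge>0. \<forall>f\<in>smooth UNIV. \<forall>x M. (\<forall>v. length v \<le> length w \<longrightarrow> norm (pderivs v f x) \<le> M) \<longrightarrow>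
    norm (pderivs w (\<lambda>x. \<eta> x * f x) x) \<le> B * M"
  using assms
proof (induction w arbitrary: \<eta>)
  case Nil
  obtain B where B: "B \<ge> 0" "\<And>x. norm (\<eta> x) \<le> B" using bdd_smooth_bounded[OF Nil] by metis
  have "norm (\<eta> x * f x) \<le> B * M" if "norm (f x) \<le> M" for f :: "real ^ 'd \<Rightarrow> complex" and x M
    unfolding norm_mult using that B by (intro mult_mono) auto
  then show ?case using B(1) by (intro exI[of _ B]) auto
next
  case (Cons i w)
  obtain B1 where B1: "B1 \<ge> 0" "\<And>f x M. f \<in> smooth UNIV \<Longrightarrow> (\<forall>v. length v \<le> length w \<longrightarrow> norm (pderivs v f x) \<le> M) \<Longrightarrow>
    norm (pderivs w (\<lambda>x. \<eta> x * f x) x) \<le> B1 * M"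
    using Cons.IH[OF Cons.prems] by metis
  obtain B2 where B2: "B2 \<ge> 0" "\<And>f x M. f \<in> smooth UNIV \<Longrightarrow> (\<forall>v. length v \<le> length w \<longrightarrow> norm (pderivs v f x) \<le> M) \<Longrightarrow>
    norm (pderivs w (\<lambda>x. partial i \<eta> x * f x) x) \<le> B2 * M"
    using Cons.IH[OF bdd_smooth_partial[OF Cons.prems]] by metis
  note \<eta> = bdd_smooth_smooth[OF Cons.prems]
  have "norm (pderivs (i # w) (\<lambda>x. \<eta> x * f x) x) \<le> (B1 + B2) * M"
    if f: "f \<in> smooth UNIV" and M: "\<forall>v. length v \<le> length (i # w) \<longrightarrow> norm (pderivs v f x) \<le> M" for f x M
  proof -
    have "pderivs (i # w) (\<lambda>x. \<eta> x * f x) x = pderivs w (\<lambda>x. \<eta> x * partial i f x) x + pderivs w (\<lambda>x. partial i \<eta> x * f x) x"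
      unfolding pderivs_Cons partial_mult[OF \<eta> f]
      by (subst pderivs_add) (intro smooth_mult \<eta> f smooth_partial refl)+
    also have "norm \<dots> \<le> B1 * M + B2 * M"
    proof (intro norm_triangle_le add_mono B1(2) B2(2) f smooth_partial allI impI)
      show "norm (pderivs v (partial i f) x) \<le> M" if "length v \<le> length w" for v :: "'d list"
        using M[rule_format, of "i # v"] that by (simp add: pderivs_Cons)
      show "norm (pderivs v f x) \<le> M" if "length v \<le> length w" for v :: "'d list"
        using M that by simp
    qed
    finally show ?thesis by (simp add: distrib_right)
  qed
  then show ?case using B1(1) B2(1) by (intro exI[of _ "B1 + B2"]) auto
qed

lemma test_functions_mult:
  assumes "\<eta> \<in> test_functions \<Omega>" "f \<in> smooth UNIV"
  shows "(\<lambda>x. \<eta> x * f x) \<in> test_functions (closure {x. \<eta> x \<noteq> 0})" "(\<lambda>x. \<eta> x * f x) \<in> test_functions \<Omega>"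
proof -
  have sub: "closure {x. \<eta> x * f x \<noteq> 0} \<subseteq> closure {x. \<eta> x \<noteq> 0}" by (intro closure_mono) auto
  have c: "compact (closure {x. \<eta> x \<noteq> 0})" and s: "closure {x. \<eta> x \<noteq> 0} \<subseteq> \<Omega>" "\<eta> \<in> smooth UNIV"
    using assms(1) by (auto simp: test_functions_def)
  have "compact (closure {x. \<eta> x \<noteq> 0} \<inter> closure {x. \<eta> x * f x \<noteq> 0})"
    by (rule compact_Int_closed[OF c closed_closure])
  moreover have "closure {x. \<eta> x \<noteq> 0} \<inter> closure {x. \<eta> x * f x \<noteq> 0} = closure {x. \<eta> x * f x \<noteq> 0}"
    using sub by blast
  ultimately have c': "compact (closure {x. \<eta> x * f x \<noteq> 0})" by simp
  show "(\<lambda>x. \<eta> x * f x) \<in> test_functions (closure {x. \<eta> x \<noteq> 0})" "(\<lambda>x. \<eta> x * f x) \<in> test_functions \<Omega>"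
    unfolding test_functions_def using sub order_trans[OF sub s(1)] c' smooth_mult[OF s(2) assms(2)] by blast+
qed

text \<open>On the support of the cutoff the product is controlled by derivatives of
  \<open>f\<close> there, and outside it all derivatives of the product vanish. Hence the suprema in
  the estimate for \<open>T\<close> see \<open>f\<close> on that compact set alone.\<close>

lemma bounded_functional_cutoff:
  fixes T :: "'d::finite functional"
  assumes T: "T \<in> distributions \<Omega>" and \<eta>: "\<eta> \<in> test_functions \<Omega>"
  shows "\<exists>C N. bounded_functional (\<lambda>f. T (\<lambda>x. \<eta> x * f x)) (closure {x. \<eta> x \<noteq> 0}) C N"
proof -
  let ?K = "closure {x. \<eta> x \<noteq> 0}"
  have lin: "linear_on_space (test_functions \<Omega>) T"
    using T by (simp add: distributions_def)
  have K: "compact ?K" "?K \<subseteq> \<Omega>" and \<eta>s: "\<eta> \<in> schwartz"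
    using \<eta> test_function_schwartz[OF \<eta>] by (auto simp: test_functions_def)
  have "\<exists>C N. \<forall>f\<in>test_functions ?K. norm (T f) \<le> C * (\<Sum>m\<in>{m. mi_order m \<le> N}. SUP x. norm (mderiv m f x))"
    using T K by (simp add: distributions_def)
  then obtain C N where C: "\<forall>f\<in>test_functions ?K. norm (T f) \<le> C * (\<Sum>m\<in>{m. mi_order m \<le> N}. SUP x. norm (mderiv m f x))"
    by (elim exE)
  have "\<forall>w. \<exists>B\<ge>0. \<forall>f\<in>smooth UNIV. \<forall>x M. (\<forall>v. length v \<le> length w \<longrightarrow> norm (pderivs v f x) \<le> M) \<longrightarrow>
    norm (pderivs w (\<lambda>x. \<eta> x * f x) x) \<le> B * M"
    by (intro allI pderivs_mult_bound schwartz_bdd_smooth \<eta>s)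
  then obtain B where B: "\<And>w. B w \<ge> 0" "\<And>w f x M. f \<in> smooth UNIV \<Longrightarrow> (\<forall>v. length v \<le> length w \<longrightarrow> norm (pderivs v f x) \<le> M) \<Longrightarrow>
    norm (pderivs w (\<lambda>x. \<eta> x * f x) x) \<le> B w * M"
    by metis
  \<comment> \<open>The constant in the estimate for \<open>T\<close> may have any sign, hence the
    absolute value.\<close>
  define C' where "C' = \<bar>C\<bar> * (\<Sum>m\<in>{m. mi_order m \<le> N}. B (sorted_word m))"
  have "bounded_functional (\<lambda>f. T (\<lambda>x. \<eta> x * f x)) ?K C' N"
  proof
    show "0 \<le> C'" unfolding C'_def by (intro mult_nonneg_nonneg sum_nonneg B) auto
    show "T (\<lambda>x. \<eta> x * (a * f x + b * g x)) = a * T (\<lambda>x. \<eta> x * f x) + b * T (\<lambda>x. \<eta> x * g x)"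
      if "f \<in> bdd_smooth" "g \<in> bdd_smooth" for f g a b
    proof -
      have "T (\<lambda>x. a * (\<eta> x * f x) + b * (\<eta> x * g x)) = a * T (\<lambda>x. \<eta> x * f x) + b * T (\<lambda>x. \<eta> x * g x)"
        using lin[unfolded linear_on_space_def, rule_format,
          OF test_functions_mult(2)[OF \<eta> bdd_smooth_smooth[OF that(1)]] test_functions_mult(2)[OF \<eta> bdd_smooth_smooth[OF that(2)]]] .
      moreover have "(\<lambda>x. \<eta> x * (a * f x + b * g x)) = (\<lambda>x. a * (\<eta> x * f x) + b * (\<eta> x * g x))"
        by (simp add: fun_eq_iff algebra_simps)
      ultimately show ?thesis by simp
    qed
    fix f :: "real ^ 'd \<Rightarrow> complex" and M
    assume f: "f \<in> bdd_smooth" and M: "0 \<le> M" and fM: "\<And>w y. length w \<le> N \<Longrightarrow> y \<in> ?K \<Longrightarrow> norm (pderivs w f y) \<le> M"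
    let ?g = "\<lambda>x. \<eta> x * f x"
    have pt: "norm (mderiv m ?g x) \<le> B (sorted_word m) * M" if m: "mi_order m \<le> N" for m x
    proof (cases "x \<in> ?K")
      case True
      then show ?thesis
        unfolding mderiv_eq_pderivs using fM m
        by (intro B(2) bdd_smooth_smooth f) (auto simp: length_sorted_word)
    next
      case False
      have "?g y = 0" if "y \<in> - ?K" for y using that closure_subset[of "{x. \<eta> x \<noteq> 0}"] by auto
      then have "pderivs (sorted_word m) ?g x = 0"
        using False by (intro pderivs_eq_0[of "- ?K"]) auto
      then show ?thesis using M B(1) by (simp add: mderiv_eq_pderivs)
    qed
    have sup: "\<bar>SUP x. norm (mderiv m ?g x)\<bar> \<le> B (sorted_word m) * M" if m: "mi_order m \<le> N" for m
    proof -
      have "(SUP x. norm (mderiv m ?g x)) \<le> B (sorted_word m) * M" by (intro cSUP_least pt m) auto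
      moreover have "0 \<le> norm (mderiv m ?g 0)" by simp
      then have "0 \<le> (SUP x. norm (mderiv m ?g x))"
        by (rule order_trans) (rule cSUP_upper, use pt[OF m] in \<open>auto simp: bdd_above_def\<close>)
      ultimately show ?thesis by simp
    qed
    have "norm (T ?g) \<le> C * (\<Sum>m\<in>{m. mi_order m \<le> N}. SUP x. norm (mderiv m ?g x))"
      by (intro C[rule_format] test_functions_mult(1)[OF \<eta>] bdd_smooth_smooth f)
    also have "\<dots> \<le> \<bar>C\<bar> * \<bar>\<Sum>m\<in>{m. mi_order m \<le> N}. SUP x. norm (mderiv m ?g x)\<bar>"
      by (simp flip: abs_mult)
    also have "\<dots> \<le> \<bar>C\<bar> * (\<Sum>m\<in>{m. mi_order m \<le> N}. B (sorted_word m) * M)"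
      by (intro mult_left_mono order_trans[OF sum_abs] sum_mono sup) auto
    finally show "norm (T ?g) \<le> C' * M" by (simp add: C'_def sum_distrib_right mult.assoc)
  qed
  then show ?thesis by blast
qed

text \<open>The Schwartz seminorms with the trivial monomial already majorize the derivatives.
  Membership in \<open>zygmund\<close> includes this property.\<close>

lemma (in bounded_functional) tempered: "U \<in> tempered_distributions"
  unfolding tempered_distributions_def
proof (intro CollectI conjI exI ballI)
  show "linear_on_space schwartz U"
    unfolding linear_on_space_def using linear schwartz_bdd_smooth by blast
  fix f :: "real ^ 'd \<Rightarrow> complex" assume f: "f \<in> schwartz"
  let ?s = "\<lambda>a m. SUP x. norm (monomial a x *\<^sub>R mderiv m f x)"
  let ?M = "\<Sum>a\<in>{a. mi_order a \<le> N}. \<Sum>m\<in>{m. mi_order m \<le> N}. ?s a m"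
  have up: "norm (monomial a x *\<^sub>R mderiv m f x) \<le> ?s a m" for a m x
  proof (rule cSUP_upper)
    show "bdd_above (range (\<lambda>x. norm (monomial a x *\<^sub>R mderiv m f x)))"
      using f by (auto simp: schwartz_def bdd_above_def bounded_iff)
  qed simp
  have nn: "0 \<le> ?s a m" for a m by (rule order_trans[OF norm_ge_zero up[of a 0 m]])
  show "norm (U f) \<le> C * ?M"
  proof (rule bound[OF schwartz_bdd_smooth[OF f]])
    show "0 \<le> ?M" by (intro sum_nonneg nn)
    fix w :: "'d list" and y assume w: "length w \<le> N"
    let ?m = "count (mset w)" and ?a = "\<lambda>_::'d. 0::nat"
    have "norm (pderivs w f y) = norm (monomial ?a y *\<^sub>R mderiv ?m f y)"
      by (simp add: pderivs_eq_mderiv[OF schwartz_smooth[OF f]] monomial_def)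
    also have "\<dots> \<le> ?s ?a ?m" by (rule up)
    also have "\<dots> \<le> (\<Sum>m\<in>{m. mi_order m \<le> N}. ?s ?a m)"
      using w by (intro member_le_sum nn finite_mi_order) (auto simp: mi_order_count)
    also have "\<dots> \<le> ?M"
    proof (rule member_le_sum[where f = "\<lambda>a. \<Sum>m\<in>{m. mi_order m \<le> N}. ?s a m"])
      show "?a \<in> {a. mi_order a \<le> N}" by (simp add: mi_order_def)
    qed (intro sum_nonneg nn finite_mi_order)+
    finally show "norm (pderivs w f y) \<le> ?M" .
  qed
qed

text \<open>On a compact neighbourhood of \<open>K\<close> in \<Omega> the class gives the bound;
  elsewhere the distance to \<open>K\<close> is at least \<epsilon> and the functions are bounded
  uniformly in n. The finitely many small n, on which an O-condition is silent, are covered by the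
  boundedness of each single function.\<close>

lemma (in bounded_functional) seq_class_imp_global_bound:
  fixes \<phi> :: "real ^ 'd \<Rightarrow> complex"
  assumes \<Omega>: "open \<Omega>" "compact K" "K \<subseteq> \<Omega>" and \<phi>: "\<phi> \<in> schwartz" and s: "s > 0"
    and seq: "(\<lambda>n. dist_conv U (dilate (real n) \<phi>)) \<in> seq_class k s \<Omega>" and w: "length w = k"
  shows "\<exists>A\<ge>0. \<forall>n\<ge>1. \<forall>x. norm (dist_conv U (pderivs w (dilate (real n) \<phi>)) x) \<le> A * real n powr s"
proof -
  note b = schwartz_bdd_smooth schwartz_dilate schwartz_pderivs
  obtain \<epsilon> where \<epsilon>: "\<epsilon> > 0" "(\<Union>x\<in>K. cball x \<epsilon>) \<subseteq> \<Omega>"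
    using compact_subset_open_imp_cball_epsilon_subset[OF \<Omega>(2,1,3)] by metis
  \<comment> \<open>The closed \<epsilon>-neighbourhood of \<open>K\<close>, written as a sum of two
    compact sets.\<close>
  define \<omega> where "\<omega> = {y + z |y z. y \<in> K \<and> z \<in> cball 0 \<epsilon>}"
  have "compact \<omega>" unfolding \<omega>_def by (intro compact_sums \<Omega> compact_cball)
  moreover have "\<omega> \<subseteq> (\<Union>x\<in>K. cball x \<epsilon>)" unfolding \<omega>_def by (auto simp: dist_norm)
  ultimately have \<omega>: "compact (closure \<omega>)" "closure \<omega> \<subseteq> \<Omega>"
    using \<epsilon>(2) by (auto simp: compact_imp_closed)
  have out: "\<epsilon> \<le> norm (x - y)" if "x \<notin> \<omega>" "y \<in> K" for x y
  proof (rule ccontr)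
    assume "\<not> \<epsilon> \<le> norm (x - y)"
    then have "x = y + (x - y) \<and> y \<in> K \<and> x - y \<in> cball 0 \<epsilon>" using that by simp
    then have "x \<in> \<omega>" unfolding \<omega>_def by blast
    with that show False by simp
  qed
  let ?F = "\<lambda>n. dist_conv U (pderivs w (dilate (real n) \<phi>))"
  have F: "pderivs w (dist_conv U (dilate (real n) \<phi>)) = ?F n" "dist_conv U (dilate (real n) \<phi>) \<in> smooth UNIV" if "n \<ge> 1" for n
    using that by (intro pderivs_dist_conv dist_conv_smooth b \<phi>; simp)+
  obtain C1 where "\<forall>\<^sub>F n in sequentially. \<forall>x\<in>\<omega>. norm (mderiv (count (mset w)) (dist_conv U (dilate (real n) \<phi>)) x) \<le> C1 * real n powr s"
    using seq \<omega> w mi_order_count[of w] unfolding seq_class_def by fastforce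
  then obtain n0 where n0: "\<And>n x. n \<ge> n0 \<Longrightarrow> x \<in> \<omega> \<Longrightarrow>
      norm (mderiv (count (mset w)) (dist_conv U (dilate (real n) \<phi>)) x) \<le> C1 * real n powr s"
    unfolding eventually_sequentially by blast
  obtain D where D: "D \<ge> 0" "\<And>n x. n \<ge> 1 \<Longrightarrow> (\<forall>y\<in>K. \<epsilon> \<le> norm (x - y)) \<Longrightarrow> norm (?F n x) \<le> D"
    using dilate_bound_away_from_support[OF \<phi> \<epsilon>(1), of w] by metis
  have "\<forall>n. \<exists>M\<ge>0. n \<ge> 1 \<longrightarrow> (\<forall>x. norm (?F n x) \<le> M)"
  proof
    fix n :: nat
    show "\<exists>M\<ge>0. n \<ge> 1 \<longrightarrow> (\<forall>x. norm (?F n x) \<le> M)"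
    proof (cases "n \<ge> 1")
      case True
      then have "pderivs w (dilate (real n) \<phi>) \<in> bdd_smooth" by (intro b \<phi>) simp
      from dist_conv_lipschitz[OF this] show ?thesis by metis
    qed auto
  qed
  then obtain M where M: "\<And>n. M n \<ge> 0" "\<And>n x. n \<ge> 1 \<Longrightarrow> norm (?F n x) \<le> M n" by metis
  \<comment> \<open>One summand for each of the three cases; constants become multiples of n^s
    because n^s \<ge> 1.\<close>
  define A where "A = \<bar>C1\<bar> + D + (\<Sum>n<n0. M n)"
  have S0: "0 \<le> (\<Sum>n<n0. M n)" by (intro sum_nonneg M)
  have "norm (?F n x) \<le> A * real n powr s" if n: "n \<ge> 1" for n x
  proof -
    have n1: "1 \<le> real n powr s" using n s by (intro ge_one_powr_ge_zero) auto
    consider "n < n0" | "n \<ge> n0" "x \<in> \<omega>" | "x \<notin> \<omega>" by linarith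
    then have "norm (?F n x) \<le> \<bar>C1\<bar> * real n powr s \<or> norm (?F n x) \<le> D \<or> norm (?F n x) \<le> (\<Sum>n<n0. M n)"
    proof cases
      case 1
      have "M n \<le> (\<Sum>n<n0. M n)" using 1 M(1) by (intro member_le_sum) auto
      then show ?thesis using M(2)[OF n, of x] by linarith
    next
      case 2
      have "norm (?F n x) \<le> C1 * real n powr s"
        using n0[OF 2] by (simp only: pderivs_eq_mderiv[OF F(2)[OF n], symmetric] F(1)[OF n])
      also have "\<dots> \<le> \<bar>C1\<bar> * real n powr s" by (intro mult_right_mono) auto
      finally show ?thesis by simp
    next
      case 3
      then show ?thesis using D(2)[OF n, of x] out by blast
    qed
    moreover have "c \<le> c * real n powr s" if "c \<ge> 0" for c
      using mult_left_mono[OF n1 that] by simp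
    note this[OF D(1)] this[OF S0]
    moreover have "0 \<le> \<bar>C1\<bar> * real n powr s" by simp
    ultimately show ?thesis using D(1) S0 unfolding A_def distrib_right by linarith
  qed
  moreover have "A \<ge> 0" using D(1) S0 by (simp add: A_def)
  ultimately show ?thesis by blast
qed

theorem theorem4p2:
  fixes \<Omega> :: "(real ^ 'd::finite) set"
    and T :: "'d functional"
    and \<phi> \<theta>1 \<theta> :: "real ^ 'd \<Rightarrow> complex"
    and k :: nat and s \<epsilon> :: real
  assumes "open \<Omega>"
    and "T \<in> compact_distributions \<Omega>"
    and "s > 0"
    and "\<phi> \<in> schwartz" and "(LINT x|lborel. \<phi> x) = 1"
    and "zygmund_window (real k - s) \<epsilon> \<theta>1 \<theta>"
  shows "(\<lambda>n. dist_conv (zero_extension \<Omega> T) (dilate (real n) \<phi>)) \<in> seq_class k s \<Omega>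
    \<longleftrightarrow> zero_extension \<Omega> T \<in> zygmund (real k - s) \<theta>1 \<theta>"
proof -
  let ?S = "zero_extension \<Omega> T" and ?\<eta> = "cutoff \<Omega> T" and ?\<beta> = "real k - s"
  let ?K = "closure {x. ?\<eta> x \<noteq> 0}"
  note \<phi> = assms(4) and s = assms(3)
  have T: "T \<in> distributions \<Omega>" "compact (dist_support \<Omega> T)" "dist_support \<Omega> T \<subseteq> \<Omega>"
    using assms(2) by (auto simp: compact_distributions_def dist_support_def)
  \<comment> \<open>\<open>cutoff\<close> is a choice; compactness of the support inside the open
    set \<Omega> provides the witness.\<close>
  have \<eta>: "?\<eta> \<in> test_functions \<Omega>"
    using someI_ex[OF exists_test_function_eq_1[OF T(2) assms(1) T(3)]] by (simp add: cutoff_def)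
  then have K: "compact ?K" "?K \<subseteq> \<Omega>" by (auto simp: test_functions_def)
  obtain C N where "bounded_functional ?S ?K C N"
    using bounded_functional_cutoff[OF T(1) \<eta>] unfolding zero_extension_def[abs_def] by metis
  then interpret S: bounded_functional ?S ?K C N .
  note b = schwartz_bdd_smooth schwartz_dilate schwartz_pderivs
  have \<theta>: "\<epsilon> > 0" "\<theta>1 \<in> schwartz" "\<theta> \<in> schwartz"
    "\<And>u. \<epsilon> / 2 \<le> norm u \<Longrightarrow> norm u \<le> 2 * \<epsilon> \<Longrightarrow> fourier \<theta> u \<noteq> 0"
    "\<And>m. int (mi_order m) \<le> \<lfloor>?\<beta>\<rfloor> \<Longrightarrow> (LINT x|lborel. monomial m x *\<^sub>R \<theta> x) = 0"
    using assms(6) by (auto simp: zygmund_window_def)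
  show ?thesis
  proof
    assume seq: "(\<lambda>n. dist_conv ?S (dilate (real n) \<phi>)) \<in> seq_class k s \<Omega>"
    have "\<forall>w. \<exists>A\<ge>0. length w = k \<longrightarrow> (\<forall>n\<ge>1. \<forall>x. norm (dist_conv ?S (pderivs w (dilate (real n) \<phi>)) x) \<le> A * real n powr s)"
      using S.seq_class_imp_global_bound[OF assms(1) K \<phi> s seq] by (metis order_refl)
    then obtain A where A: "\<And>w. A w \<ge> 0" "\<And>w n x. length w = k \<Longrightarrow> n \<ge> 1 \<Longrightarrow>
        norm (dist_conv ?S (pderivs w (dilate (real n) \<phi>)) x) \<le> A w * real n powr s"
      by metis
    have fin: "finite {w :: 'd list. length w = k}"
      using finite_lists_length_eq[OF finite_class.finite_UNIV, of k] by simp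
    \<comment> \<open>For \<beta> \<ge> 0 this is the least integer above \<beta>, and the moments
      of smaller degree are exactly those known to vanish; for \<beta> < 0 it is 0 and asks for no
      moments.\<close>
    define r where "r = nat (\<lfloor>?\<beta>\<rfloor> + 1)"
    have "\<exists>D. \<forall>j x. norm (dist_conv ?S (dilate (2 ^ j) \<theta>) x) \<le> D * 2 powr (- ?\<beta> * real j)"
    proof (rule S.regularization_imp_zygmund_bound[OF \<phi> assms(5) \<theta>(3)])
      show "(LINT x|lborel. monomial m x *\<^sub>R \<theta> x) = 0" if "mi_order m < r" for m
        using that by (intro \<theta>(5)) (simp add: r_def)
      have "?\<beta> < of_int (\<lfloor>?\<beta>\<rfloor> + 1)" by linarith
      also have "\<dots> \<le> of_int (int r)" unfolding of_int_le_iff by (simp add: r_def)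
      finally show "?\<beta> < real r" by simp
      fix w :: "'d list" and n :: nat and x assume w: "length w = k" and n: "n \<ge> 1"
      \<comment> \<open>Finitely many words have length \<open>k\<close>, so summing gives one
        constant for all of them.\<close>
      have "A w \<le> (\<Sum>w\<in>{w. length w = k}. A w)" using w A(1) by (intro member_le_sum fin) auto
      then show "norm (dist_conv ?S (pderivs w (dilate (real n) \<phi>)) x) \<le> (\<Sum>w\<in>{w. length w = k}. A w) * real n powr s"
        by (intro order_trans[OF A(2)[OF w n]] mult_right_mono) auto
    qed
    then obtain D where D: "\<And>j x. norm (dist_conv ?S (dilate (2 ^ j) \<theta>) x) \<le> D * 2 powr (- ?\<beta> * real j)" by metis
    obtain M where M: "\<And>x. norm (dist_conv ?S \<theta>1 x) \<le> M" using S.dist_conv_lipschitz[OF b(1)[OF \<theta>(2)]] by metis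
    \<comment> \<open>The term j = 0 involves \<theta>1 in place of \<theta> and is bounded
      separately by M.\<close>
    have "2 powr (?\<beta> * real j) * norm (dist_conv ?S (dyadic \<theta>1 \<theta> j) x) \<le> max M D" for x j
    proof (cases "j = 0")
      case True
      then show ?thesis using M[of x] by (simp add: dyadic_def)
    next
      case False
      have "2 powr (?\<beta> * real j) * norm (dist_conv ?S (dilate (2 ^ j) \<theta>) x) \<le> 2 powr (?\<beta> * real j) * (D * 2 powr (- ?\<beta> * real j))"
        by (intro mult_left_mono D) simp
      also have "\<dots> = D * (2 powr (?\<beta> * real j) * 2 powr (- ?\<beta> * real j))" by (simp only: mult_ac)
      also have "2 powr (?\<beta> * real j) * 2 powr (- ?\<beta> * real j) = 1" unfolding powr_add[symmetric] by (simp add: algebra_simps)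
      finally show ?thesis using False by (simp add: dyadic_def)
    qed
    then show "?S \<in> zygmund ?\<beta> \<theta>1 \<theta>"
      using S.tempered by (auto simp: zygmund_def bdd_above_def)
  next
    assume "?S \<in> zygmund ?\<beta> \<theta>1 \<theta>"
    then obtain A where A: "\<And>x j. 2 powr (?\<beta> * real j) * norm (dist_conv ?S (dyadic \<theta>1 \<theta> j) x) \<le> A"
      by (auto simp: zygmund_def bdd_above_def)
    \<comment> \<open>The case j = 0 concerns \<theta>1 and says nothing about \<theta>; the annular
      pieces of the decomposition start at l = 1.\<close>
    have A': "norm (dist_conv ?S (dilate (2 ^ j) \<theta>) x) \<le> A * 2 powr (- ?\<beta> * real j)" if "j \<ge> 1" for j x
    proof -
      have "2 powr (- ?\<beta> * real j) * (2 powr (?\<beta> * real j) * norm (dist_conv ?S (dyadic \<theta>1 \<theta> j) x)) \<le> 2 powr (- ?\<beta> * real j) * A"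
        by (intro mult_left_mono A) simp
      moreover have "2 powr (- ?\<beta> * real j) * 2 powr (?\<beta> * real j) = 1" unfolding powr_add[symmetric] by (simp add: algebra_simps)
      ultimately have "norm (dist_conv ?S (dyadic \<theta>1 \<theta> j) x) \<le> 2 powr (- ?\<beta> * real j) * A"
        by (simp only: mult.assoc[symmetric] mult_1_left)
      then show ?thesis using that by (simp add: dyadic_def mult.commute)
    qed
    have sm: "dist_conv ?S (dilate (real n) \<phi>) \<in> smooth UNIV" if "n \<ge> 1" for n
      using that by (intro S.dist_conv_smooth b \<phi>) simp
    show "(\<lambda>n. dist_conv ?S (dilate (real n) \<phi>)) \<in> seq_class k s \<Omega>"
      unfolding seq_class_def
    proof (intro CollectI conjI allI impI)
      show "dist_conv ?S (dilate (real n) \<phi>) \<in> Ck k \<Omega>" if "1 \<le> n" for n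
        by (rule Ck_subset[OF smooth_CkD[OF sm[OF that]] subset_UNIV])
      fix \<omega> :: "(real ^ 'd) set" and m :: "'d multi_index"
      assume m: "compact (closure \<omega>) \<and> closure \<omega> \<subseteq> \<Omega> \<and> mi_order m \<le> k"
      then have "length (sorted_word m) \<le> k" by (simp add: length_sorted_word)
      from S.zygmund_imp_regularization_bound[OF \<phi> \<theta>(3,1,4) A' s this]
      obtain D where D: "\<And>n x. n \<ge> 1 \<Longrightarrow> norm (dist_conv ?S (pderivs (sorted_word m) (dilate (real n) \<phi>)) x) \<le> D * real n powr s"
        by metis
      have "norm (mderiv m (dist_conv ?S (dilate (real n) \<phi>)) x) \<le> D * real n powr s" if "n \<ge> 1" for n x
        using D[OF that] that by (simp add: mderiv_eq_pderivs S.pderivs_dist_conv b \<phi>)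
      then show "\<exists>C. \<forall>\<^sub>F n in sequentially. \<forall>x\<in>\<omega>. norm (mderiv m (dist_conv ?S (dilate (real n) \<phi>)) x) \<le> C * real n powr s"
        unfolding eventually_sequentially by blast
    qed
  qed
qed

end
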